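(* Let $\mathcal D$ be a bipartite diagram of an oriented link $\mathcal L$, equipped with a checkerboard colouring of its regions, and let $\mathcal G$ be a reduced quaternary Goeritz matrix of $\mathcal D$ for this colouring (obtained by deleting the row and column of any one white region). Let $N_\bullet$ and $N_\circ$ be the numbers of $\bullet$-locks and $\circ$-locks of $\mathcal D$, and let $N^v_\bullet,N^h_\bullet,N^v_\circ,N^h_\circ$ be the numbers of self-locks of white regions of the corresponding kinds. Then the HOMFLY--PT polynomial of $\mathcal L$ is $$H^{\mathcal L}=A^{-2(N_\bullet-N_\bullet^v-N_\circ+N_\circ^v)}\,\phi^{(N_\bullet-N_\bullet^h-N_\bullet^v)/2}\,\bar\phi^{(N_\circ-N_\circ^h-N_\circ^v)/2}\,(\phi+D_N)^{N_\bullet^h}\,(\bar\phi+D_N)^{N_\circ^h}\,\mathcal M[\mathcal G],$$ where $\mathcal M[\mathcal G]$ is computed by the recursion given in the context.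
   Context: **Variables.** $A,q$ are formal variables, $\{x\}=x-x^{-1}$, $D_N=\{A\}/\{q\}$, $\phi=A\{q\}$, $\bar\phi=-A^{-1}\{q\}$; square roots $\phi^{1/2},\bar\phi^{1/2}$ are fixed once and for all in an extension field of $\mathbb Q(A,q)$. **HOMFLY--PT polynomial.** A crossing whose two strands are both drawn pointing upwards is called positive if the over-strand runs from lower right to upper left, and negative if the over-strand runs from lower left to upper right. $H$ is the oriented link invariant with $H(\text{unknot})=D_N$ and $A\,H(L_+)-A^{-1}H(L_-)=(q-q^{-1})H(L_0)$, where $L_+,L_-,L_0$ differ only near one crossing, which is respectively positive, negative, or replaced by its oriented smoothing. **Locks and bipartite diagrams.** A lock is a tangle in a disc consisting of two strands twisted around each other with exactly two crossings of the same sign, the strands being antiparallel: placing the two crossings side by side horizontally, each strand runs across the disc between its left and right sides, one from left to right and the other from right to left. It is a $\bullet$-lock if both crossings are positive and a $\circ$-lock if both are negative. The exterior of the two strands has four corners on the boundary of the disc: two end corners (left and right, at the two ends of the twist) and two lateral corners (top and bottom). A bipartite diagram is an oriented link diagram in the plane together with pairwise disjoint discs, each meeting the diagram in a lock, such that all crossings lie in these discs. Contract every lock disc to a $4$-valent vertex; the connected components of the complement in the plane of the resulting figure, including the unbounded one, are the regions. A checkerboard colouring colours them black and white so that regions sharing an edge have different colours. At each lock either the two end corners are white and the lateral ones black, or conversely. **Types.** With respect to the colouring, a lock is: positive vertical if it is a $\bullet$-lock with white end corners; positive horizontal if it is a $\circ$-lock with white lateral corners; negative vertical if it is a $\circ$-lock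 with white end corners; negative horizontal if it is a $\bullet$-lock with white lateral corners. **Self-locks.** A self-lock is a lock whose two white corners belong to the same white region. $N^v_\bullet$ (resp. $N^v_\circ$) is the number of $\bullet$- (resp. $\circ$-) self-locks whose white corners are the lateral corners; $N^h_\bullet$ (resp. $N^h_\circ$) is the number of $\bullet$- (resp. $\circ$-) self-locks whose white corners are the end corners. **Quaternary Goeritz matrix.** Number the white regions $1,\dots,n$. Entries lie in $\mathbb Z^4$ and are written $\mathfrak g=(x,y,z,t)$ (also written $x+\widetilde y+\overline z+\widehat t$), with componentwise addition. For $i\ne j$, $\widetilde{\mathfrak g}_{ij}=(x_{ij},y_{ij},z_{ij},t_{ij})$, where among the locks whose two white corners lie one in region $i$ and one in region $j$: $x_{ij}$ is the number of positive vertical ones, $y_{ij}$ the number of positive horizontal ones, $-z_{ij}$ the number of negative vertical ones, $-t_{ij}$ the number of negative horizontal ones. Also $\widetilde{\mathfrak g}_{jj}=-\sum_{k\ne j}\widetilde{\mathfrak g}_{kj}$. The reduced matrix $\mathcal G$ is obtained by deleting the $k$-th row and column for some $k$; it has size $n-1$ (it is $\varnothing$ if $n=1$). **Coefficients.** $$P_x=\sum_{k=1}^{|x|}\binom{|x|}{k}D_N^{k-1}\phi^{|x|/2-k},\quad \widetilde P_y=\sum_{k=1}^{|y|}\binom{|y|}{k}D_N^{k-1}\bar\phi^{\,k-|y|/2},$$ $$\overline P_z=\sum_{k=1}^{|z|}\binom{|z|}{k}D_N^{k-1}\bar\phi^{\,|z|/2-k},\quad \widehat P_t=\sum_{k=1}^{|t|}\binom{|t|}{k}D_N^{k-1}\phi^{\,k-|t|/2}.$$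 For $\mathfrak g=(x,y,z,t)$ put $$\mathcal U_1[\mathfrak g]=\phi^{(x+t)/2}\bar\phi^{-(y+z)/2},$$ $$\mathcal U_2[\mathfrak g]=\phi^{t/2}\bar\phi^{-(y+z)/2}P_x+\bigl(\phi^{x/2}+D_NP_x\bigr)\Bigl[\bigl(\bar\phi^{-y/2}+D_N\widetilde P_{-y}\bigr)\bigl(\bar\phi^{-z/2}\widehat P_t+\phi^{t/2}\overline P_{-z}+D_N\overline P_{-z}\widehat P_t\bigr)+\phi^{t/2}\bar\phi^{-z/2}\widetilde P_{-y}\Bigr],$$ $$\mathscr D[\mathfrak g]=\phi^{-(x+t)/2}\bar\phi^{(y+z)/2}D_N+\phi^{-t/2}\bar\phi^{(y+z)/2}P_{-x}+\bigl(\phi^{-x/2}+D_NP_{-x}\bigr)\Bigl[\bigl(\bar\phi^{y/2}+D_N\widetilde P_y\bigr)\bigl(\bar\phi^{z/2}\widehat P_{-t}+\phi^{-t/2}\overline P_z+D_N\overline P_z\widehat P_{-t}\bigr)+\phi^{-t/2}\bar\phi^{z/2}\widetilde P_y\Bigr].$$ **Recursion for $\mathcal M$.** (1) If $\mathcal G$ has a nonzero off-diagonal entry $\mathfrak g_{ij}$, choose one; then $\mathcal M[\mathcal G]=\mathcal U_1[\mathfrak g_{ij}]\,\mathcal M[\mathcal G^{(I)}]+\mathcal U_2[\mathfrak g_{ij}]\,\mathcal M[\mathcal G^{(II)}]$. Here $\mathcal G^{(I)}$ is obtained from $\mathcal G$ by replacing $\mathfrak g_{ii}\mapsto \mathfrak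 g_{ii}+\mathfrak g_{ij}$, $\mathfrak g_{jj}\mapsto\mathfrak g_{jj}+\mathfrak g_{ij}$, $\mathfrak g_{ij},\mathfrak g_{ji}\mapsto 0$. And $\mathcal G^{(II)}$ is obtained by replacing $\mathfrak g_{ii}\mapsto\mathfrak g_{ii}+\mathfrak g_{jj}+2\mathfrak g_{ij}$, $\mathfrak g_{ik}\mapsto\mathfrak g_{ik}+\mathfrak g_{jk}$ and $\mathfrak g_{ki}\mapsto\mathfrak g_{ki}+\mathfrak g_{kj}$ for $k\ne i,j$, and then deleting the $j$-th row and column. (2) If $\mathcal G$ is diagonal and nonempty, choose a diagonal entry $\mathfrak g_i$; then $\mathcal M[\mathcal G]=\mathscr D[\mathfrak g_i]\,\mathcal M[\mathcal G^{(III)}]$, where $\mathcal G^{(III)}$ is $\mathcal G$ with the $i$-th row and column deleted. (3) $\mathcal M[\varnothing]=D_N$.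
   Formalization: Every white region is additionally assumed simply connected on the sphere (automatic for connected diagrams); for two lock-free circles side by side with white outer region the formula gives D_N instead of D_N^2. *)

theory Defs
  imports "HOL-Library.Multiset" "HOL-Library.Product_Plus" "HOL-Computational_Algebra.Polynomial"
begin

section \<open>Variables\<close>

text \<open>\<open>A\<close> and \<open>q\<close> are formal variables inside an extension field of \<open>\<rat>(A,q)\<close>:
  no nonzero rational polynomial in two variables vanishes at \<open>(A,q)\<close>.\<close>

definition formal_variables :: "'k::field_char_0 \<Rightarrow> 'k \<Rightarrow> bool" where
  "formal_variables A q \<longleftrightarrow>
     (\<forall>p :: rat poly poly. p \<noteq> 0 \<longrightarrow>
        poly (map_poly (\<lambda>c. poly (map_poly of_rat c) q) p) A \<noteq> 0)"

definition braces :: "'k::field \<Rightarrow> 'k" where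
  "braces x = x - inverse x"

definition DN :: "'k::field \<Rightarrow> 'k \<Rightarrow> 'k" where
  "DN A q = braces A / braces q"

definition phi :: "'k::field \<Rightarrow> 'k \<Rightarrow> 'k" where
  "phi A q = A * braces q"

definition phibar :: "'k::field \<Rightarrow> 'k \<Rightarrow> 'k" where
  "phibar A q = - inverse A * braces q"


section \<open>Oriented figures in the sphere\<close>

text \<open>
  Diagrams are planar-diagram codes. A figure is a finite collection of vertices joined by oriented
  edges; edges are named by natural numbers.

  \<^item> \<open>Crossing s a b c d\<close>: drawn with both strands pointing upwards, \<open>a\<close>, \<open>b\<close> enter at the lower
    left and lower right, \<open>c\<close>, \<open>d\<close> leave at the upper left and upper right. The strands are
    \<open>a \<rightarrow> d\<close> and \<open>b \<rightarrow> c\<close>. For \<open>s = True\<close> (positive) \<open>b \<rightarrow> c\<close> is the over-strand, for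
    \<open>s = False\<close> (negative) \<open>a \<rightarrow> d\<close> is.
  \<^item> \<open>Bend a b\<close>: a two-valent point of a strand, where edge \<open>a\<close> is continued by edge \<open>b\<close>.
    \<open>Bend a a\<close> is a circle without crossings.
  \<^item> \<open>Lock s l i1 o1 i2 o2 u v\<close>: a lock contracted to a four-valent vertex, with strands
    \<open>i1 \<rightarrow> o1\<close> and \<open>i2 \<rightarrow> o2\<close> and both crossings of sign \<open>s\<close>, so \<open>s = True\<close> is a
    \<open>\<bullet>\<close>-lock. For \<open>l = True\<close> the lateral corners are to the left of the strands and the end
    corners to the right (twist horizontal, upper strand running to the right, lower one to the
    left); for \<open>l = False\<close> it is the other way round. \<open>u\<close>, \<open>v\<close> name the two edges between the
    two crossings inside the disc; they only appear once the lock is expanded.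
\<close>

datatype vertex =
    Crossing bool nat nat nat nat
  | Bend nat nat
  | Lock bool bool nat nat nat nat nat nat

type_synonym figure = "vertex multiset"

fun ins :: "vertex \<Rightarrow> nat multiset" where
  "ins (Crossing s a b c d) = {#a, b#}"
| "ins (Bend a b) = {#a#}"
| "ins (Lock s l i1 o1 i2 o2 u v) = {#i1, i2#}"

fun outs :: "vertex \<Rightarrow> nat multiset" where
  "outs (Crossing s a b c d) = {#c, d#}"
| "outs (Bend a b) = {#b#}"
| "outs (Lock s l i1 o1 i2 o2 u v) = {#o1, o2#}"

definition edges :: "figure \<Rightarrow> nat set" where
  "edges F = set_mset (\<Sum>\<^sub># (image_mset ins F))"

text \<open>Every edge leaves exactly one vertex and enters exactly one vertex.\<close>

definition closed_figure :: "figure \<Rightarrow> bool" where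
  "closed_figure F \<longleftrightarrow>
     \<Sum>\<^sub># (image_mset ins F) = \<Sum>\<^sub># (image_mset outs F) \<and>
     (\<forall>e. count (\<Sum>\<^sub># (image_mset ins F)) e \<le> 1)"

text \<open>A side \<open>(e, True)\<close> is the left side of the edge \<open>e\<close>, \<open>(e, False)\<close> its right side. Each
  corner of a vertex joins the facing sides of the two edges that bound it.\<close>

type_synonym side = "nat \<times> bool"

definition sides :: "figure \<Rightarrow> side set" where
  "sides F = edges F \<times> UNIV"

fun corners :: "vertex \<Rightarrow> (side \<times> side) set" where
  "corners (Crossing s a b c d) =
     {((a, False), (b, True)), ((c, False), (d, True)),
      ((a, True), (c, True)), ((b, False), (d, False))}"
| "corners (Bend a b) = {((a, True), (b, True)), ((a, False), (b, False))}"
| "corners (Lock s l i1 o1 i2 o2 u v) =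
     {((i1, \<not> l), (o2, \<not> l)), ((i2, \<not> l), (o1, \<not> l)),
      ((i1, l), (o1, l)), ((i2, l), (o2, l))}"

definition corner_rel :: "figure \<Rightarrow> (side \<times> side) set" where
  "corner_rel F = (\<Union>x\<in>set_mset F. corners x)"

definition same_face :: "figure \<Rightarrow> (side \<times> side) set" where
  "same_face F = (corner_rel F \<union> (corner_rel F)\<inverse>)\<^sup>*"

definition same_component :: "figure \<Rightarrow> (nat \<times> nat) set" where
  "same_component F =
     (\<Union>x\<in>set_mset F. set_mset (ins x + outs x) \<times> set_mset (ins x + outs x))\<^sup>*"

definition num_faces :: "figure \<Rightarrow> nat" where
  "num_faces F = card (sides F // same_face F)"

definition num_components :: "figure \<Rightarrow> nat" where
  "num_components F = card (edges F // same_component F)"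

text \<open>Genus zero: every connected component of the figure is drawn on a sphere, as expressed by
  Euler's formula (faces being counted separately for each component).\<close>

definition spherical :: "figure \<Rightarrow> bool" where
  "spherical F \<longleftrightarrow> size F + num_faces F = card (edges F) + 2 * num_components F"


section \<open>Link diagrams and the HOMFLY--PT polynomial\<close>

text \<open>The mutual position of the connected components of a split diagram does not influence the
  link type and is not recorded here; it is recorded by \<open>region_map\<close> below, where it matters.\<close>

definition link_diagram :: "figure \<Rightarrow> bool" where
  "link_diagram D \<longleftrightarrow>
     closed_figure D \<and> spherical D \<and>
     (\<forall>s l i1 o1 i2 o2 u v. Lock s l i1 o1 i2 o2 u v \<notin># D)"

fun rename :: "(nat \<Rightarrow> nat) \<Rightarrow> vertex \<Rightarrow> vertex" where
  "rename f (Crossing s a b c d) = Crossing s (f a) (f b) (f c) (f d)"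
| "rename f (Bend a b) = Bend (f a) (f b)"
| "rename f (Lock s l i1 o1 i2 o2 u v) = Lock s l (f i1) (f o1) (f i2) (f o2) (f u) (f v)"

text \<open>
  The first two moves only change the encoding. The others are all oriented Reidemeister moves:
  the kinks of either sign with the loop on the left or on the right; the parallel bigon and the
  antiparallel bigon lying to the left or to the right of its edges; the triangle with all
  strands pointing upwards, and the coherently oriented triangle. In \<open>R3_braid\<close>, \<open>sij\<close> says that
  strand \<open>j\<close> passes over strand \<open>i\<close>, the strands being numbered from the left at the bottom; in
  \<open>R3_cyclic\<close>, strand \<open>k\<close> runs from \<open>ik\<close> to \<open>ok\<close>, and again \<open>sij\<close> says that strand \<open>j\<close> passes
  over strand \<open>i\<close>. The side conditions say that the three strands lie at three different heights.
\<close>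

inductive move :: "figure \<Rightarrow> figure \<Rightarrow> bool" where
  relabel: "inj_on f (edges D) \<Longrightarrow> move D (image_mset (rename f) D)"
| contract: "a \<noteq> b \<Longrightarrow>
    move (D + {#Bend a b#}) (image_mset (rename (\<lambda>e. if e = b then a else e)) D)"
| R1_left: "move (D + {#Crossing s x b x d#}) (D + {#Bend b d#})"
| R1_right: "move (D + {#Crossing s a x c x#}) (D + {#Bend a c#})"
| R2_parallel:
    "move (D + {#Crossing s a b u v, Crossing (\<not> s) u v c d#}) (D + {#Bend a c, Bend b d#})"
| R2_left:
    "move (D + {#Crossing s u a v c, Crossing (\<not> s) v b u d#}) (D + {#Bend a d, Bend b c#})"
| R2_right:
    "move (D + {#Crossing s a u c v, Crossing (\<not> s) b v d u#}) (D + {#Bend a d, Bend b c#})"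
| R3_braid: "(s12 = s23 \<longrightarrow> s13 = s12) \<Longrightarrow>
    move (D + {#Crossing s12 a b x y, Crossing s13 y c z f, Crossing s23 x z d e#})
         (D + {#Crossing s23 b c x' y', Crossing s13 a x' d z', Crossing s12 z' y' e f#})"
| R3_cyclic: "\<not> (s12 = s23 \<and> s23 = s31) \<Longrightarrow>
    move (D + {#Crossing s12 x1 i2 x2 o1, Crossing s23 x2 i3 x3 o2, Crossing s31 x3 i1 x1 o3#})
         (D + {#Crossing s12 i1 y2 o2 y1, Crossing s23 i2 y3 o3 y2, Crossing s31 i3 y1 o1 y3#})"

text \<open>An oriented link invariant is a function of link diagrams unchanged by the moves. In the skein
  relation, \<open>L\<^sub>-\<close> and \<open>L\<^sub>0\<close> are link diagrams as soon as \<open>L\<^sub>+\<close> is.\<close>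

definition link_invariant :: "(figure \<Rightarrow> 'k) \<Rightarrow> bool" where
  "link_invariant H \<longleftrightarrow>
     (\<forall>D D'. link_diagram D \<and> link_diagram D' \<and> move D D' \<longrightarrow> H D = H D')"

definition HOMFLY_PT :: "'k::field \<Rightarrow> 'k \<Rightarrow> (figure \<Rightarrow> 'k) \<Rightarrow> bool" where
  "HOMFLY_PT A q H \<longleftrightarrow>
     link_invariant H \<and>
     (\<forall>a. H {#Bend a a#} = DN A q) \<and>
     (\<forall>D a b c d. link_diagram (D + {#Crossing True a b c d#}) \<longrightarrow>
        A * H (D + {#Crossing True a b c d#}) - inverse A * H (D + {#Crossing False a b c d#})
          = (q - inverse q) * H (D + {#Bend a c, Bend b d#}))"


section \<open>Bipartite diagrams\<close>

text \<open>The two strands of the expanded lock are \<open>i1 \<rightarrow> v \<rightarrow> o1\<close> and \<open>i2 \<rightarrow> u \<rightarrow> o2\<close>.\<close>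

fun expand :: "vertex \<Rightarrow> figure" where
  "expand (Lock s l i1 o1 i2 o2 u v) =
     (if l then {#Crossing s u i1 v o2, Crossing s v i2 u o1#}
      else {#Crossing s i1 u o2 v, Crossing s i2 v o1 u#})"
| "expand (Crossing s a b c d) = {#Crossing s a b c d#}"
| "expand (Bend a b) = {#Bend a b#}"

definition underlying :: "figure \<Rightarrow> figure" where
  "underlying B = \<Sum>\<^sub># (image_mset expand B)"

text \<open>A bipartite diagram is given by its contracted figure, which has no crossings outside the
  locks.\<close>

definition bipartite_diagram :: "figure \<Rightarrow> bool" where
  "bipartite_diagram B \<longleftrightarrow>
     (\<forall>s a b c d. Crossing s a b c d \<notin># B) \<and> link_diagram (underlying B)"

text \<open>
  \<open>\<rho>\<close> assigns to each side the region it borders, for some drawing of the whole figure on the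
  sphere (any region may be taken as the unbounded one in the plane). For a connected figure the
  regions are the faces. In general a region is a union of faces of different components, and a
  system of such unions comes from a drawing iff the graph with nodes the components and the
  regions, and one link per face, is a tree: it is connected, and has one node more than it has
  links.
\<close>

definition region_map :: "figure \<Rightarrow> (side \<Rightarrow> 'r) \<Rightarrow> bool" where
  "region_map F \<rho> \<longleftrightarrow>
     (\<forall>(x, y)\<in>corner_rel F. \<rho> x = \<rho> y) \<and>
     (\<forall>x\<in>sides F. \<forall>y\<in>sides F.
        (x, y) \<in> ({(s, t). s \<in> sides F \<and> t \<in> sides F \<and>
                     (\<rho> s = \<rho> t \<or> (fst s, fst t) \<in> same_component F)})\<^sup>*) \<and>
     card (\<rho> ` sides F) + num_components F = num_faces F + 1"

definition checkerboard :: "figure \<Rightarrow> (side \<Rightarrow> 'r) \<Rightarrow> ('r \<Rightarrow> bool) \<Rightarrow> bool" where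
  "checkerboard F \<rho> white \<longleftrightarrow>
     (\<forall>e\<in>edges F. white (\<rho> (e, True)) \<noteq> white (\<rho> (e, False)))"

definition white_regions :: "figure \<Rightarrow> (side \<Rightarrow> 'r) \<Rightarrow> ('r \<Rightarrow> bool) \<Rightarrow> 'r set" where
  "white_regions F \<rho> white = {r \<in> \<rho> ` sides F. white r}"

text \<open>A region is simply connected (on the sphere) iff it consists of a single face. This is
  automatic for connected figures. For split figures it has to be required of the white regions:
  for two circles side by side with the common outer region white, the white Goeritz matrix is
  that of one circle.\<close>

definition white_simply_connected ::
  "figure \<Rightarrow> (side \<Rightarrow> 'r) \<Rightarrow> ('r \<Rightarrow> bool) \<Rightarrow> bool" where
  "white_simply_connected F \<rho> white \<longleftrightarrow>
     (\<forall>x\<in>sides F. \<forall>y\<in>sides F. \<rho> x = \<rho> y \<and> white (\<rho> x) \<longrightarrow> (x, y) \<in> same_face F)"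


section \<open>Locks and the quaternary Goeritz matrix\<close>

fun bullet :: "vertex \<Rightarrow> bool" where
  "bullet (Lock s l i1 o1 i2 o2 u v) = s"
| "bullet _ = False"

fun circ :: "vertex \<Rightarrow> bool" where
  "circ (Lock s l i1 o1 i2 o2 u v) = (\<not> s)"
| "circ _ = False"

text \<open>The two end corners and the two lateral corners of a lock, each represented by the side of the
  incoming edge bounding it.\<close>

fun end_corners :: "vertex \<Rightarrow> side set" where
  "end_corners (Lock s l i1 o1 i2 o2 u v) = {(i1, \<not> l), (i2, \<not> l)}"
| "end_corners _ = {}"

fun lateral_corners :: "vertex \<Rightarrow> side set" where
  "lateral_corners (Lock s l i1 o1 i2 o2 u v) = {(i1, l), (i2, l)}"
| "lateral_corners _ = {}"

definition num_of :: "(vertex \<Rightarrow> bool) \<Rightarrow> figure \<Rightarrow> int" where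
  "num_of P B = int (size (filter_mset P B))"

definition self_end :: "(side \<Rightarrow> 'r) \<Rightarrow> ('r \<Rightarrow> bool) \<Rightarrow> vertex \<Rightarrow> bool" where
  "self_end \<rho> white x \<longleftrightarrow> (\<exists>r. white r \<and> \<rho> ` end_corners x = {r})"

definition self_lateral :: "(side \<Rightarrow> 'r) \<Rightarrow> ('r \<Rightarrow> bool) \<Rightarrow> vertex \<Rightarrow> bool" where
  "self_lateral \<rho> white x \<longleftrightarrow> (\<exists>r. white r \<and> \<rho> ` lateral_corners x = {r})"

type_synonym quad = "int \<times> int \<times> int \<times> int"

text \<open>Entry for two different white regions \<open>i\<close>, \<open>j\<close>. Since both are white, the corners lying in
  them are the white ones, so the four counts are those of the positive vertical, positive
  horizontal, negative vertical and negative horizontal locks.\<close>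

definition goeritz_off :: "figure \<Rightarrow> (side \<Rightarrow> 'r) \<Rightarrow> 'r \<Rightarrow> 'r \<Rightarrow> quad" where
  "goeritz_off B \<rho> i j =
     (  num_of (\<lambda>x. bullet x \<and> \<rho> ` end_corners x = {i, j}) B,
        num_of (\<lambda>x. circ x \<and> \<rho> ` lateral_corners x = {i, j}) B,
      - num_of (\<lambda>x. circ x \<and> \<rho> ` end_corners x = {i, j}) B,
      - num_of (\<lambda>x. bullet x \<and> \<rho> ` lateral_corners x = {i, j}) B)"

text \<open>The full matrix, with rows and columns indexed by the white regions. A reduced matrix is its
  restriction to all white regions but one.\<close>

definition goeritz ::
  "figure \<Rightarrow> (side \<Rightarrow> 'r) \<Rightarrow> ('r \<Rightarrow> bool) \<Rightarrow> 'r \<Rightarrow> 'r \<Rightarrow> quad" where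
  "goeritz B \<rho> white i j =
     (if i = j then - (\<Sum>k\<in>white_regions B \<rho> white - {j}. goeritz_off B \<rho> k j)
      else goeritz_off B \<rho> i j)"


section \<open>The recursion\<close>

text \<open>In the following \<open>D\<close> stands for \<open>DN A q\<close>, and \<open>f\<close>, \<open>g\<close> for the fixed square roots of
  \<open>phi A q\<close> and \<open>phibar A q\<close>. Powers of \<open>phi\<close>, \<open>phibar\<close> with exponent \<open>n/2\<close> are written
  \<open>f powi n\<close>, \<open>g powi n\<close>.\<close>

definition Px :: "'k::field \<Rightarrow> 'k \<Rightarrow> int \<Rightarrow> 'k" where
  "Px D f x = (\<Sum>k=1..nat \<bar>x\<bar>. of_nat (nat \<bar>x\<bar> choose k) * D ^ (k - 1) * f powi (\<bar>x\<bar> - 2 * int k))"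

definition Py :: "'k::field \<Rightarrow> 'k \<Rightarrow> int \<Rightarrow> 'k" where
  "Py D g y = (\<Sum>k=1..nat \<bar>y\<bar>. of_nat (nat \<bar>y\<bar> choose k) * D ^ (k - 1) * g powi (2 * int k - \<bar>y\<bar>))"

definition Pz :: "'k::field \<Rightarrow> 'k \<Rightarrow> int \<Rightarrow> 'k" where
  "Pz D g z = (\<Sum>k=1..nat \<bar>z\<bar>. of_nat (nat \<bar>z\<bar> choose k) * D ^ (k - 1) * g powi (\<bar>z\<bar> - 2 * int k))"

definition Pt :: "'k::field \<Rightarrow> 'k \<Rightarrow> int \<Rightarrow> 'k" where
  "Pt D f t = (\<Sum>k=1..nat \<bar>t\<bar>. of_nat (nat \<bar>t\<bar> choose k) * D ^ (k - 1) * f powi (2 * int k - \<bar>t\<bar>))"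

fun U1 :: "'k::field \<Rightarrow> 'k \<Rightarrow> quad \<Rightarrow> 'k" where
  "U1 f g (x, y, z, t) = f powi (x + t) * g powi (- (y + z))"

fun U2 :: "'k::field \<Rightarrow> 'k \<Rightarrow> 'k \<Rightarrow> quad \<Rightarrow> 'k" where
  "U2 D f g (x, y, z, t) =
     f powi t * g powi (- (y + z)) * Px D f x
     + (f powi x + D * Px D f x) *
       ((g powi (- y) + D * Py D g (- y)) *
          (g powi (- z) * Pt D f t + f powi t * Pz D g (- z) + D * Pz D g (- z) * Pt D f t)
        + f powi t * g powi (- z) * Py D g (- y))"

fun Dcal :: "'k::field \<Rightarrow> 'k \<Rightarrow> 'k \<Rightarrow> quad \<Rightarrow> 'k" where
  "Dcal D f g (x, y, z, t) =
     f powi (- (x + t)) * g powi (y + z) * D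
     + f powi (- t) * g powi (y + z) * Px D f (- x)
     + (f powi (- x) + D * Px D f (- x)) *
       ((g powi y + D * Py D g y) *
          (g powi z * Pt D f (- t) + f powi (- t) * Pz D g z + D * Pz D g z * Pt D f (- t))
        + f powi (- t) * g powi z * Py D g y)"

definition separate :: "('r \<Rightarrow> 'r \<Rightarrow> quad) \<Rightarrow> 'r \<Rightarrow> 'r \<Rightarrow> 'r \<Rightarrow> 'r \<Rightarrow> quad" where
  "separate G i j k l =
     (if k = i \<and> l = i then G i i + G i j
      else if k = j \<and> l = j then G j j + G i j
      else if (k = i \<and> l = j) \<or> (k = j \<and> l = i) then 0
      else G k l)"

definition merge :: "('r \<Rightarrow> 'r \<Rightarrow> quad) \<Rightarrow> 'r \<Rightarrow> 'r \<Rightarrow> 'r \<Rightarrow> 'r \<Rightarrow> quad" where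
  "merge G i j k l =
     (if k = i \<and> l = i then G i i + G j j + (G i j + G i j)
      else if k = i then G i l + G j l
      else if l = i then G k i + G k j
      else G k l)"

text \<open>\<open>M_value D f g I G m\<close>: some sequence of choices in the recursion for the matrix
  \<open>(G i j)\<^bsub>i,j\<in>I\<^esub>\<close> produces the value \<open>m\<close>.\<close>

inductive M_value ::
  "'k::field \<Rightarrow> 'k \<Rightarrow> 'k \<Rightarrow> 'r set \<Rightarrow> ('r \<Rightarrow> 'r \<Rightarrow> quad) \<Rightarrow> 'k \<Rightarrow> bool"
  for D f g where
  off_diagonal: "\<lbrakk>i \<in> I; j \<in> I; i \<noteq> j; G i j \<noteq> 0;
      M_value D f g I (separate G i j) m1; M_value D f g (I - {j}) (merge G i j) m2\<rbrakk>
    \<Longrightarrow> M_value D f g I G (U1 f g (G i j) * m1 + U2 D f g (G i j) * m2)"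
| diagonal: "\<lbrakk>\<forall>j\<in>I. \<forall>k\<in>I. j \<noteq> k \<longrightarrow> G j k = 0; i \<in> I; M_value D f g (I - {i}) G m\<rbrakk>
    \<Longrightarrow> M_value D f g I G (Dcal D f g (G i i) * m)"
| empty: "M_value D f g {} G D"

end

theory Submission
  imports Defs
begin

text \<open>
  A lock satisfies a planar skein relation: up to a power of \<open>A\<close>, it is the sum of its two
  crossingless smoothings with coefficients \<open>1\<close> and \<open>phi\<close> or \<open>phibar\<close>. Hence \<open>H\<close> is a sum over
  the sets \<open>S\<close> of locks whose white corners are joined, weighted by \<open>D\<close> to the number of
  circles. Viewing the locks as edges between the white regions, changing one smoothing merges or
  splits circles exactly like a transposition acting on a permutation, which gives
  \<open>circles \<le> 2 k(S) + |S| - |V|\<close> with a deficit that grows with \<open>S\<close>; Euler's formula says that the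
  deficit vanishes for the full set, hence for all \<open>S\<close>. So \<open>H\<close> is a dichromatic polynomial of a
  multigraph. The recursion is deletion--contraction for it: a bundle of parallel edges acts as
  \<open>U1 + U2 * M\<close> in the algebra \<open>M\<^sup>2 = D * M\<close>, and self-locks are loops.
\<close>

section \<open>Classes of generated equivalence relations\<close>

text \<open>\<open>H\<close> is invariant only under moves between link diagrams, so every
  intermediate figure must be shown to be spherical, and this is a purely numerical condition. In a
  closed figure without crossings no corner joins a left side to a right side; the faces are
  therefore the cycles of two permutations of the edges, one for each side. Smoothing a lock
  multiplies one of them by a transposition. Hence smoothing cannot raise the genus; since circles
  have genus 0, the genus is never negative, and smoothings of spherical figures stay spherical. The
  circles of a state are counted by the same argument, with white and black sides in place of left
  and right. The exponent \<open>2 k(S) + |S| - |V|\<close> is what makes deletion and contraction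
  free of powers of \<open>D\<close>. The deleted region stays in the graph as a vertex: a diagonal
  entry is minus the total of the locks at its region, so it remembers those leading to the deleted
  one. Each component of an off-diagonal quadruple keeps a fixed sign, so nothing cancels and a zero
  entry means that no lock is there.\<close>

definition eqv :: "('a \<times> 'a) set \<Rightarrow> ('a \<times> 'a) set" where
  "eqv R = (R \<union> R\<inverse>)\<^sup>*"

definition num_classes :: "'a set \<Rightarrow> ('a \<times> 'a) set \<Rightarrow> nat" where
  "num_classes X R = card (X // eqv R)"

lemma eqv_refl [simp]: "(x, x) \<in> eqv R"
  by (simp add: eqv_def)

lemma eqv_sym: "(x, y) \<in> eqv R \<Longrightarrow> (y, x) \<in> eqv R"
proof -
  have "sym ((R \<union> R\<inverse>)\<^sup>*)"
    by (intro sym_rtrancl) (auto simp: sym_def)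
  then show "(x, y) \<in> eqv R \<Longrightarrow> (y, x) \<in> eqv R"
    by (auto simp: eqv_def sym_def)
qed

lemma eqv_trans: "(x, y) \<in> eqv R \<Longrightarrow> (y, z) \<in> eqv R \<Longrightarrow> (x, z) \<in> eqv R"
  unfolding eqv_def by (rule rtrancl_trans)

lemma eqv_I: "(x, y) \<in> R \<Longrightarrow> (x, y) \<in> eqv R"
  by (auto simp: eqv_def)

lemma eqv_I': "(x, y) \<in> R \<Longrightarrow> (y, x) \<in> eqv R"
  by (auto simp: eqv_def)

lemma eqv_rtrancl: "(x, y) \<in> R\<^sup>* \<Longrightarrow> (x, y) \<in> eqv R"
  unfolding eqv_def by (rule in_rtrancl_UnI) simp

lemma subset_eqv: "R \<subseteq> Q \<Longrightarrow> R \<subseteq> eqv Q"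
  by (auto simp: eqv_def)

lemma eqv_map:
  assumes "\<And>x y. (x, y) \<in> R \<Longrightarrow> (h x, h y) \<in> eqv Q" and "(x, y) \<in> eqv R"
  shows "(h x, h y) \<in> eqv Q"
  using assms(2) unfolding eqv_def[of R]
proof (induction rule: rtrancl_induct)
  case base
  then show ?case by simp
next
  case (step y z)
  then have "(h y, h z) \<in> eqv Q"
    using assms(1) by (auto intro: eqv_sym)
  with step show ?case by (blast intro: eqv_trans)
qed

lemma eqv_mono: "R \<subseteq> eqv Q \<Longrightarrow> eqv R \<subseteq> eqv Q"
  using eqv_map[of R "\<lambda>x. x" Q] by auto

lemma eqv_eqI: "R \<subseteq> eqv Q \<Longrightarrow> Q \<subseteq> eqv R \<Longrightarrow> eqv R = eqv Q"
  using eqv_mono by blast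

lemma eqv_subset: "R \<subseteq> Q \<Longrightarrow> eqv R \<subseteq> eqv Q"
  by (rule eqv_mono) (auto intro: eqv_I)

lemma equiv_eqv: "equiv UNIV (eqv R)"
  by (rule equivI) (auto simp: refl_on_def sym_def intro: eqv_sym transI eqv_trans)

lemma eqv_class_eq_iff: "eqv R `` {x} = eqv R `` {y} \<longleftrightarrow> (x, y) \<in> eqv R"
  using eq_equiv_class_iff[OF equiv_eqv, of x y] by simp

lemma quotient_image: "X // r = (\<lambda>x. r `` {x}) ` X"
  by (auto simp: quotient_def)

lemma num_classes_cong: "eqv R = eqv Q \<Longrightarrow> num_classes X R = num_classes X Q"
  by (simp add: num_classes_def)

lemma num_classes_empty [simp]: "num_classes X {} = card X"
proof -
  have "X // eqv {} = (\<lambda>x. {x}) ` X"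
    by (auto simp: quotient_image eqv_def)
  then show ?thesis
    by (simp add: num_classes_def card_image)
qed

text \<open>Classes are taken in the whole type, so a chosen representative may lie outside
  \<open>X\<close>; this is harmless because \<open>h\<close> respects \<open>R\<close>
  everywhere.\<close>

lemma num_classes_le_surj:
  assumes "finite X" "h ` X = Y"
    and "\<And>x y. (x, y) \<in> R \<Longrightarrow> (h x, h y) \<in> eqv Q"
  shows "num_classes Y Q \<le> num_classes X R"
proof -
  have "\<exists>c. \<forall>x\<in>X. c (eqv R `` {x}) = eqv Q `` {h x}"
  proof (intro exI ballI)
    fix x assume "x \<in> X"
    have "(x, SOME z. z \<in> eqv R `` {x}) \<in> eqv R"
      using someI[of "\<lambda>z. z \<in> eqv R `` {x}" x] by auto
    then show "(\<lambda>k. eqv Q `` {h (SOME z. z \<in> k)}) (eqv R `` {x}) = eqv Q `` {h x}"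
      using eqv_map[of R h Q, OF assms(3)] by (simp add: eqv_class_eq_iff eqv_sym)
  qed
  then obtain c where "\<forall>x\<in>X. c (eqv R `` {x}) = eqv Q `` {h x}" ..
  then have "Y // eqv Q \<subseteq> c ` (X // eqv R)"
    using assms(2) by (force simp: quotient_image image_iff)
  then show ?thesis
    unfolding num_classes_def using assms(1) by (intro surj_card_le[of _ _ c]) (auto simp: quotient_image)
qed

lemma num_classes_bij:
  assumes "finite X" "h ` X = Y"
    and "\<And>x y. (x, y) \<in> R \<Longrightarrow> (h x, h y) \<in> eqv Q"
    and "\<And>x y. x \<in> X \<Longrightarrow> y \<in> X \<Longrightarrow> (h x, h y) \<in> eqv Q \<Longrightarrow> (x, y) \<in> eqv R"
  shows "num_classes X R = num_classes Y Q"
proof (rule antisym)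
  show "num_classes Y Q \<le> num_classes X R"
    using assms by (intro num_classes_le_surj) auto
  have "\<exists>c. \<forall>x\<in>X. c (eqv Q `` {h x}) = eqv R `` {x}"
  proof (intro exI ballI)
    fix x assume x: "x \<in> X"
    let ?k = "eqv Q `` {h x}"
    \<comment> \<open>Now the representative has to be chosen inside \<open>X\<close>, because only
      there is \<open>h\<close> assumed to reflect the relation.\<close>
    have "(SOME z. z \<in> X \<and> h z \<in> ?k) \<in> X \<and> h (SOME z. z \<in> X \<and> h z \<in> ?k) \<in> ?k"
      by (rule someI[of "\<lambda>z. z \<in> X \<and> h z \<in> ?k" x]) (use x in auto)
    then show "(\<lambda>k. eqv R `` {SOME z. z \<in> X \<and> h z \<in> k}) ?k = eqv R `` {x}"
      using assms(4)[OF x] by (simp add: eqv_class_eq_iff eqv_sym)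
  qed
  then obtain c where "\<forall>x\<in>X. c (eqv Q `` {h x}) = eqv R `` {x}" ..
  then have "X // eqv R \<subseteq> c ` (Y // eqv Q)"
    using assms(2) by (force simp: quotient_image image_iff)
  then show "num_classes X R \<le> num_classes Y Q"
    unfolding num_classes_def using assms(1,2) by (intro surj_card_le[of _ _ c]) (auto simp: quotient_image)
qed

text \<open>The form in which figures and graphs are compared before and after a local change: each
  point of \<open>X\<close> that disappears is pushed, within its own class, to a point that
  stays.\<close>

lemma num_classes_retract:
  assumes "finite X" "Y \<subseteq> X" "h ` X \<subseteq> Y" "\<And>y. y \<in> Y \<Longrightarrow> h y = y"
    and "\<And>x. x \<in> X \<Longrightarrow> (h x, x) \<in> eqv R"
    and "\<And>x y. (x, y) \<in> R \<Longrightarrow> (h x, h y) \<in> eqv Q"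
    and "Q \<subseteq> eqv R"
  shows "num_classes X R = num_classes Y Q"
proof (rule num_classes_bij[where h = h])
  show "h ` X = Y"
    using assms(2-4) by force
  fix x y
  assume "x \<in> X" "y \<in> X" "(h x, h y) \<in> eqv Q"
  then have "(h x, h y) \<in> eqv R"
    using assms(7) eqv_mono by blast
  then show "(x, y) \<in> eqv R"
    using assms(5)[OF \<open>x \<in> X\<close>] assms(5)[OF \<open>y \<in> X\<close>] by (blast intro: eqv_sym eqv_trans)
qed (use assms in auto)

lemma eqv_closed: "(x, y) \<in> eqv R \<Longrightarrow> R \<subseteq> X \<times> X \<union> (- X) \<times> (- X) \<Longrightarrow> x \<in> X \<longleftrightarrow> y \<in> X"
  unfolding eqv_def by (induction rule: rtrancl_induct) auto

lemma num_classes_Un: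
  assumes "finite X" "finite Y" "X \<inter> Y = {}" "R \<subseteq> X \<times> X \<union> (- X) \<times> (- X)"
  shows "num_classes (X \<union> Y) R = num_classes X R + num_classes Y R"
proof -
  have "(X \<union> Y) // eqv R = X // eqv R \<union> Y // eqv R"
    by (auto simp: quotient_image)
  moreover have "X // eqv R \<inter> Y // eqv R = {}"
    using assms(3) eqv_closed[OF _ assms(4)] by (auto simp: quotient_image eqv_class_eq_iff)
  ultimately show ?thesis
    using assms(1,2) by (simp add: num_classes_def card_Un_disjoint quotient_image)
qed

text \<open>Shortcutting a path leaves at most one passage through the new pair, in one of its two
  directions.\<close>

lemma eqv_insert_cases:
  assumes "(x, y) \<in> eqv (insert (a, b) R)"
  shows "(x, y) \<in> eqv R \<or> (x, a) \<in> eqv R \<and> (b, y) \<in> eqv R \<or> (x, b) \<in> eqv R \<and> (a, y) \<in> eqv R"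
  using assms unfolding eqv_def[of "insert _ _"]
proof (induction rule: rtrancl_induct)
  case base
  then show ?case by simp
next
  case (step y z)
  then consider "(y, z) \<in> eqv R" | "y = a" "z = b" | "y = b" "z = a"
    by (auto intro: eqv_I eqv_I')
  then show ?case
  proof cases
    case 1
    then show ?thesis using step.IH by (meson eqv_trans)
  next
    case 2
    then show ?thesis using step.IH eqv_refl[of b R] eqv_sym[of b a R] eqv_trans[of x b R] eqv_trans[of x a R] by metis
  next
    case 3
    then show ?thesis using step.IH eqv_refl[of a R] eqv_sym[of a b R] eqv_trans[of x b R] eqv_trans[of x a R] by metis
  qed
qed

lemma num_classes_insert_same:
  "(a, b) \<in> eqv R \<Longrightarrow> num_classes X (insert (a, b) R) = num_classes X R"
  by (rule num_classes_cong, rule eqv_eqI) (auto intro: eqv_I)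

lemma num_classes_insert_new:
  assumes "finite X" "a \<in> X" "b \<in> X" "(a, b) \<notin> eqv R"
  shows "num_classes X R = Suc (num_classes X (insert (a, b) R))"
proof -
  let ?R' = "insert (a, b) R"
  \<comment> \<open>With the single class of \<open>b\<close> set aside, the new pair no longer
    identifies anything.\<close>
  let ?X = "{x \<in> X. (x, b) \<notin> eqv R}"
  have "X // eqv R = insert (eqv R `` {b}) (?X // eqv R)"
    using assms(3) eqv_class_eq_iff[of R _ b] by (fastforce simp: quotient_image)
  moreover have "eqv R `` {b} \<notin> ?X // eqv R"
    using eqv_sym[of b _ R] by (auto simp: quotient_image eqv_class_eq_iff)
  ultimately have 1: "num_classes X R = Suc (num_classes ?X R)"
    using assms(1) by (simp add: num_classes_def quotient_image)
  have sub: "eqv R \<subseteq> eqv ?R'"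
    by (rule eqv_subset) auto
  have ab: "(a, b) \<in> eqv ?R'"
    by (simp add: eqv_I)
  \<comment> \<open>The class of \<open>b\<close> is absorbed by that of \<open>a\<close>, so every
    enlarged class still meets \<open>?X\<close>.\<close>
  have "X // eqv ?R' = ?X // eqv ?R'"
  proof
    show "X // eqv ?R' \<subseteq> ?X // eqv ?R'"
    proof
      fix k assume "k \<in> X // eqv ?R'"
      then obtain x where x: "x \<in> X" "k = eqv ?R' `` {x}"
        by (auto simp: quotient_image)
      show "k \<in> ?X // eqv ?R'"
      proof (cases "(x, b) \<in> eqv R")
        case True
        then have "(x, a) \<in> eqv ?R'"
          using sub ab by (blast intro: eqv_sym eqv_trans)
        then have "k = eqv ?R' `` {a}"
          using x(2) by (simp add: eqv_class_eq_iff)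
        then show ?thesis
          using assms(2,4) by (auto simp: quotient_image)
      qed (use x in \<open>auto simp: quotient_image\<close>)
    qed
  qed (auto simp: quotient_image)
  moreover have "num_classes ?X R = num_classes ?X ?R'"
  proof (rule num_classes_bij[where h = "\<lambda>x. x"])
    fix x y
    assume "x \<in> ?X" "y \<in> ?X" "(x, y) \<in> eqv ?R'"
    then show "(x, y) \<in> eqv R"
      using eqv_insert_cases[of x y a b R] eqv_sym[of b y R] by auto
  next
    show "(x, y) \<in> eqv ?R'" if "(x, y) \<in> R" for x y
      using that by (simp add: eqv_I)
  qed (use assms(1) in auto)
  ultimately show ?thesis
    using 1 by (simp add: num_classes_def)
qed

lemma num_classes_insert_bounds:
  assumes "finite X" "a \<in> X" "b \<in> X"
  shows "num_classes X (insert (a, b) R) \<le> num_classes X R"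
    and "num_classes X R \<le> Suc (num_classes X (insert (a, b) R))"
  using num_classes_insert_same[of a b R X] num_classes_insert_new[OF assms, of R]
  by (cases "(a, b) \<in> eqv R"; linarith)+

section \<open>Permutations as multisets of arcs, and the effect of a transposition on their
  cycles\<close>

definition perm_arcs :: "('a \<times> 'a) multiset \<Rightarrow> bool" where
  "perm_arcs M \<longleftrightarrow> image_mset fst M = image_mset snd M \<and> (\<forall>e. count (image_mset fst M) e \<le> 1)"

lemma count_image_le_1:
  assumes "\<forall>e. count (image_mset f (add_mset p M)) e \<le> 1"
  shows "f p \<notin> f ` set_mset M"
proof -
  have "count (image_mset f (add_mset p M)) (f p) \<le> 1"
    using assms by blast
  then have "count (image_mset f M) (f p) = 0"
    by simp
  then show ?thesis
    by (metis count_eq_zero_iff set_image_mset)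
qed

lemma perm_arcs_alt:
  "perm_arcs M \<longleftrightarrow> image_mset fst M = image_mset snd M \<and>
     (\<forall>e. count (image_mset fst M) e \<le> 1) \<and> (\<forall>e. count (image_mset snd M) e \<le> 1)"
  unfolding perm_arcs_def by metis

text \<open>Following the permutation from \<open>b\<close> runs along its cycle back to
  \<open>a\<close>. The proof counts: if \<open>a\<close> were not reached, every point of the set
  \<open>C\<close> reached from \<open>b\<close> would start an arc of \<open>M\<close> ending in
  \<open>C\<close>; distinct arcs have distinct ends, so all of \<open>C\<close> would be hit,
  including \<open>b\<close>, which is already the end of \<open>(a, b)\<close>.\<close>

lemma perm_arcs_closing_path:
  assumes "perm_arcs (add_mset (a, b) M)"
  shows "(b, a) \<in> (set_mset M)\<^sup>*"
proof (rule ccontr)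
  assume nin: "(b, a) \<notin> (set_mset M)\<^sup>*"
  let ?M = "add_mset (a, b) M"
  define C where "C = (set_mset M)\<^sup>* `` {b}"
  have eq: "image_mset fst ?M = image_mset snd ?M"
    and c1: "\<forall>e. count (image_mset fst ?M) e \<le> 1" and c2: "\<forall>e. count (image_mset snd ?M) e \<le> 1"
    using assms unfolding perm_arcs_alt by blast+
  have inj: "inj_on snd (set_mset M)"
  proof (rule inj_onI)
    fix p p' assume "p \<in># M" "p' \<in># M" "snd p = snd p'"
    show "p = p'"
    proof (rule ccontr)
      assume "p \<noteq> p'"
      then have "p' \<in># M - {#p#}"
        using \<open>p' \<in># M\<close> by (simp add: in_diff_count)
      moreover have "\<forall>e. count (image_mset snd (add_mset p (add_mset (a, b) (M - {#p#})))) e \<le> 1"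
        using c2 \<open>p \<in># M\<close> by (metis add_mset_commute insert_DiffM)
      ultimately show False
        using count_image_le_1[of snd p "add_mset (a, b) (M - {#p#})"] \<open>snd p = snd p'\<close> by auto
    qed
  qed
  have sub: "C \<subseteq> fst ` set_mset ?M"
  proof
    fix x assume "x \<in> C"
    then have "(b, x) \<in> (set_mset M)\<^sup>*" by (simp add: C_def)
    then have "x \<in> snd ` set_mset ?M"
    proof (induction rule: rtrancl_induct)
      case base
      then show ?case by auto
    next
      case (step y z)
      then show ?case by force
    qed
    then show "x \<in> fst ` set_mset ?M"
      by (metis eq set_image_mset)
  qed
  have fin: "finite C"
    using sub by (rule finite_subset) auto
  let ?A = "{p \<in> set_mset M. fst p \<in> C}"
  have "C \<subseteq> fst ` ?A"
  proof
    fix x assume x: "x \<in> C"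
    then have "x \<noteq> a" using nin by (auto simp: C_def)
    then show "x \<in> fst ` ?A"
      using sub x by auto
  qed
  then have "card C \<le> card ?A"
    by (rule surj_card_le[rotated]) simp
  also have "card ?A = card (snd ` ?A)"
    by (metis (no_types, lifting) inj card_image inj_on_subset mem_Collect_eq subsetI)
  finally have le: "card C \<le> card (snd ` ?A)" .
  have "snd ` ?A \<subseteq> C"
    by (auto simp: C_def intro: rtrancl_into_rtrancl)
  then have "snd ` ?A = C"
    using le fin by (simp add: card_seteq)
  moreover have "b \<in> C" by (simp add: C_def)
  ultimately have "b \<in> snd ` set_mset M" by auto
  then show False
    using count_image_le_1[OF c2] by simp
qed

lemma perm_arcs_in: "perm_arcs M \<Longrightarrow> fst ` set_mset M = X \<Longrightarrow> (a, b) \<in># M \<Longrightarrow> a \<in> X \<and> b \<in> X"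
  unfolding perm_arcs_def by (metis fst_conv image_eqI set_image_mset snd_conv)

text \<open>Exchanging the two targets composes the permutation with a transposition, which splits a
  cycle or merges two. By the closing paths, the second of the two arcs adds nothing to the
  equivalence generated by the others, so both counts are those of \<open>M\<close> with a single
  extra arc and can be compared with \<open>M\<close> alone.\<close>

lemma num_classes_switch:
  assumes p1: "perm_arcs (M + {#(a, c), (b, d)#})" and X: "X = fst ` set_mset (M + {#(a, c), (b, d)#})"
  defines "n \<equiv> num_classes X (set_mset (M + {#(a, c), (b, d)#}))"
    and "n' \<equiv> num_classes X (set_mset (M + {#(a, d), (b, c)#}))"
  shows "n' \<le> Suc n" "n \<le> Suc n'"
    and "(a, b) \<notin> eqv (set_mset (M + {#(a, c), (b, d)#})) \<Longrightarrow> n = Suc n'"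
proof -
  let ?R = "set_mset M"
  let ?n0 = "num_classes X ?R"
  have p2: "perm_arcs (M + {#(a, d), (b, c)#})"
  proof -
    have "image_mset snd (M + {#(a, d), (b, c)#}) = image_mset snd (M + {#(a, c), (b, d)#})"
      "image_mset fst (M + {#(a, d), (b, c)#}) = image_mset fst (M + {#(a, c), (b, d)#})"
      by (simp_all add: add_mset_commute[of c d])
    with p1 show ?thesis
      unfolding perm_arcs_def by metis
  qed
  have fin: "finite X" by (simp add: X)
  have mem: "a \<in> X" "b \<in> X" "c \<in> X" "d \<in> X"
    using perm_arcs_in[OF p1 X[symmetric]] by auto
  have "(d, b) \<in> (set_mset (add_mset (a, c) M))\<^sup>*"
    by (rule perm_arcs_closing_path) (use p1 in \<open>simp add: add_mset_commute\<close>)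
  then have "(b, d) \<in> eqv (insert (a, c) ?R)"
    by (intro eqv_sym[OF eqv_rtrancl]) simp
  then have n: "n = num_classes X (insert (a, c) ?R)"
    using num_classes_insert_same[of b d "insert (a, c) ?R" X]
    by (simp add: n_def insert_commute)
  have "(c, b) \<in> (set_mset (add_mset (a, d) M))\<^sup>*"
    by (rule perm_arcs_closing_path) (use p2 in \<open>simp add: add_mset_commute\<close>)
  then have "(b, c) \<in> eqv (insert (a, d) ?R)"
    by (intro eqv_sym[OF eqv_rtrancl]) simp
  then have n': "n' = num_classes X (insert (a, d) ?R)"
    using num_classes_insert_same[of b c "insert (a, d) ?R" X]
    by (simp add: n'_def insert_commute)
  show "n' \<le> Suc n" "n \<le> Suc n'"
    using num_classes_insert_bounds[OF fin \<open>a \<in> X\<close> \<open>c \<in> X\<close>, of ?R]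
      num_classes_insert_bounds[OF fin \<open>a \<in> X\<close> \<open>d \<in> X\<close>, of ?R] n n' by auto
  assume ab: "(a, b) \<notin> eqv (set_mset (M + {#(a, c), (b, d)#}))"
  have sub: "eqv ?R \<subseteq> eqv (set_mset (M + {#(a, c), (b, d)#}))"
    by (rule eqv_subset) auto
  have bd: "(b, d) \<in> eqv (set_mset (M + {#(a, c), (b, d)#}))"
    by (rule eqv_I) auto
  have "(a, d) \<notin> eqv ?R"
    using ab sub bd by (meson eqv_sym eqv_trans subsetD)
  then have 1: "?n0 = Suc n'"
    using n' num_classes_insert_new[OF fin \<open>a \<in> X\<close> \<open>d \<in> X\<close>] by simp
  \<comment> \<open>The path that closes \<open>(a, c)\<close> cannot use \<open>(b, d)\<close>, as
    this would relate \<open>a\<close> to \<open>b\<close>; so \<open>M\<close> alone already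
    relates \<open>a\<close> to \<open>c\<close>.\<close>
  have "(c, a) \<in> (set_mset (add_mset (b, d) M))\<^sup>*"
    by (rule perm_arcs_closing_path) (use p1 in \<open>simp add: add_mset_commute\<close>)
  then have "(a, c) \<in> eqv (insert (b, d) ?R)"
    by (intro eqv_sym[OF eqv_rtrancl]) simp
  then have "(a, c) \<in> eqv ?R"
  proof (rule eqv_insert_cases[THEN disjE], goal_cases)
    case 2
    then show ?case
      using ab sub bd by (meson eqv_sym eqv_trans subsetD)
  qed
  then have "n = ?n0"
    using n num_classes_insert_same by metis
  with 1 show "n = Suc n'" by simp
qed

section \<open>Genus of figures\<close>

definition heads :: "figure \<Rightarrow> nat multiset" where
  "heads F = \<Sum>\<^sub># (image_mset ins F)"

definition tails :: "figure \<Rightarrow> nat multiset" where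
  "tails F = \<Sum>\<^sub># (image_mset outs F)"

lemma heads_simps [simp]:
  "heads {#} = {#}" "heads (add_mset x F) = ins x + heads F" "heads (F + G) = heads F + heads G"
  by (simp_all add: heads_def)

lemma tails_simps [simp]:
  "tails {#} = {#}" "tails (add_mset x F) = outs x + tails F" "tails (F + G) = tails F + tails G"
  by (simp_all add: tails_def)

lemma edges_heads: "edges F = set_mset (heads F)"
  by (simp add: edges_def heads_def)

lemma finite_edges [simp]: "finite (edges F)"
  by (simp add: edges_heads)

lemma closed_figure_iff: "closed_figure F \<longleftrightarrow> heads F = tails F \<and> (\<forall>e. count (heads F) e \<le> 1)"
  by (simp add: closed_figure_def heads_def tails_def)

lemma ins_subset_edges: "x \<in># F \<Longrightarrow> set_mset (ins x) \<subseteq> edges F"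
  by (metis UnI1 edges_heads heads_simps(2) insert_DiffM set_mset_union subsetI)

lemma outs_subset_edges: "closed_figure F \<Longrightarrow> x \<in># F \<Longrightarrow> set_mset (outs x) \<subseteq> edges F"
  unfolding closed_figure_iff edges_heads
  by (metis UnI1 tails_simps(2) insert_DiffM set_mset_union subsetI)

lemma mset_set_set_mset_eq:
  assumes "\<forall>e. count M e \<le> 1"
  shows "mset_set (set_mset M) = M"
proof (rule multiset_eqI)
  fix e
  show "count (mset_set (set_mset M)) e = count M e"
    using assms[rule_format, of e] count_greater_zero_iff[of M e]
    by (cases "e \<in># M") (simp_all add: count_mset_set' count_eq_zero_iff del: count_greater_zero_iff)
qed

lemma size_heads_closed: "closed_figure F \<Longrightarrow> size (heads F) = card (edges F)"
  unfolding closed_figure_iff edges_heads by (metis mset_set_set_mset_eq size_mset_set)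

definition comp_rel :: "figure \<Rightarrow> (nat \<times> nat) set" where
  "comp_rel F = (\<Union>x\<in>set_mset F. set_mset (ins x + outs x) \<times> set_mset (ins x + outs x))"

lemma comp_rel_simps [simp]:
  "comp_rel {#} = {}"
  "comp_rel (add_mset x F) = set_mset (ins x + outs x) \<times> set_mset (ins x + outs x) \<union> comp_rel F"
  "comp_rel (F + G) = comp_rel F \<union> comp_rel G"
  by (auto simp: comp_rel_def)

lemma corner_rel_simps [simp]:
  "corner_rel {#} = {}" "corner_rel (add_mset x F) = corners x \<union> corner_rel F"
  "corner_rel (F + G) = corner_rel F \<union> corner_rel G"
  by (auto simp: corner_rel_def)

lemma num_faces_alt: "num_faces F = num_classes (sides F) (corner_rel F)"
  by (simp add: num_faces_def num_classes_def same_face_def eqv_def)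

lemma num_components_alt: "num_components F = num_classes (edges F) (comp_rel F)"
proof -
  have "comp_rel F \<union> (comp_rel F)\<inverse> = comp_rel F"
    by (auto simp: comp_rel_def)
  then show ?thesis
    unfolding num_components_def num_classes_def same_component_def eqv_def comp_rel_def[symmetric]
    by simp
qed

text \<open>Twice the total genus.\<close>

definition defect :: "figure \<Rightarrow> int" where
  "defect F = int (card (edges F)) + 2 * int (num_components F) - int (size F) - int (num_faces F)"

lemma spherical_iff: "spherical F \<longleftrightarrow> defect F = 0"
  by (auto simp: spherical_def defect_def)

lemma comp_rel_subset_edges: "closed_figure F \<Longrightarrow> comp_rel F \<subseteq> edges F \<times> edges F"
  using ins_subset_edges outs_subset_edges by (fastforce simp: comp_rel_def)

lemma corners_subset:
  "(p, r) \<in> corners x \<Longrightarrow> fst p \<in># ins x + outs x \<and> fst r \<in># ins x + outs x"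
  by (cases x) auto

lemma corner_rel_subset_sides: "closed_figure F \<Longrightarrow> corner_rel F \<subseteq> sides F \<times> sides F"
proof
  fix p assume F: "closed_figure F" "p \<in> corner_rel F"
  then obtain x where "x \<in># F" "(fst p, snd p) \<in> corners x"
    by (auto simp: corner_rel_def)
  then show "p \<in> sides F \<times> sides F"
    using corners_subset[of "fst p" "snd p" x] ins_subset_edges[of x F] outs_subset_edges[OF F(1), of x]
    by (cases p) (auto simp: sides_def)
qed

text \<open>Covers local changes that create or remove inner edges \<open>N\<close>: closedness of
  the larger figure amounts to these names being distinct and fresh.\<close>

lemma closed_figure_extend:
  assumes "heads X1 = N + heads X2" "tails X1 = N + tails X2"
  shows "closed_figure (D + X1) \<longleftrightarrow>
    closed_figure (D + X2) \<and> (\<forall>e. count N e \<le> 1) \<and> set_mset N \<inter> edges (D + X2) = {}"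
proof -
  have "(\<forall>e. count (N + M) e \<le> 1) \<longleftrightarrow>
      (\<forall>e. count M e \<le> 1) \<and> (\<forall>e. count N e \<le> 1) \<and> set_mset N \<inter> set_mset M = {}" for M :: "nat multiset"
  proof -
    have "count (N + M) e \<le> 1 \<longleftrightarrow> count M e \<le> 1 \<and> count N e \<le> 1 \<and> \<not> (e \<in># N \<and> e \<in># M)" for e
      using count_greater_zero_iff[of N e] count_greater_zero_iff[of M e] by (simp del: count_greater_zero_iff) linarith
    then show ?thesis by blast
  qed
  from this[of "heads D + heads X2"] show ?thesis
    using assms by (auto simp: closed_figure_iff edges_heads ac_simps)
qed

lemma edges_extend: "heads X1 = N + heads X2 \<Longrightarrow> edges (D + X1) = set_mset N \<union> edges (D + X2)"
  by (auto simp: edges_heads)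

text \<open>Replacing the part \<open>X1\<close> of a figure by \<open>X2\<close> removes the edges \<open>N\<close>; all sides of removed
  edges are retracted to old sides, except for those of one face inside \<open>X1\<close>.\<close>

lemma defect_retract:
  assumes closed: "closed_figure (D + X1)"
    and hd: "heads X1 = N + heads X2" "tails X1 = N + tails X2"
    and size: "size X1 + 1 = size X2 + size N"
    and u: "u \<in># N"
    and h: "\<And>n f. n \<in># N \<Longrightarrow> fst (h (n, f)) \<in> edges X2 \<or> h (n, f) = (u, f0)" "h (u, f0) = (u, f0)"
      "\<And>n f. n \<in># N \<Longrightarrow> (h (n, f), (n, f)) \<in> eqv (corner_rel X1)"
      "\<And>e f. e \<notin># N \<Longrightarrow> h (e, f) = (e, f)"
      "\<And>p r. (p, r) \<in> corner_rel X1 \<Longrightarrow> (h p, h r) \<in> eqv (corner_rel X2)"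
      "corner_rel X2 \<subseteq> eqv (corner_rel X1)"
    and c: "\<And>n. n \<in># N \<Longrightarrow> c n \<in> edges X2" "\<And>n. n \<in># N \<Longrightarrow> (c n, n) \<in> eqv (comp_rel X1)"
      "\<And>e. e \<notin># N \<Longrightarrow> c e = e"
      "\<And>p r. (p, r) \<in> comp_rel X1 \<Longrightarrow> (c p, c r) \<in> eqv (comp_rel X2)"
      "comp_rel X2 \<subseteq> eqv (comp_rel X1)"
  shows "defect (D + X1) = defect (D + X2)"
proof -
  let ?F = "D + X1" and ?G = "D + X2"
  have cl2: "closed_figure ?G" and N1: "\<forall>e. count N e \<le> 1" and disj: "set_mset N \<inter> edges ?G = {}"
    using closed closed_figure_extend[OF hd, of D] by auto
  have ed: "edges ?F = set_mset N \<union> edges ?G"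
    by (rule edges_extend) (rule hd)
  have "size N + size (heads D + heads X2) = card (edges ?F)"
    using size_heads_closed[OF closed] hd by (simp add: add_ac)
  then have card: "card (edges ?F) = card (edges ?G) + size N"
    using size_heads_closed[OF cl2] by simp
  have sub2: "edges X2 \<subseteq> edges ?G"
    by (auto simp: edges_heads)
  have rel: "eqv (corner_rel X1) \<subseteq> eqv (corner_rel ?F)" "eqv (comp_rel X1) \<subseteq> eqv (comp_rel ?F)"
    "eqv (corner_rel X2) \<subseteq> eqv (corner_rel ?G)" "eqv (comp_rel X2) \<subseteq> eqv (comp_rel ?G)"
    by (rule eqv_subset; auto)+
  have hid: "h p = p" if "p \<in> sides ?G" for p
  proof -
    have "fst p \<notin># N"
      using that disj by (auto simp: sides_def)
    then show ?thesis
      using h(4)[of "fst p" "snd p"] by simp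
  qed
  have "num_components ?F = num_components ?G"
    unfolding num_components_alt
  proof (rule num_classes_retract[where h = c])
    show "c ` edges ?F \<subseteq> edges ?G"
    proof
      fix e assume "e \<in> c ` edges ?F"
      then obtain e' where "e' \<in> edges ?F" "e = c e'" by auto
      then show "e \<in> edges ?G"
        using ed c(1,3) sub2 by (cases "e' \<in># N") auto
    qed
    show "c y = y" if "y \<in> edges ?G" for y
      using that c(3) disj by auto
    show "(c x, x) \<in> eqv (comp_rel ?F)" if "x \<in> edges ?F" for x
      using c(2,3) rel by (cases "x \<in># N") auto
    show "(c x, c y) \<in> eqv (comp_rel ?G)" if "(x, y) \<in> comp_rel ?F" for x y
    proof (cases "(x, y) \<in> comp_rel X1")
      case True
      then show ?thesis using c(4) rel by blast
    next
      case False
      then have D: "(x, y) \<in> comp_rel D" using that by auto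
      then have "x \<in> edges ?G" "y \<in> edges ?G"
        using comp_rel_subset_edges[OF cl2] by auto
      then have "c x = x" "c y = y"
        using disj c(3) by auto
      then show ?thesis using D by (auto intro: eqv_I)
    qed
    show "comp_rel ?G \<subseteq> eqv (comp_rel ?F)"
      using c(5) rel by (auto intro: eqv_I)
  qed (use ed in auto)
  moreover have "num_faces ?F = num_faces ?G + 1"
  proof -
    \<comment> \<open>The inner face is kept as the isolated point \<open>(u, f0)\<close>, so that
      the retraction is a bijection on classes; it is split off afterwards by
      \<open>num_classes_Un\<close>.\<close>
    have "num_classes (sides ?F) (corner_rel ?F) = num_classes (insert (u, f0) (sides ?G)) (corner_rel ?G)"
    proof (rule num_classes_retract[where h = h])
      show "h ` sides ?F \<subseteq> insert (u, f0) (sides ?G)"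
      proof
        fix p assume "p \<in> h ` sides ?F"
        then obtain e f where ef: "e \<in> edges ?F" "p = h (e, f)" by (auto simp: sides_def)
        show "p \<in> insert (u, f0) (sides ?G)"
        proof (cases "e \<in># N")
          case True
          from h(1)[OF this, of f] sub2 show ?thesis
            by (cases p) (auto simp: sides_def ef)
        next
          case False
          then show ?thesis using ef ed h(4) by (auto simp: sides_def)
        qed
      qed
      show "insert (u, f0) (sides ?G) \<subseteq> sides ?F"
        using u ed by (auto simp: sides_def)
      show "h y = y" if "y \<in> insert (u, f0) (sides ?G)" for y
        using that h(2,4) disj by (cases y) (auto simp: sides_def)
      show "(h x, x) \<in> eqv (corner_rel ?F)" if "x \<in> sides ?F" for x
        using h(3,4)[of "fst x" "snd x"] rel by (cases "fst x \<in># N") auto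
      show "(h x, h y) \<in> eqv (corner_rel ?G)" if "(x, y) \<in> corner_rel ?F" for x y
      proof (cases "(x, y) \<in> corner_rel X1")
        case True
        then show ?thesis using h(5) rel by blast
      next
        case False
        then have D: "(x, y) \<in> corner_rel D" using that by auto
        then have "x \<in> sides ?G" "y \<in> sides ?G"
          using corner_rel_subset_sides[OF cl2] by auto
        then have "h x = x" "h y = y"
          by (auto intro: hid)
        then show ?thesis using D by (auto intro: eqv_I)
      qed
      show "corner_rel ?G \<subseteq> eqv (corner_rel ?F)"
        using h(6) rel by (auto intro: eqv_I)
    qed (auto simp: sides_def)
    also have "\<dots> = num_classes ({(u, f0)} \<union> sides ?G) (corner_rel ?G)"
      by simp
    also have "\<dots> = num_classes {(u, f0)} (corner_rel ?G) + num_classes (sides ?G) (corner_rel ?G)"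
      using u disj corner_rel_subset_sides[OF cl2]
      by (intro num_classes_Un) (auto simp: sides_def)
    also have "num_classes {(u, f0)} (corner_rel ?G) = 1"
      by (simp add: num_classes_def quotient_image)
    finally show ?thesis
      by (simp add: num_faces_alt)
  qed
  \<comment> \<open>Euler balance: \<open>size N\<close> edges, \<open>size N - 1\<close> vertices
    and one face fewer, with the same number of components.\<close>
  ultimately show ?thesis
    using size card by (simp add: defect_def)
qed

section \<open>Genus of kinks, of expanded locks and of half smoothed locks\<close>

lemma eqv_clique: "(\<And>p. p \<in> P \<Longrightarrow> (p, u) \<in> eqv R) \<Longrightarrow> P \<times> P \<subseteq> eqv R"
  by (blast intro: eqv_sym eqv_trans)

text \<open>The face that disappears is the inside of the loop, on side \<open>f0\<close> of
  \<open>x\<close>; the other side of \<open>x\<close> borders the same face as side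
  \<open>f0\<close> of \<open>b\<close>.\<close>

lemma defect_kink:
  assumes "closed_figure (D + {#K#})"
    and "K = Crossing s x b x d \<or> K = Crossing s b x d x"
  shows "defect (D + {#K#}) = defect (D + {#Bend b d#})"
proof -
  have hd: "heads {#K#} = {#x#} + heads {#Bend b d#}" "tails {#K#} = {#x#} + tails {#Bend b d#}"
    using assms(2) by auto
  have cl: "closed_figure (D + {#Bend b d#})" and x: "x \<notin> edges (D + {#Bend b d#})"
    using assms(1) closed_figure_extend[OF hd, of D] by auto
  have b: "x \<noteq> b" "x \<noteq> d"
    using x ins_subset_edges[of "Bend b d" "D + {#Bend b d#}"] outs_subset_edges[OF cl, of "Bend b d"]
    by auto
  obtain f0 where f0: "f0 \<longleftrightarrow> K = Crossing s x b x d" by simp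
  have K: "K = (if f0 then Crossing s x b x d else Crossing s b x d x)"
    using f0 assms(2) by auto
  show ?thesis
  proof (rule defect_retract[where N = "{#x#}" and u = x and ?f0.0 = f0
        and h = "id((x, \<not> f0) := (b, f0))" and c = "id(x := b)"])
    show "corner_rel {#Bend b d#} \<subseteq> eqv (corner_rel {#K#})"
    proof -
      have "((b, f0), (d, f0)) \<in> eqv (corner_rel {#K#})"
        by (rule eqv_trans[of _ "(x, \<not> f0)"]; cases f0) (simp_all add: K eqv_I eqv_I')
      moreover have "((b, \<not> f0), (d, \<not> f0)) \<in> eqv (corner_rel {#K#})"
        by (cases f0) (simp_all add: K eqv_I eqv_I')
      ultimately show ?thesis by (cases f0) auto
    qed
    show "(id((x, \<not> f0) := (b, f0))) (n, f) = (n, f)" if "n \<notin># {#x#}" for n f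
      using that by simp
    show "(((id((x, \<not> f0) := (b, f0))) (n, f), (n, f)) \<in> eqv (corner_rel {#K#}))" if "n \<in># {#x#}" for n f
      using that by (cases f0; cases f) (simp_all add: K eqv_I eqv_I')
  qed (use assms(1) b in \<open>auto simp: K edges_heads eqv_I eqv_I' split: if_splits\<close>)
qed

definition lock_bend :: "figure \<Rightarrow> bool" where
  "lock_bend F \<longleftrightarrow> (\<forall>s a b c d. Crossing s a b c d \<notin># F)"

lemma heads_underlying_lock:
  "heads (expand (Lock s l i1 o1 i2 o2 u v)) = {#u, v#} + heads {#Lock s l i1 o1 i2 o2 u v#}"
  "tails (expand (Lock s l i1 o1 i2 o2 u v)) = {#u, v#} + tails {#Lock s l i1 o1 i2 o2 u v#}"
  by auto

lemma fresh_edges: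
  assumes "closed_figure (D + X1)" "heads X1 = {#u, v#} + heads X2" "tails X1 = {#u, v#} + tails X2"
  shows "closed_figure (D + X2)" "u \<noteq> v" "u \<notin> edges (D + X2)" "v \<notin> edges (D + X2)"
    "edges (D + X1) = {u, v} \<union> edges (D + X2)"
proof -
  have *: "closed_figure (D + X2)" "\<forall>e. count {#u, v#} e \<le> 1" "set_mset {#u, v#} \<inter> edges (D + X2) = {}"
    using closed_figure_extend[OF assms(2,3), of D] assms(1) by auto
  then show "closed_figure (D + X2)" "u \<notin> edges (D + X2)" "v \<notin> edges (D + X2)"
    by auto
  show "u \<noteq> v"
    using *(2)[rule_format, of u] by (auto split: if_splits)
  show "edges (D + X1) = {u, v} \<union> edges (D + X2)"
    using edges_extend[OF assms(2), of D] by auto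
qed

lemma mem_edges_add:
  assumes "closed_figure (D + X)" "x \<in># X" "e \<in># ins x + outs x"
  shows "e \<in> edges (D + X)"
  using assms ins_subset_edges[of x "D + X"] outs_subset_edges[of "D + X" x] by auto

lemma clique_image:
  "(p, r) \<in> A \<times> A \<union> B \<times> B \<Longrightarrow> c ` A \<subseteq> Q \<Longrightarrow> c ` B \<subseteq> Q \<Longrightarrow> (c p, c r) \<in> Q \<times> Q"
  "(p, r) \<in> A \<times> A \<union> B \<times> B \<union> C \<times> C \<Longrightarrow> c ` A \<subseteq> P \<Longrightarrow> c ` B \<subseteq> Q \<Longrightarrow> c ` C \<subseteq> P \<Longrightarrow>
    (c p, c r) \<in> Q \<times> Q \<union> P \<times> P"
  by blast+

text \<open>The additional face is the bigon between the two crossings, on side \<open>l\<close> of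
  both \<open>u\<close> and \<open>v\<close>. Their other sides belong to the two lateral corners,
  which is where \<open>h\<close> sends them.\<close>

lemma defect_expand:
  assumes "closed_figure (D + expand (Lock s l i1 o1 i2 o2 u v))"
  shows "defect (D + expand (Lock s l i1 o1 i2 o2 u v)) = defect (D + {#Lock s l i1 o1 i2 o2 u v#})"
proof -
  let ?L = "Lock s l i1 o1 i2 o2 u v"
  note fr = fresh_edges[OF assms heads_underlying_lock]
  have ne: "u \<noteq> v" "v \<noteq> u" "e \<noteq> u" "e \<noteq> v" "u \<noteq> e" "v \<noteq> e" if "e \<in> {i1, i2, o1, o2}" for e
    using fr(2-4) mem_edges_add[OF fr(1), of ?L e] that by auto
  note ne = ne[of i1] ne[of i2] ne[of o1] ne[of o2]
  have com: "comp_rel {#?L#} = {i1, i2, o1, o2} \<times> {i1, i2, o1, o2}"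
    by auto
  have comX: "comp_rel (expand ?L) = {u, i1, v, o2} \<times> {u, i1, v, o2} \<union> {v, i2, u, o1} \<times> {v, i2, u, o1}"
    by auto
  show ?thesis
  proof (rule defect_retract[where N = "{#u, v#}" and u = u and ?f0.0 = l
        and h = "id((u, \<not> l) := (i1, l), (v, \<not> l) := (i2, l), (v, l) := (u, l))"
        and c = "id(u := i1, v := i2)"])
    show "fst ((id((u, \<not> l) := (i1, l), (v, \<not> l) := (i2, l), (v, l) := (u, l))) (n, f)) \<in> edges {#?L#} \<or>
        (id((u, \<not> l) := (i1, l), (v, \<not> l) := (i2, l), (v, l) := (u, l))) (n, f) = (u, l)"
      if "n \<in># {#u, v#}" for n f
      using that by (cases "f = l") (auto simp: edges_heads)
    show "comp_rel {#?L#} \<subseteq> eqv (comp_rel (expand ?L))"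
      unfolding com by (rule eqv_clique[of _ u]) (auto simp: comX intro!: eqv_I)
    show "corner_rel {#?L#} \<subseteq> eqv (corner_rel (expand ?L))"
    proof -
      have "((i1, l), (o1, l)) \<in> eqv (corner_rel (expand ?L))"
        by (rule eqv_trans[of _ "(u, \<not> l)"]; cases l) (simp_all add: eqv_I eqv_I')
      moreover have "((i2, l), (o2, l)) \<in> eqv (corner_rel (expand ?L))"
        by (rule eqv_trans[of _ "(v, \<not> l)"]; cases l) (simp_all add: eqv_I eqv_I')
      moreover have "((i1, \<not> l), (o2, \<not> l)) \<in> eqv (corner_rel (expand ?L))"
        "((i2, \<not> l), (o1, \<not> l)) \<in> eqv (corner_rel (expand ?L))"
        by (cases l; simp add: eqv_I eqv_I')+
      ultimately show ?thesis by auto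
    qed
    show "((id((u, \<not> l) := (i1, l), (v, \<not> l) := (i2, l), (v, l) := (u, l))) (n, f), (n, f))
        \<in> eqv (corner_rel (expand ?L))" if "n \<in># {#u, v#}" for n f
    proof -
      have *: "((i1, l), (u, \<not> l)) \<in> eqv (corner_rel (expand ?L))"
        "((i2, l), (v, \<not> l)) \<in> eqv (corner_rel (expand ?L))"
        "((u, l), (v, l)) \<in> eqv (corner_rel (expand ?L))"
        by (cases l; simp add: eqv_I eqv_I')+
      have "f = l \<or> f = (\<not> l)" by auto
      with that show ?thesis
        using * ne(1) by (elim disjE) auto
    qed
    show "((id((u, \<not> l) := (i1, l), (v, \<not> l) := (i2, l), (v, l) := (u, l))) p,
        (id((u, \<not> l) := (i1, l), (v, \<not> l) := (i2, l), (v, l) := (u, l))) r)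
        \<in> eqv (corner_rel {#?L#})" if "(p, r) \<in> corner_rel (expand ?L)" for p r
      using that by (cases l; simp; elim disjE conjE; simp add: ne eqv_I eqv_I')
    show "((id(u := i1, v := i2)) p, (id(u := i1, v := i2)) r) \<in> eqv (comp_rel {#?L#})"
      if "(p, r) \<in> comp_rel (expand ?L)" for p r
    proof -
      have "id(u := i1, v := i2) ` {u, i1, v, o2} \<subseteq> {i1, i2, o1, o2}"
        "id(u := i1, v := i2) ` {v, i2, u, o1} \<subseteq> {i1, i2, o1, o2}"
        using ne by auto
      then show ?thesis
        unfolding com by (intro eqv_I clique_image(1)[OF that[unfolded comX]])
    qed
    show "((id(u := i1, v := i2)) n, n) \<in> eqv (comp_rel (expand ?L))" if "n \<in># {#u, v#}" for n
      unfolding comX by (rule eqv_I) (use that ne(1) in auto)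
  qed (use ne(1) assms in \<open>auto simp: edges_heads\<close>)
qed

text \<open>\<open>True\<close> smooths both crossings along the orientation and thereby unites the
  lateral corners; \<open>False\<close> untwists the two strands and unites the end corners.\<close>

fun resolve :: "bool \<Rightarrow> vertex \<Rightarrow> figure" where
  "resolve m (Lock s l i1 o1 i2 o2 u v) =
     (if m then {#Bend i1 o2, Bend i2 o1#} else {#Bend i1 o1, Bend i2 o2#})"
| "resolve m x = {#x#}"

text \<open>The term of the skein relation in which one crossing is smoothed: the other crossing has
  become a kink on the strand from \<open>i2\<close> to \<open>o1\<close>.\<close>

fun half_smoothed :: "vertex \<Rightarrow> figure" where
  "half_smoothed (Lock s l i1 o1 i2 o2 u v) =
     {#Bend u v, Bend i1 o2, if l then Crossing s v i2 u o1 else Crossing s i2 v o1 u#}"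
| "half_smoothed x = {#x#}"

lemma heads_half_smoothed:
  "heads (half_smoothed (Lock s l i1 o1 i2 o2 u v)) = {#u, v#} + heads (resolve True (Lock s l i1 o1 i2 o2 u v))"
  "tails (half_smoothed (Lock s l i1 o1 i2 o2 u v)) = {#u, v#} + tails (resolve True (Lock s l i1 o1 i2 o2 u v))"
  by auto

text \<open>The face that disappears is the inside of that kink, on side \<open>l\<close> of
  \<open>u\<close> and \<open>v\<close>.\<close>

lemma defect_half_smoothed:
  assumes "closed_figure (D + half_smoothed (Lock s l i1 o1 i2 o2 u v))"
  shows "defect (D + half_smoothed (Lock s l i1 o1 i2 o2 u v)) =
    defect (D + resolve True (Lock s l i1 o1 i2 o2 u v))"
proof -
  let ?L = "Lock s l i1 o1 i2 o2 u v"
  note fr = fresh_edges[OF assms heads_half_smoothed]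
  have ne: "u \<noteq> v" "v \<noteq> u" "e \<noteq> u" "e \<noteq> v" "u \<noteq> e" "v \<noteq> e" if "e \<in> {i1, i2, o1, o2}" for e
    using fr(2-4) mem_edges_add[OF fr(1), of "Bend i1 o2" e] mem_edges_add[OF fr(1), of "Bend i2 o1" e] that
    by auto
  note ne = ne[of i1] ne[of i2] ne[of o1] ne[of o2]
  have com: "comp_rel (resolve True ?L) = {i1, o2} \<times> {i1, o2} \<union> {i2, o1} \<times> {i2, o1}"
    by auto
  have comX: "comp_rel (half_smoothed ?L) = {u, v} \<times> {u, v} \<union> {i1, o2} \<times> {i1, o2}
      \<union> {v, i2, u, o1} \<times> {v, i2, u, o1}"
    by auto
  show ?thesis
  proof (rule defect_retract[where N = "{#u, v#}" and u = u and ?f0.0 = l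
        and h = "id((u, \<not> l) := (i2, l), (v, \<not> l) := (i2, l), (v, l) := (u, l))"
        and c = "id(u := i2, v := i2)"])
    show "fst ((id((u, \<not> l) := (i2, l), (v, \<not> l) := (i2, l), (v, l) := (u, l))) (n, f))
          \<in> edges (resolve True ?L) \<or>
        (id((u, \<not> l) := (i2, l), (v, \<not> l) := (i2, l), (v, l) := (u, l))) (n, f) = (u, l)"
      if "n \<in># {#u, v#}" for n f
      using that by (cases "f = l") (auto simp: edges_heads)
    show "comp_rel (resolve True ?L) \<subseteq> eqv (comp_rel (half_smoothed ?L))"
      unfolding com comX by (auto simp: eqv_I)
    show "corner_rel (resolve True ?L) \<subseteq> eqv (corner_rel (half_smoothed ?L))"
    proof -
      have "((v, \<not> l), (u, \<not> l)) \<in> eqv (corner_rel (half_smoothed ?L))"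
        by (cases l) (simp_all add: eqv_I eqv_I')
      moreover have "((u, \<not> l), (o1, l)) \<in> eqv (corner_rel (half_smoothed ?L))"
        by (cases l) (simp_all add: eqv_I eqv_I')
      moreover have "((i2, l), (v, \<not> l)) \<in> eqv (corner_rel (half_smoothed ?L))"
        by (cases l) (simp_all add: eqv_I eqv_I')
      ultimately have "((i2, l), (o1, l)) \<in> eqv (corner_rel (half_smoothed ?L))"
        by (blast intro: eqv_trans)
      moreover have "((i1, l), (o2, l)) \<in> eqv (corner_rel (half_smoothed ?L))"
        "((i1, \<not> l), (o2, \<not> l)) \<in> eqv (corner_rel (half_smoothed ?L))"
        "((i2, \<not> l), (o1, \<not> l)) \<in> eqv (corner_rel (half_smoothed ?L))"
        by (cases l; simp add: eqv_I eqv_I')+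
      ultimately show ?thesis by (cases l) auto
    qed
    show "((id((u, \<not> l) := (i2, l), (v, \<not> l) := (i2, l), (v, l) := (u, l))) (n, f), (n, f))
        \<in> eqv (corner_rel (half_smoothed ?L))" if n: "n \<in># {#u, v#}" for n f
    proof -
      have "((i2, l), (v, \<not> l)) \<in> eqv (corner_rel (half_smoothed ?L))"
        "((v, \<not> l), (u, \<not> l)) \<in> eqv (corner_rel (half_smoothed ?L))"
        by (cases l; simp add: eqv_I eqv_I')+
      then have "((i2, l), (u, \<not> l)) \<in> eqv (corner_rel (half_smoothed ?L))"
        by (blast intro: eqv_trans)
      moreover have "((i2, l), (v, \<not> l)) \<in> eqv (corner_rel (half_smoothed ?L))"
        "((u, l), (v, l)) \<in> eqv (corner_rel (half_smoothed ?L))"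
        by (cases l; simp add: eqv_I eqv_I')+
      moreover have "f = l \<or> f = (\<not> l)" by auto
      ultimately show ?thesis
        using n ne(1) by (elim disjE) auto
    qed
    show "((id((u, \<not> l) := (i2, l), (v, \<not> l) := (i2, l), (v, l) := (u, l))) p,
        (id((u, \<not> l) := (i2, l), (v, \<not> l) := (i2, l), (v, l) := (u, l))) r)
        \<in> eqv (corner_rel (resolve True ?L))" if "(p, r) \<in> corner_rel (half_smoothed ?L)" for p r
      using that by (cases l; simp; elim disjE conjE; simp add: ne eqv_I eqv_I')
    show "((id(u := i2, v := i2)) p, (id(u := i2, v := i2)) r) \<in> eqv (comp_rel (resolve True ?L))"
      if "(p, r) \<in> comp_rel (half_smoothed ?L)" for p r
    proof -
      have "id(u := i2, v := i2) ` {u, v} \<subseteq> {i2, o1}"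
        "id(u := i2, v := i2) ` {i1, o2} \<subseteq> {i1, o2}"
        "id(u := i2, v := i2) ` {v, i2, u, o1} \<subseteq> {i2, o1}"
        using ne by auto
      then show ?thesis
        unfolding com by (intro eqv_I clique_image(2)[OF that[unfolded comX]])
    qed
    show "((id(u := i2, v := i2)) n, n) \<in> eqv (comp_rel (half_smoothed ?L))" if "n \<in># {#u, v#}" for n
      unfolding comX by (rule eqv_I) (use that ne(1) in auto)
  qed (use ne(1) assms in \<open>auto simp: edges_heads\<close>)
qed

lemma underlying_simps [simp]:
  "underlying {#} = {#}" "underlying (add_mset x F) = expand x + underlying F"
  "underlying (F + G) = underlying F + underlying G"
  by (simp_all add: underlying_def)

text \<open>Locks are contracted one by one; the arbitrary \<open>D\<close> carries those that are
  still expanded while another one is treated.\<close>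

lemma closed_underlying:
  "closed_figure (D + underlying F) \<Longrightarrow>
    closed_figure (D + F) \<and> defect (D + underlying F) = defect (D + F)"
proof (induction F arbitrary: D)
  case empty
  then show ?case by simp
next
  case (add x F)
  have "closed_figure ((D + F) + expand x) \<and> defect (D + expand x + underlying F) = defect ((D + F) + expand x)"
    using add.IH[of "D + expand x"] add.prems by (simp add: ac_simps)
  moreover have "closed_figure ((D + F) + {#x#}) \<and> defect ((D + F) + expand x) = defect ((D + F) + {#x#})"
    if "closed_figure ((D + F) + expand x)"
  proof (cases x)
    case (Lock s l i1 o1 i2 o2 u v)
    then show ?thesis
      using that defect_expand[of "D + F"] fresh_edges(1)[of "D + F", OF _ heads_underlying_lock]
      by blast
  qed (use that in simp_all)
  ultimately show ?case by (simp add: ac_simps)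
qed

section \<open>Contracted figures without crossings\<close>

text \<open>\<open>arcs f x\<close> joins the incoming to the outgoing edges of \<open>x\<close> along the corners facing left
  (\<open>f = True\<close>) or right sides; this makes sense because locks and bends never join a left side
  to a right side.\<close>

fun arcs :: "bool \<Rightarrow> vertex \<Rightarrow> (nat \<times> nat) multiset" where
  "arcs f (Crossing s a b c d) = {#(a, c), (b, d)#}"
| "arcs f (Bend a b) = {#(a, b)#}"
| "arcs f (Lock s l i1 o1 i2 o2 u v) =
     (if f = l then {#(i1, o1), (i2, o2)#} else {#(i1, o2), (i2, o1)#})"

fun lead :: "vertex \<Rightarrow> nat" where
  "lead (Crossing s a b c d) = a"
| "lead (Bend a b) = a"
| "lead (Lock s l i1 o1 i2 o2 u v) = i1"

definition arcs_along :: "(nat \<Rightarrow> bool) \<Rightarrow> figure \<Rightarrow> (nat \<times> nat) multiset" where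
  "arcs_along w F = \<Sum>\<^sub># (image_mset (\<lambda>x. arcs (w (lead x)) x) F)"

definition coherent :: "(nat \<Rightarrow> bool) \<Rightarrow> figure \<Rightarrow> bool" where
  "coherent w F \<longleftrightarrow> (\<forall>x\<in>#F. \<forall>e\<in>#ins x + outs x. w e = w (lead x))"

lemma arcs_along_simps [simp]:
  "arcs_along w {#} = {#}"
  "arcs_along w (add_mset x F) = arcs (w (lead x)) x + arcs_along w F"
  "arcs_along w (F + G) = arcs_along w F + arcs_along w G"
  by (simp_all add: arcs_along_def)

lemma image_arcs [simp]: "image_mset fst (arcs f x) = ins x" "image_mset snd (arcs f x) = outs x"
  by (cases x; simp add: add_mset_commute)+

lemma image_arcs_along [simp]:
  "image_mset fst (arcs_along w F) = heads F" "image_mset snd (arcs_along w F) = tails F"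
  by (induction F) simp_all

lemma perm_arcs_along [simp]: "perm_arcs (arcs_along w F) \<longleftrightarrow> closed_figure F"
  by (simp add: perm_arcs_def closed_figure_iff)

lemma edges_arcs_along: "edges F = fst ` set_mset (arcs_along w F)"
  by (metis edges_heads image_arcs_along(1) set_image_mset)

lemma set_arcs_along: "set_mset (arcs_along w F) = (\<Union>x\<in>set_mset F. set_mset (arcs (w (lead x)) x))"
  by (induction F) auto

lemma corners_arcs:
  "lock_bend F \<Longrightarrow> x \<in># F \<Longrightarrow> corners x = {((a, f), (b, f)) | a b f. (a, b) \<in># arcs f x}"
  by (cases x) (auto simp: lock_bend_def)

lemma arcs_in_out: "(a, b) \<in># arcs f x \<Longrightarrow> a \<in># ins x \<and> b \<in># outs x"
  by (metis fst_conv snd_conv image_arcs imageI set_image_mset)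

text \<open>A coherent \<open>w\<close> selects one side of every edge, and no corner leads from a
  selected side to another one. A face that starts on a selected side thus stays there and follows
  the arcs.\<close>

lemma eqv_corner_arcs:
  assumes "lock_bend F" "coherent w F" "(p, r) \<in> eqv (corner_rel F)" "snd p = w (fst p)"
  shows "snd r = w (fst r) \<and> (fst p, fst r) \<in> eqv (set_mset (arcs_along w F))"
proof -
  have corner: "snd p = snd r \<and> w (fst p) = w (fst r) \<and>
      (snd p = w (fst p) \<longrightarrow> (fst p, fst r) \<in># arcs_along w F)" if "(p, r) \<in> corner_rel F" for p r
  proof -
    from that obtain x where x: "x \<in># F" "(p, r) \<in> corners x"
      by (auto simp: corner_rel_def)
    then obtain a b f where ab: "p = (a, f)" "r = (b, f)" "(a, b) \<in># arcs f x"
      using corners_arcs[OF assms(1)] by auto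
    then have "w a = w (lead x)" "w b = w (lead x)"
      using x(1) arcs_in_out[OF ab(3)] assms(2) by (auto simp: coherent_def)
    then show ?thesis
      using ab x by (auto simp: set_arcs_along)
  qed
  show ?thesis
    using assms(3) unfolding eqv_def[of "corner_rel F"]
  proof (induction rule: rtrancl_induct)
    case base
    then show ?case using assms(4) by simp
  next
    case (step y z)
    then consider "(y, z) \<in> corner_rel F" | "(z, y) \<in> corner_rel F" by auto
    then show ?case
    proof cases
      case 1
      then show ?thesis
        using corner[OF 1] step.IH by (metis eqv_I eqv_trans)
    next
      case 2
      then show ?thesis
        using corner[OF 2] step.IH by (metis eqv_I' eqv_trans)
    qed
  qed
qed

lemma num_classes_side:
  assumes "lock_bend F" "coherent w F"
  shows "num_classes {(e, w e) | e. e \<in> edges F} (corner_rel F) =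
    num_classes (edges F) (set_mset (arcs_along w F))"
proof -
  show ?thesis
  proof (rule num_classes_bij[where h = "\<lambda>e. (e, w e)", symmetric])
    show "((a, w a), (b, w b)) \<in> eqv (corner_rel F)" if ab: "(a, b) \<in># arcs_along w F" for a b
    proof -
      from ab obtain x where x: "x \<in># F" "(a, b) \<in># arcs (w (lead x)) x"
        by (auto simp: set_arcs_along)
      have "w a = w (lead x)" "w b = w (lead x)"
        using x(1) arcs_in_out[OF x(2)] assms(2) by (auto simp: coherent_def)
      then have "((a, w a), (b, w b)) \<in> corners x"
        using x corners_arcs[OF assms(1) x(1)] by auto
      then show ?thesis
        using x(1) by (intro eqv_I) (auto simp: corner_rel_def)
    qed
    show "(a, b) \<in> eqv (set_mset (arcs_along w F))"
      if "((a, w a), (b, w b)) \<in> eqv (corner_rel F)" for a b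
      using eqv_corner_arcs[OF assms that] by simp
  qed auto
qed

text \<open>Applied with constant \<open>w\<close>, i.e. left against right, for the genus, and with
  the colouring, i.e. white against black, for the states.\<close>

lemma num_faces_split:
  assumes "closed_figure F" "lock_bend F" "coherent w F"
  shows "num_faces F = num_classes (edges F) (set_mset (arcs_along w F)) +
    num_classes (edges F) (set_mset (arcs_along (Not \<circ> w) F))"
proof -
  let ?S = "\<lambda>w. {(e, w e) | e. e \<in> edges F}"
  have co: "coherent (Not \<circ> w) F"
    using assms(3) by (auto simp: coherent_def)
  have un: "sides F = ?S w \<union> ?S (Not \<circ> w)"
    by (auto simp: sides_def)
  have "corner_rel F \<subseteq> ?S w \<times> ?S w \<union> (- ?S w) \<times> (- ?S w)"
  proof
    fix pr assume pr: "pr \<in> corner_rel F"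
    then obtain x where x: "x \<in># F" "pr \<in> corners x"
      by (auto simp: corner_rel_def)
    then obtain a b f where ab: "pr = ((a, f), (b, f))" "(a, b) \<in># arcs f x"
      using corners_arcs[OF assms(2)] by auto
    then have "w a = w (lead x)" "w b = w (lead x)"
      using x(1) arcs_in_out[OF ab(2)] assms(3) by (auto simp: coherent_def)
    moreover have "a \<in> edges F" "b \<in> edges F"
      using corner_rel_subset_sides[OF assms(1)] pr ab by (auto simp: sides_def)
    ultimately show "pr \<in> ?S w \<times> ?S w \<union> (- ?S w) \<times> (- ?S w)"
      using ab(1) by auto
  qed
  then have "num_classes (?S w \<union> ?S (Not \<circ> w)) (corner_rel F) =
      num_classes (?S w) (corner_rel F) + num_classes (?S (Not \<circ> w)) (corner_rel F)"
    by (intro num_classes_Un) auto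
  then show ?thesis
    using num_classes_side[OF assms(2,3)] num_classes_side[OF assms(2) co]
    by (simp add: num_faces_alt un)
qed

lemma eqv_arcs_comp: "eqv (set_mset (arcs_along w F)) \<subseteq> eqv (comp_rel F)"
proof (rule eqv_subset, safe)
  fix a b assume "(a, b) \<in># arcs_along w F"
  then obtain x where "x \<in># F" "(a, b) \<in># arcs (w (lead x)) x"
    by (auto simp: set_arcs_along)
  then show "(a, b) \<in> comp_rel F"
    using arcs_in_out[of a b _ x] by (auto simp: comp_rel_def)
qed

section \<open>Genus zero of circles, and behaviour of the genus under smoothing\<close>

definition all_bends :: "figure \<Rightarrow> bool" where
  "all_bends F \<longleftrightarrow> (\<forall>x\<in>#F. \<exists>a b. x = Bend a b)"

lemma all_bends_simps [simp]:
  "all_bends {#}" "all_bends (add_mset x F) \<longleftrightarrow> (\<exists>a b. x = Bend a b) \<and> all_bends F"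
  "all_bends (F + G) \<longleftrightarrow> all_bends F \<and> all_bends G"
  by (auto simp: all_bends_def)

lemma lock_bend_simps [simp]:
  "lock_bend {#}" "lock_bend (F + G) \<longleftrightarrow> lock_bend F \<and> lock_bend G"
  "lock_bend (add_mset (Bend a b) F) \<longleftrightarrow> lock_bend F"
  "lock_bend (add_mset (Lock s l i1 o1 i2 o2 u v) F) \<longleftrightarrow> lock_bend F"
  by (auto simp: lock_bend_def)

lemma all_bends_lock_bend: "all_bends F \<Longrightarrow> lock_bend F"
  by (auto simp: all_bends_def lock_bend_def)

lemma num_components_all_bends:
  assumes "all_bends F"
  shows "num_components F = num_classes (edges F) (set_mset (arcs_along w F))"
  unfolding num_components_alt
proof (rule num_classes_cong, rule equalityI)
  have "comp_rel F \<subseteq> eqv (set_mset (arcs_along w F))"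
  proof safe
    fix a b assume "(a, b) \<in> comp_rel F"
    then obtain x where x: "x \<in># F" "a \<in># ins x + outs x" "b \<in># ins x + outs x"
      by (auto simp: comp_rel_def)
    then obtain c d where cd: "x = Bend c d"
      using assms by (auto simp: all_bends_def)
    then have "(c, d) \<in># arcs_along w F"
      using x(1) by (force simp: set_arcs_along)
    then show "(a, b) \<in> eqv (set_mset (arcs_along w F))"
      using x cd eqv_I eqv_I' by fastforce
  qed
  then show "eqv (comp_rel F) \<subseteq> eqv (set_mset (arcs_along w F))"
    by (rule eqv_mono)
qed (rule eqv_arcs_comp)

lemma size_heads_bends: "all_bends F \<Longrightarrow> size (heads F) = size F"
  by (induction F) auto

lemma coherent_const: "coherent (\<lambda>_. f) F"
  by (simp add: coherent_def)

lemma num_faces_const: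
  assumes "closed_figure F" "lock_bend F"
  shows "num_faces F = num_classes (edges F) (set_mset (arcs_along (\<lambda>_. f) F)) +
    num_classes (edges F) (set_mset (arcs_along (\<lambda>_. \<not> f) F))"
  using num_faces_split[OF assms coherent_const[of f]] by (simp add: o_def)

text \<open>Each component is a circle with as many edges as vertices and with two faces.\<close>

lemma defect_all_bends:
  assumes "closed_figure F" "all_bends F"
  shows "defect F = 0"
proof -
  have "num_faces F = 2 * num_components F"
    using num_faces_const[OF assms(1) all_bends_lock_bend[OF assms(2)], of True]
      num_components_all_bends[OF assms(2)] by simp
  then show ?thesis
    using size_heads_closed[OF assms(1)] size_heads_bends[OF assms(2)] by (simp add: defect_def)
qed

lemma heads_resolve [simp]: "heads (resolve m x) = ins x" "tails (resolve m x) = outs x"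
  by (cases x; simp add: add_mset_commute)+

lemma edges_resolve: "edges (F + resolve m x) = edges (F + {#x#})"
  by (simp add: edges_heads Un_commute)

lemma closed_resolve: "closed_figure (F + resolve m x) \<longleftrightarrow> closed_figure (F + {#x#})"
  by (simp add: closed_figure_iff add_ac)

text \<open>The arcs change only on the side \<open>f\<close> facing the corners that are united,
  and there by one switch. One vertex is gained and no edge. If the number of components stays the
  same, at most one face is lost, which is just compensated. If a component splits in two, the
  switch joins two cycles of the smoothed figure into one, so smoothing gains exactly one face and
  the defect is unchanged.\<close>

lemma defect_resolve_le:
  assumes cl: "closed_figure (F + {#L#})" and lb: "lock_bend F" and L: "L = Lock s l i1 o1 i2 o2 u v"
  shows "defect (F + resolve m L) \<le> defect (F + {#L#})"
proof -
  let ?G = "F + {#L#}" and ?G' = "F + resolve m L"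
  define f where "f \<longleftrightarrow> m = l"
  have cl': "closed_figure ?G'"
    using cl by (simp add: closed_resolve)
  have ed: "edges ?G' = edges ?G"
    by (rule edges_resolve)
  define M where "M = arcs_along (\<lambda>_. f) F"
  obtain a b c d where abcd: "arcs_along (\<lambda>_. f) ?G = M + {#(a, c), (b, d)#}"
    "arcs_along (\<lambda>_. f) ?G' = M + {#(a, d), (b, c)#}" "{a, b} = {i1, i2}" "{c, d} = {o1, o2}"
    "resolve m L = {#Bend a d, Bend b c#}"
  proof (cases m)
    case True
    show ?thesis
      by (rule that[of i1 o1 i2 o2]) (use True in \<open>auto simp: M_def L f_def\<close>)
  next
    case False
    show ?thesis
      by (rule that[of i1 o2 i2 o1]) (use False in \<open>auto simp: M_def L f_def\<close>)
  qed
  have "arcs_along (\<lambda>_. \<not> f) ?G = arcs_along (\<lambda>_. \<not> f) ?G'"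
    by (auto simp: L f_def)
  define n where "n = num_classes (edges ?G) (set_mset (M + {#(a, c), (b, d)#}))"
  define n' where "n' = num_classes (edges ?G) (set_mset (M + {#(a, d), (b, c)#}))"
  have faces: "int (num_faces ?G') - int (num_faces ?G) = int n' - int n"
  proof -
    have "lock_bend ?G" "lock_bend ?G'"
      using lb by (simp_all add: L)
    from num_faces_const[OF cl this(1), of f] num_faces_const[OF cl' this(2), of f] show ?thesis
      unfolding n_def n'_def ed abcd(1,2) \<open>arcs_along (\<lambda>_. \<not> f) ?G = _\<close> by simp
  qed
  have perm: "perm_arcs (M + {#(a, d), (b, c)#})"
    using cl' abcd(2) perm_arcs_along by metis
  have X: "edges ?G = fst ` set_mset (M + {#(a, d), (b, c)#})"
    using edges_arcs_along[of ?G' "\<lambda>_. f"] unfolding ed abcd(2) .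
  \<comment> \<open>The switch is read backwards, from the smoothed figure: it is there that
    different components force different cycles.\<close>
  have sw: "n \<le> Suc n'" "(a, b) \<notin> eqv (set_mset (M + {#(a, d), (b, c)#})) \<Longrightarrow> n' = Suc n"
    using num_classes_switch(1,3)[OF perm X] by (simp_all add: n_def n'_def)
  have ab: "a \<in> edges ?G" "b \<in> edges ?G"
    unfolding X by auto
  have c1: "comp_rel ?G = comp_rel F \<union> {a, b, c, d} \<times> {a, b, c, d}"
  proof -
    have "{a, b, c, d} = {i1, o1, i2, o2}"
      using abcd(3,4) by auto
    then show ?thesis by (auto simp: L)
  qed
  have c2: "comp_rel ?G' = comp_rel F \<union> {a, d} \<times> {a, d} \<union> {b, c} \<times> {b, c}"
    by (auto simp: abcd(5))
  have "eqv (comp_rel ?G) = eqv (insert (a, b) (comp_rel ?G'))"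
  proof (rule eqv_eqI)
    have ba: "(b, a) \<in> eqv (insert (a, b) (comp_rel ?G'))"
      by (rule eqv_I') simp
    moreover have "(d, a) \<in> eqv (insert (a, b) (comp_rel ?G'))" "(c, b) \<in> eqv (insert (a, b) (comp_rel ?G'))"
      unfolding c2 by (simp_all add: eqv_I)
    moreover from this(2) ba have "(c, a) \<in> eqv (insert (a, b) (comp_rel ?G'))"
      by (rule eqv_trans)
    ultimately have "{a, b, c, d} \<times> {a, b, c, d} \<subseteq> eqv (insert (a, b) (comp_rel ?G'))"
      using ba eqv_refl[of a] by (intro eqv_clique[of _ a]) (elim insertE emptyE; blast)
    then show "comp_rel ?G \<subseteq> eqv (insert (a, b) (comp_rel ?G'))"
      unfolding c1 by (rule Un_least[rotated]) (rule subset_eqv, auto)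
    show "insert (a, b) (comp_rel ?G') \<subseteq> eqv (comp_rel ?G)"
      unfolding c1 c2 by (rule subset_eqv) auto
  qed
  then have comp: "num_components ?G = num_classes (edges ?G) (insert (a, b) (comp_rel ?G'))"
    unfolding num_components_alt by (rule num_classes_cong)
  have comp': "num_components ?G' = num_classes (edges ?G) (comp_rel ?G')"
    by (simp add: num_components_alt ed)
  have size: "size ?G' = Suc (size ?G)"
    by (simp add: abcd(5))
  show ?thesis
  proof (cases "(a, b) \<in> eqv (comp_rel ?G')")
    case True
    then have "num_components ?G = num_components ?G'"
      using comp comp' num_classes_insert_same by metis
    then show ?thesis
      using faces sw(1) size by (simp add: defect_def ed)
  next
    case False
    then have "num_components ?G' = Suc (num_components ?G)"
      using comp comp' num_classes_insert_new[OF finite_edges ab] by metis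
    moreover have "n' = Suc n"
      using False eqv_arcs_comp[of "\<lambda>_. f" ?G'] sw(2) unfolding abcd(2) by blast
    ultimately show ?thesis
      using faces size by (simp add: defect_def ed)
  qed
qed

lemma lock_bend_cases:
  assumes "lock_bend F"
  obtains "all_bends F"
  | G s l i1 o1 i2 o2 u v where "F = G + {#Lock s l i1 o1 i2 o2 u v#}" "lock_bend G"
proof (cases "all_bends F")
  case False
  then obtain x where x: "x \<in># F" "\<nexists>a b. x = Bend a b"
    by (auto simp: all_bends_def)
  then obtain s l i1 o1 i2 o2 u v where L: "x = Lock s l i1 o1 i2 o2 u v"
    using assms by (cases x) (auto simp: lock_bend_def)
  have "F = (F - {#x#}) + {#x#}"
    using x(1) by simp
  moreover have "lock_bend (F - {#x#})"
    using assms by (auto simp: lock_bend_def dest: in_diffD)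
  ultimately show ?thesis
    using that(2) L by metis
qed (use that in blast)

definition num_locks :: "figure \<Rightarrow> nat" where
  "num_locks F = size (filter_mset (\<lambda>x. \<nexists>a b. x = Bend a b) F)"

text \<open>Smoothing all locks never raises the defect and ends with circles, where it is
  0.\<close>

lemma defect_nonneg:
  assumes "closed_figure F" "lock_bend F"
  shows "defect F \<ge> 0"
  using assms
proof (induction "num_locks F" arbitrary: F rule: less_induct)
  case less
  from less.prems(2) show ?case
  proof (cases rule: lock_bend_cases)
    case 1
    then show ?thesis using less.prems defect_all_bends by simp
  next
    case (2 G s l i1 o1 i2 o2 u v)
    let ?L = "Lock s l i1 o1 i2 o2 u v"
    have "0 \<le> defect (G + resolve True ?L)"
    proof (rule less.hyps)
      show "closed_figure (G + resolve True ?L)"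
        using less.prems(1) 2 by (simp only: closed_resolve)
    qed (use 2 in \<open>auto simp: num_locks_def\<close>)
    also have "\<dots> \<le> defect (G + {#?L#})"
      by (rule defect_resolve_le) (use less.prems 2 in auto)
    finally show ?thesis
      by (simp add: 2)
  qed
qed

text \<open>Closedness is required of \<open>underlying F\<close> because this also makes the inner
  names \<open>u\<close>, \<open>v\<close> of all locks distinct and fresh. The genus can be
  measured on the contracted figure by \<open>closed_underlying\<close>.\<close>

definition spherical_lock_bend :: "figure \<Rightarrow> bool" where
  "spherical_lock_bend F \<longleftrightarrow> lock_bend F \<and> closed_figure (underlying F) \<and> defect F = 0"

lemma link_diagram_underlying:
  assumes "spherical_lock_bend F"
  shows "link_diagram (underlying F)"
proof -
  have "defect (underlying F) = 0"
    using assms closed_underlying[of "{#}" F] by (simp add: spherical_lock_bend_def)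
  moreover have "Lock s l i1 o1 i2 o2 u v \<notin># underlying F" for s l i1 o1 i2 o2 u v
  proof -
    have "Lock s l i1 o1 i2 o2 u v \<notin># expand x" for x
      by (cases x) auto
    then show ?thesis
      by (auto simp: underlying_def)
  qed
  ultimately show ?thesis
    using assms by (simp add: link_diagram_def spherical_iff spherical_lock_bend_def)
qed

lemma bipartite_spherical_lock_bend:
  "bipartite_diagram B \<Longrightarrow> spherical_lock_bend B"
  using closed_underlying[of "{#}" B]
  by (auto simp: bipartite_diagram_def spherical_lock_bend_def link_diagram_def spherical_iff lock_bend_def)

lemma underlying_bends: "all_bends F \<Longrightarrow> underlying F = F"
  by (induction F) auto

lemma all_bends_resolve: "all_bends (resolve m (Lock s l i1 o1 i2 o2 u v))"
  by simp

text \<open>The defect is squeezed between \<open>defect_nonneg\<close> and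
  \<open>defect_resolve_le\<close>.\<close>

lemma spherical_resolve:
  assumes "spherical_lock_bend (F + {#L#})" and L: "L = Lock s l i1 o1 i2 o2 u v"
  shows "spherical_lock_bend (F + resolve m L)"
proof -
  have lb: "lock_bend F" and cl: "closed_figure (underlying F + expand L)" and d: "defect (F + {#L#}) = 0"
    using assms by (auto simp: spherical_lock_bend_def)
  have cl2: "closed_figure (underlying F + {#L#})"
    using cl fresh_edges(1)[OF _ heads_underlying_lock] L by blast
  have "underlying (resolve m L) = resolve m L"
    using all_bends_resolve underlying_bends L by metis
  then have 1: "closed_figure (underlying (F + resolve m L))"
    using cl2 by (simp add: closed_resolve)
  have lb': "lock_bend (F + resolve m L)"
    using lb all_bends_lock_bend[OF all_bends_resolve] L by simp
  have clF: "closed_figure (F + {#L#})"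
    using closed_underlying[of "{#}" "F + {#L#}"] assms by (simp add: spherical_lock_bend_def)
  have "defect (F + resolve m L) \<le> 0"
    using defect_resolve_le[OF clF lb L, of m] d by simp
  moreover have "0 \<le> defect (F + resolve m L)"
    using clF lb' by (intro defect_nonneg) (simp_all only: closed_resolve)
  ultimately show ?thesis
    using 1 lb' by (simp add: spherical_lock_bend_def)
qed

section \<open>Skein expansion of locks\<close>

definition no_locks :: "figure \<Rightarrow> bool" where
  "no_locks D \<longleftrightarrow> (\<forall>s l i1 o1 i2 o2 u v. Lock s l i1 o1 i2 o2 u v \<notin># D)"

lemma no_locks_simps [simp]:
  "no_locks {#}" "no_locks (F + G) \<longleftrightarrow> no_locks F \<and> no_locks G"
  "no_locks (add_mset (Bend a b) F) \<longleftrightarrow> no_locks F"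
  "no_locks (add_mset (Crossing s a b c d) F) \<longleftrightarrow> no_locks F"
  by (auto simp: no_locks_def)

lemma link_diagram_iff:
  "link_diagram D \<longleftrightarrow> closed_figure D \<and> defect D = 0 \<and> no_locks D"
  by (simp add: link_diagram_def spherical_iff no_locks_def)

lemma no_locks_bends: "all_bends F \<Longrightarrow> no_locks F"
  by (auto simp: all_bends_def no_locks_def)

lemma link_diagram_sign:
  assumes "link_diagram (D + {#Crossing s a b c d#})"
  shows "link_diagram (D + {#Crossing s' a b c d#})"
proof -
  have cong: "link_diagram F'"
    if "link_diagram F" "heads F = heads F'" "tails F = tails F'" "corner_rel F = corner_rel F'"
      "comp_rel F = comp_rel F'" "size F = size F'" "no_locks F = no_locks F'" for F F'
    using that(1)
    unfolding link_diagram_iff closed_figure_iff defect_def num_faces_alt num_components_alt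
      edges_heads sides_def that(2-7) .
  show ?thesis
    by (rule cong[OF assms]) simp_all
qed

text \<open>Locks are excluded because \<open>rename\<close> also acts on their inner names, which
  are not edges of the contracted figure and hence not covered by freshness.\<close>

lemma rename_fresh:
  assumes "no_locks D" "closed_figure (D + X)" "b \<notin> edges (D + X)"
  shows "image_mset (rename (\<lambda>e. if e = b then a else e)) D = D"
proof -
  have "rename (\<lambda>e. if e = b then a else e) x = x" if "x \<in># D" for x
  proof -
    have "x \<in># D + X" using that by simp
    then have "b \<notin># ins x" "b \<notin># outs x"
      using ins_subset_edges[of x "D + X"] outs_subset_edges[OF assms(2), of x] assms(3) by blast+
    then show ?thesis
      using that assms(1) by (cases x) (auto simp: no_locks_def)
  qed
  then have "image_mset (rename (\<lambda>e. if e = b then a else e)) D = image_mset (\<lambda>x. x) D"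
    by (intro image_mset_cong)
  then show ?thesis by simp
qed

text \<open>The skein relation solved for a lock: the coefficients are \<open>A^-2\<close> and
  \<open>A^-2 * phi = A^-1 * {q}\<close> for a bullet lock, \<open>A^2\<close> and
  \<open>A^2 * phibar = - A * {q}\<close> for a circ lock.\<close>

definition lock_coeff :: "'k::field \<Rightarrow> 'k \<Rightarrow> bool \<Rightarrow> vertex \<Rightarrow> 'k" where
  "lock_coeff A q m x = A powi (if bullet x then - 2 else 2) *
     (if m then (if bullet x then phi A q else phibar A q) else 1)"

lemma sum_Pow_insert:
  assumes "finite E" "x \<notin> E"
  shows "(\<Sum>S\<in>Pow (insert x E). g S) = (\<Sum>S\<in>Pow E. g S + g (insert x S))"
proof -
  have "(\<Sum>S\<in>Pow (insert x E). g S) = (\<Sum>S\<in>Pow E. g S) + (\<Sum>S\<in>insert x ` Pow E. g S)"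
    unfolding Pow_insert using assms by (intro sum.union_disjoint) auto
  also have "(\<Sum>S\<in>insert x ` Pow E. g S) = (\<Sum>S\<in>Pow E. g (insert x S))"
    using assms by (subst sum.reindex) (auto simp: inj_on_def)
  finally show ?thesis
    by (simp add: sum.distrib)
qed

lemma num_components_circles:
  assumes "closed_figure F" "all_bends F" "\<And>a b. Bend a b \<in># F \<Longrightarrow> a = b"
  shows "num_components F = size F"
proof -
  have "eqv (comp_rel F) = eqv {}"
  proof (rule eqv_eqI)
    show "comp_rel F \<subseteq> eqv {}"
    proof safe
      fix x y assume "(x, y) \<in> comp_rel F"
      then obtain z where z: "z \<in># F" "x \<in># ins z + outs z" "y \<in># ins z + outs z"
        by (auto simp: comp_rel_def)
      then obtain c d where "z = Bend c d"
        using assms(2) by (auto simp: all_bends_def)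
      then have "x = y"
        using z assms(3) by auto
      then show "(x, y) \<in> eqv {}" by simp
    qed
  qed simp
  then have "num_components F = card (edges F)"
    unfolding num_components_alt using num_classes_cong num_classes_empty by metis
  then show ?thesis
    using size_heads_closed[OF assms(1)] size_heads_bends[OF assms(2)] by simp
qed

lemma num_components_contract:
  assumes cl: "closed_figure (F + {#Bend a b#})" and ab: "a \<noteq> b" and bends: "all_bends F"
  defines "f \<equiv> \<lambda>e. if e = b then a else e"
  shows "closed_figure (image_mset (rename f) F)"
    and "num_components (image_mset (rename f) F) = num_components (F + {#Bend a b#})"
    and "F \<noteq> {#}"
proof -
  let ?F = "F + {#Bend a b#}" and ?G = "image_mset (rename f) F"
  have eq: "add_mset a (heads F) = add_mset b (tails F)"
    and c: "\<forall>e. count (add_mset a (heads F)) e \<le> 1"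
  proof -
    have 1: "heads ?F = tails ?F" and 2: "\<forall>e. count (heads ?F) e \<le> 1"
      using cl unfolding closed_figure_iff by blast+
    show "add_mset a (heads F) = add_mset b (tails F)"
      using 1 by simp
    show "\<forall>e. count (add_mset a (heads F)) e \<le> 1"
      using 2 by simp
  qed
  have hG: "heads ?G = image_mset f (heads F)" and tG: "tails ?G = image_mset f (tails F)"
    using bends by (induction F) auto
  have a: "a \<notin># heads F"
    using c[rule_format, of a] by (simp add: not_in_iff)
  have b: "b \<in># heads F"
    using eq ab by (metis insert_noteq_member multi_member_this)
  have "image_mset f (add_mset a (heads F)) = image_mset f (add_mset b (tails F))"
    by (simp only: eq)
  then have ht: "heads ?G = tails ?G"
    unfolding hG tG using ab by (simp add: f_def)
  have "count (heads F) e \<le> 1" for e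
    using c[rule_format, of e] by (auto split: if_splits)
  then have hF: "heads F = mset_set (set_mset (heads F))"
    by (simp add: mset_set_set_mset_eq)
  have "inj_on f (set_mset (heads F))"
    using a by (auto simp: inj_on_def f_def)
  then have "heads ?G = mset_set (f ` set_mset (heads F))"
    unfolding hG by (subst hF) (rule image_mset_mset_set)
  then have "\<forall>e. count (heads ?G) e \<le> 1"
    by (simp add: count_mset_set')
  with ht show "closed_figure ?G"
    by (simp add: closed_figure_iff)
  have edG: "edges ?G = f ` edges ?F"
    unfolding edges_heads hG using b by (auto simp: f_def)
  have relG: "comp_rel ?G = (\<lambda>(x, y). (f x, f y)) ` comp_rel F"
    using bends by (induction F) (auto simp: image_Un)
  have fx: "(f x, x) \<in> eqv (comp_rel ?F)" for x
    by (simp add: f_def eqv_I)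
  have "num_classes (edges ?F) (comp_rel ?F) = num_classes (edges ?G) (comp_rel ?G)"
  proof (rule num_classes_retract[where h = f])
    show "edges ?G \<subseteq> edges ?F"
      unfolding edG using b by (auto simp: edges_heads f_def)
    show "f y = y" if "y \<in> edges ?G" for y
      using that ab unfolding edG by (auto simp: f_def)
    show "(f x, f y) \<in> eqv (comp_rel ?G)" if "(x, y) \<in> comp_rel ?F" for x y
    proof (cases "(x, y) \<in> comp_rel F")
      case True
      then show ?thesis
        unfolding relG by (intro eqv_I) force
    next
      case False
      then have "x \<in> {a, b}" "y \<in> {a, b}" using that by auto
      then have "f x = a" "f y = a" by (auto simp: f_def)
      then show ?thesis by simp
    qed
    show "comp_rel ?G \<subseteq> eqv (comp_rel ?F)"
    proof (unfold relG, safe)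
      fix x y assume "(x, y) \<in> comp_rel F"
      then have "(x, y) \<in> eqv (comp_rel ?F)"
        by (simp add: eqv_I)
      then show "(f x, f y) \<in> eqv (comp_rel ?F)"
        using fx[of x] fx[of y] by (blast intro: eqv_trans eqv_sym)
    qed
  qed (use fx in \<open>auto simp: edG\<close>)
  then show "num_components ?G = num_components ?F"
    by (simp only: num_components_alt)
  show "F \<noteq> {#}"
    using b by auto
qed

section \<open>Evaluation of the HOMFLY-PT polynomial by smoothing locks\<close>

locale homfly =
  fixes A q :: "'k::field_char_0" and H :: "figure \<Rightarrow> 'k"
  assumes A0: "A \<noteq> 0" and q0: "braces q \<noteq> 0" and H: "HOMFLY_PT A q H"
begin

lemma H_move: "move D D' \<Longrightarrow> link_diagram D \<Longrightarrow> link_diagram D' \<Longrightarrow> H D = H D'"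
  using H by (auto simp: HOMFLY_PT_def link_invariant_def)

lemma H_skein:
  "link_diagram (D + {#Crossing s a b c d#}) \<Longrightarrow>
    A * H (D + {#Crossing True a b c d#}) - inverse A * H (D + {#Crossing False a b c d#})
      = braces q * H (D + {#Bend a c, Bend b d#})"
  using H link_diagram_sign[of D s a b c d True] by (auto simp: HOMFLY_PT_def braces_def)

text \<open>Contracting \<open>Bend u v\<close> makes the remaining crossing a kink with the single
  loop edge \<open>u\<close>, which a first Reidemeister move removes. Most of the work is to see
  that the three figures are link diagrams and that the contraction renames nothing else.\<close>

lemma H_half_smoothed:
  assumes F: "spherical_lock_bend (F + {#L#})" and L: "L = Lock s l i1 o1 i2 o2 u v"
  shows "H (underlying F + half_smoothed L) = H (underlying F + resolve True L)"
proof -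
  let ?D = "underlying F"
  let ?f = "\<lambda>e. if e = v then u else e"
  define K where "K = (\<lambda>v. if l then Crossing s v i2 u o1 else Crossing s i2 v o1 u)"
  have res: "underlying (F + resolve True L) = ?D + resolve True L"
    by (simp add: L)
  have good: "spherical_lock_bend (F + resolve True L)"
    by (rule spherical_resolve[OF F L])
  then have ld: "link_diagram (?D + resolve True L)"
    using link_diagram_underlying res by metis
  have nl: "no_locks ?D"
    using ld by (simp add: link_diagram_iff)
  have "closed_figure (?D + expand L)"
    using F by (simp add: spherical_lock_bend_def add.commute)
  note fr0 = fresh_edges[OF this[unfolded L] heads_underlying_lock, folded L]
  have eqe: "edges (?D + resolve True L) = edges (?D + {#L#})"
    by (rule edges_resolve)
  have clR: "closed_figure (?D + resolve True L)"
    using ld by (simp add: link_diagram_iff)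
  have clX: "closed_figure (?D + half_smoothed L)"
    using clR fr0(2-4)
    by (subst closed_figure_extend[OF heads_half_smoothed[of s l i1 o1 i2 o2 u v, folded L]]) (simp add: eqe)
  then have "link_diagram (?D + half_smoothed L)"
    using ld nl defect_half_smoothed[of ?D s l i1 o1 i2 o2 u v] by (auto simp: link_diagram_iff L)
  moreover have X: "?D + half_smoothed L = (?D + {#Bend i1 o2, K v#}) + {#Bend u v#}"
    by (simp add: L K_def add_mset_commute)
  moreover have mv: "move ((?D + {#Bend i1 o2, K v#}) + {#Bend u v#})
      (image_mset (rename ?f) (?D + {#Bend i1 o2, K v#}))"
    by (rule contract) (rule fr0(2))
  moreover have ren: "image_mset (rename ?f) (?D + {#Bend i1 o2, K v#}) = ?D + {#Bend i1 o2#} + {#K u#}"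
  proof -
    have "v \<notin> edges (?D + resolve True L)"
      using fr0(4) eqe by simp
    then have "i1 \<noteq> v" "o2 \<noteq> v" "i2 \<noteq> v" "o1 \<noteq> v"
      using mem_edges_add[OF clR, of "Bend i1 o2" v] mem_edges_add[OF clR, of "Bend i2 o1" v]
      by (auto simp: L)
    moreover have "image_mset (rename ?f) ?D = ?D"
      by (rule rename_fresh[OF nl clR]) fact
    ultimately show ?thesis
      using fr0(2) by (simp add: K_def add_mset_commute)
  qed
  moreover have ldK: "link_diagram (?D + {#Bend i1 o2#} + {#K u#})"
  proof -
    have hd: "heads {#K u#} = {#u#} + heads {#Bend i2 o1#}" "tails {#K u#} = {#u#} + tails {#Bend i2 o1#}"
      by (auto simp: K_def)
    have eq: "?D + {#Bend i1 o2#} + {#Bend i2 o1#} = ?D + resolve True L"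
      by (simp add: L add_mset_commute)
    have cl: "closed_figure (?D + {#Bend i1 o2#} + {#K u#})"
      unfolding closed_figure_extend[OF hd] eq using clR fr0(3) eqe by simp
    moreover have "defect (?D + {#Bend i1 o2#} + {#K u#}) = defect (?D + resolve True L)"
      unfolding eq[symmetric] by (rule defect_kink[OF cl, where s = s and x = u and b = i2 and d = o1]) (auto simp: K_def)
    ultimately show ?thesis
      using ld nl by (auto simp: link_diagram_iff K_def)
  qed
  ultimately have 1: "H (?D + half_smoothed L) = H (?D + {#Bend i1 o2#} + {#K u#})"
    using H_move by metis
  have eq: "?D + resolve True L = ?D + {#Bend i1 o2#} + {#Bend i2 o1#}"
    by (simp add: L add_mset_commute)
  have "move (?D + {#Bend i1 o2#} + {#K u#}) (?D + resolve True L)"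
    unfolding eq K_def using move.R1_left move.R1_right by (cases l) (simp_all only: if_True if_False)
  then show ?thesis
    using 1 H_move[OF _ ldK ld] by simp
qed

text \<open>The skein relation is applied at the crossing \<open>C1\<close>. With its sign changed,
  it cancels against \<open>C2\<close> by a second Reidemeister move, which leaves
  \<open>resolve False\<close>; smoothed, it leaves \<open>half_smoothed L\<close>, hence
  \<open>resolve True\<close>.\<close>

lemma H_lock:
  assumes F: "spherical_lock_bend (F + {#L#})" and L: "L = Lock s l i1 o1 i2 o2 u v"
  shows "H (underlying (F + {#L#})) =
    lock_coeff A q False L * H (underlying (F + resolve False L)) +
    lock_coeff A q True L * H (underlying (F + resolve True L))"
proof -
  let ?D = "underlying F"
  define C1 where "C1 = (\<lambda>s. if l then Crossing s u i1 v o2 else Crossing s i1 u o2 v)"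
  define C2 where "C2 = (if l then Crossing s v i2 u o1 else Crossing s i2 v o1 u)"
  have res: "underlying (F + resolve m L) = ?D + resolve m L" for m
    by (simp add: L)
  have ld: "link_diagram (?D + resolve m L)" for m
    using link_diagram_underlying[OF spherical_resolve[OF F L, of m]] res by simp
  have X: "underlying (F + {#L#}) = (?D + {#C2#}) + {#C1 s#}"
    by (simp add: L C1_def C2_def add_mset_commute)
  have ldX: "link_diagram ((?D + {#C2#}) + {#C1 s#})"
    using link_diagram_underlying[OF F] unfolding X .
  have ldX': "link_diagram ((?D + {#C2#}) + {#C1 s'#})" for s'
    using ldX link_diagram_sign[of "?D + {#C2#}" s u i1 v o2 s']
      link_diagram_sign[of "?D + {#C2#}" s i1 u o2 v s']
    by (cases l) (simp_all add: C1_def)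
  have "A * H (?D + {#C2#} + {#C1 True#}) - inverse A * H (?D + {#C2#} + {#C1 False#}) =
      braces q * H (?D + {#C2#} + {#Bend u v, Bend i1 o2#})"
  proof (cases l)
    case True
    then show ?thesis
      using H_skein[of "?D + {#C2#}" s u i1 v o2] ldX by (simp add: C1_def)
  next
    case False
    then show ?thesis
      using H_skein[of "?D + {#C2#}" s i1 u o2 v] ldX by (simp add: C1_def add_mset_commute)
  qed
  also have "?D + {#C2#} + {#Bend u v, Bend i1 o2#} = ?D + half_smoothed L"
    by (simp add: L C2_def add_mset_commute)
  also have "H \<dots> = H (?D + resolve True L)"
    by (rule H_half_smoothed[OF F L])
  finally have sk: "A * H (?D + {#C2#} + {#C1 True#}) - inverse A * H (?D + {#C2#} + {#C1 False#}) =
      braces q * H (?D + resolve True L)" .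
  have "move (?D + {#C2#} + {#C1 (\<not> s)#}) (?D + resolve False L)"
  proof (cases l)
    case True
    then show ?thesis
      using move.R2_left[where D = ?D and s = "\<not> s" and u = u and a = i1 and v = v and c = o2 and b = i2 and d = o1] by (simp add: C1_def C2_def L add_mset_commute)
  next
    case False
    then show ?thesis
      using move.R2_right[where D = ?D and s = "\<not> s" and u = u and a = i1 and v = v and c = o2 and b = i2 and d = o1] by (simp add: C1_def C2_def L add_mset_commute)
  qed
  then have r2: "H (?D + {#C2#} + {#C1 (\<not> s)#}) = H (?D + resolve False L)"
    using H_move ldX' ld by blast
  have lc: "lock_coeff A q False L = (if s then inverse A * inverse A else A * A)"
    "lock_coeff A q True L = (if s then inverse A * braces q else - (A * braces q))"
    using A0 by (auto simp: lock_coeff_def L phi_def phibar_def power_int_minus power2_eq_square field_simps)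
  show ?thesis
  proof (cases s)
    case True
    have "A * H (?D + {#C2#} + {#C1 True#}) =
        inverse A * H (?D + resolve False L) + braces q * H (?D + resolve True L)"
      using sk r2 True by (simp add: algebra_simps)
    then have "H (?D + {#C2#} + {#C1 True#}) =
        inverse A * (inverse A * H (?D + resolve False L) + braces q * H (?D + resolve True L))"
      using A0 by (metis mult.assoc left_inverse mult_1)
    then show ?thesis
      unfolding X res lc using True by (simp only: if_True) (simp add: distrib_left mult.assoc)
  next
    case False
    have "inverse A * H (?D + {#C2#} + {#C1 False#}) =
        A * H (?D + resolve False L) - braces q * H (?D + resolve True L)"
      using sk r2 False by (simp add: algebra_simps)
    then have "H (?D + {#C2#} + {#C1 False#}) =
        A * (A * H (?D + resolve False L) - braces q * H (?D + resolve True L))"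
      using A0 by (metis mult.assoc right_inverse mult_1)
    then show ?thesis
      unfolding X res lc using False by (simp only: if_False) (simp add: right_diff_distrib mult.assoc)
  qed
qed

text \<open>A kink with loop \<open>x\<close> is put on some bend of \<open>F\<close>. Both signs of
  the kink are undone by a first Reidemeister move, while smoothing it splits off the circle; the
  skein relation compares the three.\<close>

lemma H_add_circle:
  assumes "closed_figure F" "all_bends F" "F \<noteq> {#}" "x \<notin> edges F"
  shows "H (F + {#Bend x x#}) = DN A q * H F"
proof -
  obtain b d F' where F: "F = F' + {#Bend b d#}"
    using assms(2,3) by (cases F) auto
  define K where "K = (\<lambda>s. Crossing s x b x d)"
  have hd: "heads {#K s#} = {#x#} + heads {#Bend b d#}" "tails {#K s#} = {#x#} + tails {#Bend b d#}" for s
    by (simp_all add: K_def)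
  have cl: "closed_figure (F' + {#K s#})" for s
    unfolding closed_figure_extend[OF hd] using assms(1,4) F by simp
  have ldF: "link_diagram F"
    using assms(1,2) by (simp add: link_diagram_iff defect_all_bends no_locks_bends)
  have "defect (F' + {#K s#}) = defect F" for s
    unfolding F by (rule defect_kink[OF cl[of s], where s = s and x = x and b = b and d = d]) (simp add: K_def)
  then have ld: "link_diagram (F' + {#K s#})" for s
    using cl ldF F by (auto simp: link_diagram_iff K_def)
  have "H (F' + {#K s#}) = H F" for s
    using H_move[OF _ ld ldF] move.R1_left[where D = F' and s = s and x = x and b = b and d = d] F by (simp add: K_def)
  moreover have "A * H (F' + {#K True#}) - inverse A * H (F' + {#K False#}) =
      braces q * H (F' + {#Bend x x, Bend b d#})"
    unfolding K_def by (rule H_skein[where s = True]) (use ld[of True] in \<open>simp add: K_def\<close>)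
  ultimately have "braces A * H F = braces q * H (F + {#Bend x x#})"
    by (simp add: F braces_def algebra_simps add_mset_commute)
  then show ?thesis
    using q0 by (simp add: DN_def field_simps)
qed

text \<open>Proper bends are contracted away until only circles \<open>Bend a a\<close> remain, and
  these are removed one at a time. The last circle is evaluated by the normalisation at the unknot,
  which says nothing about the empty figure; hence \<open>F\<close> must be nonempty.\<close>

lemma H_all_bends:
  assumes "closed_figure F" "all_bends F" "F \<noteq> {#}"
  shows "H F = DN A q ^ num_components F"
  using assms
proof (induction "size F" arbitrary: F rule: less_induct)
  case less
  show ?case
  proof (cases "\<exists>a b. a \<noteq> b \<and> Bend a b \<in># F")
    case True
    then obtain a b G where ab: "a \<noteq> b" "F = G + {#Bend a b#}"
      by (metis add_mset_add_single insert_DiffM)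
    let ?G = "image_mset (rename (\<lambda>e. if e = b then a else e)) G"
    have bends: "all_bends G"
      using less.prems(2) ab by simp
    have clF: "closed_figure (G + {#Bend a b#})"
      using less.prems(1) ab by simp
    note G = num_components_contract[OF clF ab(1) bends]
    have bG: "all_bends ?G"
      using bends by (induction G) auto
    have "H ?G = DN A q ^ num_components ?G"
      using G bG ab(2) by (intro less.hyps) auto
    moreover have "H F = H ?G"
    proof (rule H_move)
      show "move F ?G"
        unfolding ab(2) by (rule move.contract[OF ab(1)])
    qed (use G bG less.prems in \<open>simp_all add: link_diagram_iff defect_all_bends no_locks_bends\<close>)
    ultimately show ?thesis
      using G(2) ab(2) by simp
  next
    case False
    obtain a G where aG: "F = G + {#Bend a a#}"
    proof -
      obtain x G where F: "F = add_mset x G"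
        using less.prems(3) by (cases F) auto
      then obtain a b where "x = Bend a b"
        using less.prems(2) by auto
      moreover from this have "a = b"
        using False F by auto
      ultimately show ?thesis
        using that F by auto
    qed
    have num: "num_components F = size F"
      using less.prems False by (intro num_components_circles) auto
    have hd: "heads {#Bend a a#} = {#a#} + heads {#}" "tails {#Bend a a#} = {#a#} + tails {#}"
      by simp_all
    have cl: "closed_figure G" and a: "a \<notin> edges G"
      using closed_figure_extend[OF hd, of G] less.prems(1) aG by simp_all
    show ?thesis
    proof (cases "G = {#}")
      case True
      then show ?thesis
        using H num by (simp add: aG HOMFLY_PT_def)
    next
      case G: False
      have bG: "all_bends G"
        using less.prems(2) aG by simp
      have "H G = DN A q ^ num_components G"
        using cl G bG by (intro less.hyps) (auto simp: aG)
      moreover have "num_components G = size G"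
        using cl bG False by (intro num_components_circles) (auto simp: aG)
      ultimately show ?thesis
        using H_add_circle[OF cl bG G a] num by (simp add: aG)
    qed
  qed
qed

text \<open>The free function \<open>mm\<close> chooses, lock by lock, which smoothing membership in
  \<open>S\<close> stands for; later membership means that the white corners are united.
  \<open>N\<close> collects the bends of the locks already resolved.\<close>

lemma H_state_sum:
  assumes "finite E" "\<forall>x\<in>E. \<exists>s l i1 o1 i2 o2 u v. x = Lock s l i1 o1 i2 o2 u v"
    and "all_bends N" "spherical_lock_bend (N + mset_set E)" "N + mset_set E \<noteq> {#}"
  shows "H (underlying (N + mset_set E)) =
    (\<Sum>S\<in>Pow E. (\<Prod>x\<in>E. lock_coeff A q ((x \<in> S) = mm x) x) *
       DN A q ^ num_components (N + (\<Sum>x\<in>E. resolve ((x \<in> S) = mm x) x)))"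
  using assms
proof (induction E arbitrary: N rule: finite_induct)
  case empty
  then show ?case
    by (simp add: underlying_bends spherical_lock_bend_def H_all_bends)
next
  case (insert x E)
  let ?t = "\<lambda>N S. (\<Prod>x\<in>E. lock_coeff A q ((x \<in> S) = mm x) x) *
      DN A q ^ num_components (N + (\<Sum>x\<in>E. resolve ((x \<in> S) = mm x) x))"
  from insert.prems(1) obtain s l i1 o1 i2 o2 u v where x: "x = Lock s l i1 o1 i2 o2 u v"
    by auto
  have eq: "N + mset_set (insert x E) = (N + mset_set E) + {#x#}"
    using insert.hyps by simp
  have sph: "spherical_lock_bend ((N + mset_set E) + {#x#})"
    using insert.prems(3) unfolding eq .
  have IH: "H (underlying (N + mset_set E + resolve m x)) = (\<Sum>S\<in>Pow E. ?t (N + resolve m x) S)" for m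
  proof -
    have "N + mset_set E + resolve m x = (N + resolve m x) + mset_set E"
      by (simp add: add_ac)
    moreover have "spherical_lock_bend ((N + resolve m x) + mset_set E)"
      using spherical_resolve[OF sph x, of m] by (simp add: add_ac)
    moreover have "(N + resolve m x) + mset_set E \<noteq> {#}"
      by (simp add: x)
    moreover have "all_bends (N + resolve m x)"
      using insert.prems(2) all_bends_resolve x by simp
    moreover have "\<forall>x\<in>E. \<exists>s l i1 o1 i2 o2 u v. x = Lock s l i1 o1 i2 o2 u v"
      using insert.prems(1) by blast
    ultimately show ?thesis
      using insert.IH[of "N + resolve m x"] by (simp add: add_ac)
  qed
  have E: "(y \<in> insert x S) = (y \<in> S)" if "y \<in> E" for y S
    using that insert.hyps by auto
  have 1: "(\<Prod>y\<in>insert x E. lock_coeff A q ((y \<in> S) = mm y) y) *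
       DN A q ^ num_components (N + (\<Sum>y\<in>insert x E. resolve ((y \<in> S) = mm y) y)) =
      lock_coeff A q (\<not> mm x) x * ?t (N + resolve (\<not> mm x) x) S" if "S \<in> Pow E" for S
  proof -
    have "x \<notin> S"
      using that insert.hyps by auto
    then show ?thesis
      using insert.hyps by (simp add: add_ac mult_ac)
  qed
  have 2: "(\<Prod>y\<in>insert x E. lock_coeff A q ((y \<in> insert x S) = mm y) y) *
       DN A q ^ num_components (N + (\<Sum>y\<in>insert x E. resolve ((y \<in> insert x S) = mm y) y)) =
      lock_coeff A q (mm x) x * ?t (N + resolve (mm x) x) S" for S
  proof -
    have p: "(\<Prod>y\<in>E. lock_coeff A q ((y \<in> insert x S) = mm y) y) = (\<Prod>y\<in>E. lock_coeff A q ((y \<in> S) = mm y) y)"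
      by (intro prod.cong refl) (simp only: E)
    have r: "(\<Sum>y\<in>E. resolve ((y \<in> insert x S) = mm y) y) = (\<Sum>y\<in>E. resolve ((y \<in> S) = mm y) y)"
      by (intro sum.cong refl) (simp only: E)
    show ?thesis
      unfolding prod.insert[OF insert.hyps] sum.insert[OF insert.hyps] p r by (simp add: add_ac mult_ac)
  qed
  have "(\<Sum>S\<in>Pow (insert x E). (\<Prod>y\<in>insert x E. lock_coeff A q ((y \<in> S) = mm y) y) *
       DN A q ^ num_components (N + (\<Sum>y\<in>insert x E. resolve ((y \<in> S) = mm y) y))) =
      (\<Sum>S\<in>Pow E. lock_coeff A q (\<not> mm x) x * ?t (N + resolve (\<not> mm x) x) S +
        lock_coeff A q (mm x) x * ?t (N + resolve (mm x) x) S)"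
    unfolding sum_Pow_insert[OF insert.hyps(1,2)] by (intro sum.cong refl arg_cong2[where f = "(+)"] 1 2)
  also have "\<dots> = lock_coeff A q (\<not> mm x) x * H (underlying (N + mset_set E + resolve (\<not> mm x) x)) +
      lock_coeff A q (mm x) x * H (underlying (N + mset_set E + resolve (mm x) x))"
    unfolding IH by (simp add: sum.distrib sum_distrib_left)
  also have "\<dots> = H (underlying ((N + mset_set E) + {#x#}))"
    unfolding H_lock[OF sph x] by (cases "mm x") simp_all
  finally show ?case
    unfolding eq by simp
qed

end

section \<open>Circles of a state and the graph of white regions\<close>

definition is_lock :: "vertex \<Rightarrow> bool" where
  "is_lock x \<longleftrightarrow> (\<exists>s l i1 o1 i2 o2 u v. x = Lock s l i1 o1 i2 o2 u v)"

lemma is_lock_simps [simp]: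
  "is_lock (Lock s l i1 o1 i2 o2 u v)" "\<not> is_lock (Bend a b)" "\<not> is_lock (Crossing s' a' b' c' d')"
  by (auto simp: is_lock_def)

text \<open>\<open>True\<close> for locks whose lateral corners face the sides selected by \<open>w\<close>; joining these
  corners is the smoothing \<open>resolve True\<close>.\<close>

fun lateral_along :: "(nat \<Rightarrow> bool) \<Rightarrow> vertex \<Rightarrow> bool" where
  "lateral_along w (Lock s l i1 o1 i2 o2 u v) \<longleftrightarrow> w i1 = l"
| "lateral_along w _ \<longleftrightarrow> False"

text \<open>Each incoming edge of a lock borders one end corner and one lateral corner, so the two
  incoming edges give access to both white corners, whichever kind is white.\<close>

fun strand1 :: "vertex \<Rightarrow> nat" where
  "strand1 (Lock s l i1 o1 i2 o2 u v) = i1" | "strand1 (Bend a b) = a" | "strand1 (Crossing s a b c d) = a"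

fun strand2 :: "vertex \<Rightarrow> nat" where
  "strand2 (Lock s l i1 o1 i2 o2 u v) = i2" | "strand2 (Bend a b) = a" | "strand2 (Crossing s a b c d) = b"

text \<open>Two copies of a vertex would make its edge \<open>lead x\<close> enter twice. So closed
  figures can be treated as sets and their locks indexed by themselves.\<close>

lemma mset_closed_figure: "closed_figure F \<Longrightarrow> mset_set (set_mset F) = F"
proof (rule mset_set_set_mset_eq, rule allI, rule ccontr)
  fix x assume cl: "closed_figure F" and "\<not> count F x \<le> 1"
  then have "{#x, x#} \<subseteq># F"
    by (auto simp: subseteq_mset_def)
  then obtain G where "F = {#x, x#} + G"
    by (auto simp: subset_mset.le_iff_add)
  then have "count (heads F) (lead x) \<ge> 2 * count (ins x) (lead x)"
    by simp
  moreover have "count (ins x) (lead x) \<ge> 1"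
    by (cases x) auto
  moreover have "count (heads F) (lead x) \<le> 1"
    using cl unfolding closed_figure_iff by blast
  ultimately show False by linarith
qed

lemma arcs_along_sum: "finite X \<Longrightarrow> arcs_along w (\<Sum>x\<in>X. f x) = (\<Sum>x\<in>X. arcs_along w (f x))"
  by (induction X rule: finite_induct) auto

lemma heads_sum: "finite X \<Longrightarrow> heads (\<Sum>x\<in>X. f x) = (\<Sum>x\<in>X. heads (f x))"
  by (induction X rule: finite_induct) auto

lemma tails_sum: "finite X \<Longrightarrow> tails (\<Sum>x\<in>X. f x) = (\<Sum>x\<in>X. tails (f x))"
  by (induction X rule: finite_induct) auto

lemma all_bends_sum: "finite X \<Longrightarrow> all_bends (\<Sum>x\<in>X. f x) \<longleftrightarrow> (\<forall>x\<in>X. all_bends (f x))"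
  by (induction X rule: finite_induct) auto

lemma arcs_along_mset_set:
  "finite X \<Longrightarrow> arcs_along w (mset_set X) = (\<Sum>x\<in>X. arcs (w (lead x)) x)"
  by (induction X rule: finite_induct) auto

lemma heads_mset_set: "finite X \<Longrightarrow> heads (mset_set X) = (\<Sum>x\<in>X. ins x)"
  by (induction X rule: finite_induct) auto

lemma tails_mset_set: "finite X \<Longrightarrow> tails (mset_set X) = (\<Sum>x\<in>X. outs x)"
  by (induction X rule: finite_induct) auto

section \<open>White regions as vertices, locks as edges, and the circles of a state\<close>

locale coloured_bipartite =
  fixes B :: figure and \<rho> :: "side \<Rightarrow> 'r" and white :: "'r \<Rightarrow> bool"
  assumes bip: "bipartite_diagram B"
    and corner_region: "\<And>p r. (p, r) \<in> corner_rel B \<Longrightarrow> \<rho> p = \<rho> r"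
    and check: "checkerboard B \<rho> white"
    and simply_connected: "white_simply_connected B \<rho> white"
begin

text \<open>The two sides of an edge of \<open>B\<close> have different colours, so
  \<open>(e, w e)\<close> is the white one and \<open>hr e\<close> is the white region along
  \<open>e\<close>.\<close>

definition w :: "nat \<Rightarrow> bool" where "w e = white (\<rho> (e, True))"
definition E :: "vertex set" where "E = {x \<in> set_mset B. is_lock x}"
definition N :: figure where "N = filter_mset (\<lambda>x. \<not> is_lock x) B"
definition V :: "'r set" where "V = white_regions B \<rho> white"
definition hr :: "nat \<Rightarrow> 'r" where "hr e = \<rho> (e, w e)"
definition src :: "vertex \<Rightarrow> 'r" where "src x = hr (strand1 x)"
definition tgt :: "vertex \<Rightarrow> 'r" where "tgt x = hr (strand2 x)"
text \<open>\<open>S\<close> holds the locks whose white corners are united; the comparison with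
  \<open>lateral_along\<close> turns this into the flag of \<open>resolve\<close>.\<close>

definition state :: "vertex set \<Rightarrow> figure" where
  "state S = N + (\<Sum>x\<in>E. resolve ((x \<in> S) = lateral_along w x) x)"
definition circles :: "vertex set \<Rightarrow> (nat \<times> nat) multiset" where
  "circles S = arcs_along w (state S)"
definition joins :: "vertex set \<Rightarrow> ('r \<times> 'r) set" where
  "joins S = (\<lambda>x. (src x, tgt x)) ` S"

lemma sph: "spherical_lock_bend B"
  by (rule bipartite_spherical_lock_bend) (rule bip)

lemma lb: "lock_bend B" and dB: "defect B = 0"
  using sph by (auto simp: spherical_lock_bend_def)

lemma cl: "closed_figure B"
  using sph closed_underlying[of "{#}" B] by (simp add: spherical_lock_bend_def)

lemma fin [simp]: "finite E"
  by (simp add: E_def)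

lemma B_eq: "B = N + mset_set E"
proof -
  have "filter_mset is_lock B = mset_set E"
    by (subst mset_closed_figure[OF cl, symmetric]) (simp add: E_def filter_mset_mset_set)
  then show ?thesis
    unfolding N_def using multiset_partition[of B is_lock] by (simp add: add.commute)
qed

lemma all_bends_N: "all_bends N"
  unfolding all_bends_def
proof
  fix x assume "x \<in># N"
  then have "x \<in># B" "\<not> is_lock x"
    by (auto simp: N_def)
  then show "\<exists>a b. x = Bend a b"
    using lb by (cases x) (auto simp: lock_bend_def)
qed

lemma white_iff: "e \<in> edges B \<Longrightarrow> white (\<rho> (e, f)) \<longleftrightarrow> f = w e"
  using check by (cases f) (auto simp: checkerboard_def w_def)

lemma arc_region:
  assumes "x \<in># B" "(a, b) \<in># arcs f x"
  shows "\<rho> (a, f) = \<rho> (b, f)" "w a = w b"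
proof -
  have "((a, f), (b, f)) \<in> corner_rel B"
    using assms corners_arcs[OF lb assms(1)] by (auto simp: corner_rel_def)
  then show *: "\<rho> (a, f) = \<rho> (b, f)"
    by (rule corner_region)
  have "a \<in> edges B" "b \<in> edges B"
    using arcs_in_out[OF assms(2)] assms(1) ins_subset_edges outs_subset_edges[OF cl] by blast+
  then have "f = w a \<longleftrightarrow> f = w b"
    using white_iff[of a f] white_iff[of b f] * by simp
  then show "w a = w b" by auto
qed

text \<open>A corner joins sides in one region, hence of one colour, so its two edges have their
  white side on the same hand; the corners of a lock chain its four edges together.\<close>

lemma coherent_w: "coherent w B"
  unfolding coherent_def
proof (intro ballI)
  fix x e assume x: "x \<in># B" "e \<in># ins x + outs x"
  show "w e = w (lead x)"
  proof (cases x)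
    case (Crossing s a b c d)
    then show ?thesis
      using x lb by (auto simp: lock_bend_def)
  next
    case (Bend a b)
    then have "w a = w b"
      using arc_region(2)[OF x(1), of a b True] by simp
    then show ?thesis
      using x Bend by auto
  next
    case (Lock s l i1 o1 i2 o2 u v)
    then have "w i1 = w o1" "w i2 = w o2" "w i1 = w o2"
      using arc_region(2)[OF x(1), of i1 o1 l] arc_region(2)[OF x(1), of i2 o2 l]
        arc_region(2)[OF x(1), of i1 o2 "\<not> l"] by simp_all
    then show ?thesis
      using x Lock by auto
  qed
qed

lemma white_arc: "x \<in># B \<Longrightarrow> (a, b) \<in># arcs (w (lead x)) x \<Longrightarrow> hr a = hr b"
proof -
  assume x: "x \<in># B" "(a, b) \<in># arcs (w (lead x)) x"
  have "w a = w (lead x)" "w b = w (lead x)"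
    using coherent_w x arcs_in_out[OF x(2)] by (auto simp: coherent_def)
  then show "hr a = hr b"
    using arc_region(1)[OF x] by (simp add: hr_def)
qed

lemma E_cases:
  assumes "x \<in> E"
  obtains s l i1 o1 i2 o2 u v where "x = Lock s l i1 o1 i2 o2 u v" "x \<in># B"
  using assms by (auto simp: E_def is_lock_def)

lemma hr_surj: "hr ` edges B = V"
proof (intro equalityI subsetI)
  fix r assume "r \<in> hr ` edges B"
  then show "r \<in> V"
    using white_iff by (auto simp: hr_def V_def white_regions_def sides_def)
next
  fix r assume "r \<in> V"
  then obtain e f where "e \<in> edges B" "r = \<rho> (e, f)" "white r"
    by (auto simp: V_def white_regions_def sides_def)
  then show "r \<in> hr ` edges B"
    using white_iff by (auto simp: hr_def)
qed

lemma finite_V [simp]: "finite V"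
  unfolding hr_surj[symmetric] by simp

lemma strands_edges:
  shows "x \<in> E \<Longrightarrow> strand1 x \<in> edges B \<and> strand2 x \<in> edges B"
proof -
  assume "x \<in> E"
  then obtain s l i1 o1 i2 o2 u v where L: "x = Lock s l i1 o1 i2 o2 u v" "x \<in># B"
    by (rule E_cases)
  then show ?thesis
    using ins_subset_edges[OF L(2)] by simp
qed

lemma src_tgt_V: "x \<in> E \<Longrightarrow> src x \<in> V \<and> tgt x \<in> V"
  using strands_edges hr_surj by (auto simp: src_def tgt_def)

lemma heads_state: "heads (state S) = heads B" "tails (state S) = tails B"
  by (subst B_eq, simp add: state_def heads_sum tails_sum heads_mset_set tails_mset_set)+

lemma edges_state: "edges (state S) = edges B"
  by (simp add: edges_heads heads_state)

lemma closed_state: "closed_figure (state S)"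
  using cl unfolding closed_figure_iff heads_state .

lemma bends_state: "all_bends (state S)"
  unfolding state_def all_bends_simps all_bends_sum[OF fin]
  using all_bends_N by (auto elim!: E_cases)

lemma num_components_state: "num_components (state S) = num_classes (edges B) (set_mset (circles S))"
  using num_components_all_bends[OF bends_state, of S w] by (simp add: edges_state circles_def)

lemma arcs_resolve:
  assumes "x \<in> E"
  shows "arcs_along w (resolve (m = lateral_along w x) x) = arcs (w (lead x) \<noteq> m) x"
  using assms by (auto elim!: E_cases)

lemma arcs_along_N: "arcs_along w' N = arcs_along w'' N"
proof -
  have "arcs_along w' F = arcs_along w'' F" if "all_bends F" for F
    using that by (induction F) auto
  then show ?thesis
    using all_bends_N by blast
qed

text \<open>A circle follows the white side at a lock outside \<open>S\<close> and the black side at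
  a lock in \<open>S\<close>. Thus the empty state traces the white faces and the full state the
  black ones.\<close>

lemma circles_eq: "circles S = arcs_along w N + (\<Sum>x\<in>E. arcs (w (lead x) \<noteq> (x \<in> S)) x)"
proof -
  have "(\<Sum>x\<in>E. arcs_along w (resolve ((x \<in> S) = lateral_along w x) x)) =
      (\<Sum>x\<in>E. arcs (w (lead x) \<noteq> (x \<in> S)) x)"
    by (intro sum.cong refl arcs_resolve)
  then show ?thesis
    by (simp add: circles_def state_def arcs_along_sum)
qed

lemma circles_empty: "circles {} = arcs_along w B"
  by (subst B_eq, simp add: circles_eq arcs_along_mset_set)

lemma circles_full: "circles E = arcs_along (Not \<circ> w) B"
proof -
  have "(\<Sum>x\<in>E. arcs (w (lead x) \<noteq> (x \<in> E)) x) = (\<Sum>x\<in>E. arcs ((Not \<circ> w) (lead x)) x)"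
    by (intro sum.cong refl) simp
  then show ?thesis
    by (subst B_eq, simp add: circles_eq arcs_along_mset_set arcs_along_N[of "Not \<circ> w" w])
qed

text \<open>A circle can leave its white region only by passing a lock in \<open>S\<close>, which
  joins the two regions concerned.\<close>

lemma circles_joins:
  assumes "S \<subseteq> E" "(a, b) \<in># circles S"
  shows "(hr a, hr b) \<in> eqv (joins S)"
proof -
  have "(a, b) \<in># arcs_along w N \<or> (\<exists>x\<in>E. (a, b) \<in># arcs (w (lead x) \<noteq> (x \<in> S)) x)"
    using assms(2) by (simp add: circles_eq set_mset_sum)
  then show ?thesis
  proof
    assume "(a, b) \<in># arcs_along w N"
    then obtain x where "x \<in># B" "(a, b) \<in># arcs (w (lead x)) x"
      by (auto simp: set_arcs_along N_def)
    then show ?thesis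
      using white_arc by simp
  next
    assume "\<exists>x\<in>E. (a, b) \<in># arcs (w (lead x) \<noteq> (x \<in> S)) x"
    then obtain x where x: "x \<in> E" "(a, b) \<in># arcs (w (lead x) \<noteq> (x \<in> S)) x" by blast
    show ?thesis
    proof (cases "x \<in> S")
      case False
      then show ?thesis
        using x white_arc[of x a b] by (auto simp: E_def)
    next
      case True
      from x(1) obtain s l i1 o1 i2 o2 u v where L: "x = Lock s l i1 o1 i2 o2 u v" "x \<in># B"
        by (rule E_cases)
      have j: "(hr i1, hr i2) \<in> eqv (joins S)"
        using True by (intro eqv_I) (force simp: joins_def src_def tgt_def L)
      have arcs: "hr a' = hr b'" if "(a', b') \<in># arcs (w i1) x" for a' b'
        using white_arc[OF L(2)] that by (simp add: L)
      have "a = i1 \<and> hr b = hr i2 \<or> a = i2 \<and> hr b = hr i1"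
        using x(2) True arcs[of i1 o1] arcs[of i2 o2] arcs[of i1 o2] arcs[of i2 o1]
        by (auto simp: L split: if_splits)
      then show ?thesis
        using j eqv_sym[OF j] by auto
    qed
  qed
qed

lemma circles_insert:
  assumes "x \<in> E" "x \<notin> S"
  obtains M c d where "circles S = M + {#(strand1 x, c), (strand2 x, d)#}"
    "circles (insert x S) = M + {#(strand1 x, d), (strand2 x, c)#}"
proof -
  from assms(1) obtain s l i1 o1 i2 o2 u v where L: "x = Lock s l i1 o1 i2 o2 u v"
    by (rule E_cases)
  define M where "M = arcs_along w N + (\<Sum>y\<in>E - {x}. arcs (w (lead y) \<noteq> (y \<in> S)) y)"
  have 1: "circles S = M + arcs (w i1) x"
    unfolding circles_eq M_def by (subst sum.remove[OF fin assms(1)]) (use assms(2) in \<open>simp add: L add_ac\<close>)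
  have "(\<Sum>y\<in>E - {x}. arcs (w (lead y) \<noteq> (y \<in> insert x S)) y) =
      (\<Sum>y\<in>E - {x}. arcs (w (lead y) \<noteq> (y \<in> S)) y)"
    by (intro sum.cong refl) auto
  then have 2: "circles (insert x S) = M + arcs (\<not> w i1) x"
    unfolding circles_eq M_def by (subst sum.remove[OF fin assms(1)]) (simp add: L add_ac)
  show thesis
    using that[of M o1 o2] that[of M o2 o1] 1 2 by (cases "w i1 = l") (auto simp: L)
qed

definition excess :: "vertex set \<Rightarrow> int" where
  "excess S = 2 * int (num_classes V (joins S)) + int (card S) - int (card V)
     - int (num_components (state S))"

text \<open>If the ends of \<open>x\<close> are already connected by \<open>S\<close>, the number of
  circles grows by at most one, which \<open>card S\<close> pays for. Otherwise
  \<open>2 k(S) + |S|\<close> drops by one; but then the two strands lie on different circles,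
  because a circle stays in one class of regions, and these circles merge.\<close>

lemma excess_insert:
  assumes "S \<subseteq> E" "x \<in> E" "x \<notin> S"
  shows "excess S \<le> excess (insert x S)"
proof -
  obtain M c d where M: "circles S = M + {#(strand1 x, c), (strand2 x, d)#}"
    "circles (insert x S) = M + {#(strand1 x, d), (strand2 x, c)#}"
    using circles_insert[OF assms(2,3)] .
  have perm: "perm_arcs (M + {#(strand1 x, c), (strand2 x, d)#})"
    unfolding M(1)[symmetric] circles_def using closed_state by simp
  have X: "edges B = fst ` set_mset (M + {#(strand1 x, c), (strand2 x, d)#})"
    unfolding M(1)[symmetric] circles_def using edges_arcs_along[of "state S" w] by (simp add: edges_state)
  note sw = num_classes_switch[OF perm X]
  have c: "num_components (state S) = num_classes (edges B) (set_mset (M + {#(strand1 x, c), (strand2 x, d)#}))"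
    "num_components (state (insert x S)) =
       num_classes (edges B) (set_mset (M + {#(strand1 x, d), (strand2 x, c)#}))"
    by (simp_all only: num_components_state M)
  have card: "card (insert x S) = Suc (card S)"
    using assms finite_subset[OF assms(1) fin] by simp
  have joins: "joins (insert x S) = insert (src x, tgt x) (joins S)"
    by (simp add: joins_def)
  show ?thesis
  proof (cases "(src x, tgt x) \<in> eqv (joins S)")
    case True
    then have "num_classes V (joins (insert x S)) = num_classes V (joins S)"
      unfolding joins by (rule num_classes_insert_same)
    then show ?thesis
      using sw(1) c card by (simp add: excess_def)
  next
    case False
    then have "num_classes V (joins S) = Suc (num_classes V (joins (insert x S)))"
      unfolding joins using src_tgt_V[OF assms(2)] by (intro num_classes_insert_new) auto
    moreover have "(strand1 x, strand2 x) \<notin> eqv (set_mset (circles S))"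
    proof
      assume "(strand1 x, strand2 x) \<in> eqv (set_mset (circles S))"
      then have "(hr (strand1 x), hr (strand2 x)) \<in> eqv (joins S)"
        by (rule eqv_map[where h = hr, rotated]) (rule circles_joins[OF assms(1)])
      then show False
        using False by (simp add: src_def tgt_def)
    qed
    ultimately show ?thesis
      using sw(3) c card M(1) by (simp add: excess_def)
  qed
qed

lemma excess_mono:
  assumes "finite T" "S \<subseteq> E" "T \<subseteq> E"
  shows "excess S \<le> excess (S \<union> T)"
  using assms(1,3)
proof (induction T rule: finite_induct)
  case (insert x T)
  have "excess (S \<union> T) \<le> excess (insert x (S \<union> T))"
    using excess_insert[of "S \<union> T" x] assms(2) insert by (cases "x \<in> S \<union> T") (auto simp: insert_absorb)
  then show ?case
    using insert by simp
qed simp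

text \<open>Simple connectedness of the white regions enters here: each white region is a single
  face and so contributes a single circle.\<close>

lemma components_empty: "num_components (state {}) = card V"
proof -
  have "num_classes (edges B) (set_mset (arcs_along w B)) = num_classes V {}"
  proof (rule num_classes_bij[where h = hr])
    show "(hr a, hr b) \<in> eqv {}" if "(a, b) \<in># arcs_along w B" for a b
      using that circles_joins[of "{}" a b] by (simp add: circles_empty joins_def)
    show "(a, b) \<in> eqv (set_mset (arcs_along w B))"
      if "a \<in> edges B" "b \<in> edges B" "(hr a, hr b) \<in> eqv {}" for a b
    proof -
      have "\<rho> (a, w a) = \<rho> (b, w b)"
        using that(3) by (simp add: eqv_def hr_def)
      moreover have "white (\<rho> (a, w a))"
        using white_iff[OF that(1)] by simp
      ultimately have "((a, w a), (b, w b)) \<in> same_face B"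
        using simply_connected that(1,2) by (auto simp: white_simply_connected_def sides_def)
      then have "((a, w a), (b, w b)) \<in> eqv (corner_rel B)"
        by (simp add: same_face_def eqv_def)
      then show ?thesis
        using eqv_corner_arcs[OF lb coherent_w, of "(a, w a)" "(b, w b)"] by simp
    qed
  qed (simp_all add: hr_surj)
  then show ?thesis
    by (simp add: num_components_state circles_empty)
qed

lemma excess_empty: "excess {} = 0"
  by (simp add: excess_def joins_def components_empty)

text \<open>White and black faces together are counted by Euler's formula, which turns
  \<open>excess E\<close> into \<open>2 * (k(E) - c)\<close> with \<open>c\<close> the number of
  components of \<open>B\<close>. At every vertex of \<open>B\<close> the adjacent white regions
  coincide or are joined by the full set, so \<open>k(E) <= c\<close>.\<close>

lemma excess_full: "excess E \<le> 0"
proof -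
  have "num_faces B = num_components (state {}) + num_components (state E)"
    using num_faces_split[OF cl lb coherent_w]
    by (simp add: num_components_state circles_empty circles_full)
  moreover have "card (edges B) = size N + 2 * card E"
  proof -
    have "size (heads B) = size (heads N) + (\<Sum>x\<in>E. size (ins x))"
      by (subst B_eq) (simp add: heads_mset_set size_multiset_sum)
    also have "(\<Sum>x\<in>E. size (ins x)) = (\<Sum>x\<in>E. 2)"
      by (intro sum.cong refl) (auto elim!: E_cases)
    finally show ?thesis
      using size_heads_closed[OF cl] size_heads_bends[OF all_bends_N] by simp
  qed
  moreover have "size B = size N + card E"
    by (subst B_eq) simp
  ultimately have "int (num_components (state E)) =
      int (card E) + 2 * int (num_components B) - int (card V)"
    using dB components_empty by (simp add: defect_def)
  moreover have "num_classes V (joins E) \<le> num_components B"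
    unfolding num_components_alt
  proof (rule num_classes_le_surj[where h = hr])
    fix a b assume "(a, b) \<in> comp_rel B"
    then obtain x where x: "x \<in># B" "a \<in># ins x + outs x" "b \<in># ins x + outs x"
      by (auto simp: comp_rel_def)
    have arcs: "hr a' = hr b'" if "(a', b') \<in># arcs (w (lead x)) x" for a' b'
      by (rule white_arc[OF x(1) that])
    show "(hr a, hr b) \<in> eqv (joins E)"
    proof (cases x)
      case (Crossing s a b c d)
      then show ?thesis
        using x lb by (auto simp: lock_bend_def)
    next
      case (Bend c d)
      then have "hr c = hr d"
        using arcs[of c d] by simp
      then show ?thesis
        using x Bend by auto
    next
      case (Lock s l i1 o1 i2 o2 u v)
      have "(hr i1, hr i2) \<in> joins E"
        using x(1) Lock by (force simp: joins_def E_def src_def tgt_def)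
      then have j: "(hr i1, hr i2) \<in> eqv (joins E)" "(hr i2, hr i1) \<in> eqv (joins E)"
        by (simp_all add: eqv_I eqv_I')
      have "hr o1 \<in> {hr i1, hr i2}" "hr o2 \<in> {hr i1, hr i2}"
        using arcs[of i1 o1] arcs[of i2 o2] arcs[of i1 o2] arcs[of i2 o1]
        by (cases "w i1 = l"; simp add: Lock)+
      then have "hr a \<in> {hr i1, hr i2}" "hr b \<in> {hr i1, hr i2}"
        using x(2,3) Lock by auto
      then show ?thesis
        using j by auto
    qed
  qed (simp_all add: hr_surj)
  ultimately show ?thesis
    by (simp add: excess_def)
qed

text \<open>The excess is monotone in \<open>S\<close> and vanishes at both ends, so it vanishes.\<close>

lemma components_state:
  assumes "S \<subseteq> E"
  shows "num_components (state S) + card V = 2 * num_classes V (joins S) + card S"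
proof -
  have "excess {} \<le> excess S"
    using excess_mono[of S "{}"] assms finite_subset[OF assms fin] by simp
  moreover have "excess S \<le> excess E"
    using excess_mono[of E S] assms by (simp add: Un_absorb1)
  ultimately have "excess S = 0"
    using excess_empty excess_full by simp
  then show ?thesis
    by (simp add: excess_def)
qed

end

section \<open>The recursion as a dichromatic state sum\<close>

text \<open>A dichromatic polynomial with separate weights on each edge. By
  \<open>components_state\<close> the exponent, after division by \<open>D ^ card V\<close>, is the
  number of circles of the state \<open>S\<close>.\<close>

definition potts :: "'k::field \<Rightarrow> 'r set \<Rightarrow> 'e set \<Rightarrow> ('e \<Rightarrow> 'r) \<Rightarrow> ('e \<Rightarrow> 'r) \<Rightarrow> ('e \<Rightarrow> 'k) \<Rightarrow> ('e \<Rightarrow> 'k) \<Rightarrow> 'k" where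
  "potts D V E s t a b =
     (\<Sum>S\<in>Pow E. (\<Prod>e\<in>E. if e \<in> S then b e else a e) *
        D ^ (2 * num_classes V ((\<lambda>e. (s e, t e)) ` S) + card S)) / D ^ card V"

lemma potts_cong:
  assumes "\<And>e. e \<in> E \<Longrightarrow> s e = s' e" "\<And>e. e \<in> E \<Longrightarrow> t e = t' e"
    and "\<And>e. e \<in> E \<Longrightarrow> a e = a' e" "\<And>e. e \<in> E \<Longrightarrow> b e = b' e"
  shows "potts D V E s t a b = potts D V E s' t' a' b'"
proof -
  have "(\<lambda>e. (s e, t e)) ` S = (\<lambda>e. (s' e, t' e)) ` S" if "S \<in> Pow E" for S
    using assms that by (intro image_cong) auto
  moreover have "(\<Prod>e\<in>E. if e \<in> S then b e else a e) = (\<Prod>e\<in>E. if e \<in> S then b' e else a' e)" for S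
    using assms by (intro prod.cong) auto
  ultimately show ?thesis
    unfolding potts_def by (intro arg_cong2[where f = "(/)"] sum.cong refl) simp
qed

lemma potts_scale:
  "potts D V E s t (\<lambda>e. p e * a e) (\<lambda>e. p e * b e) = (\<Prod>e\<in>E. p e) * potts D V E s t a b"
proof -
  have "(\<Prod>e\<in>E. if e \<in> S then p e * b e else p e * a e) =
      (\<Prod>e\<in>E. p e) * (\<Prod>e\<in>E. if e \<in> S then b e else a e)" for S
    unfolding prod.distrib[symmetric] by (intro prod.cong) auto
  then show ?thesis
    by (simp add: potts_def sum_distrib_left mult.assoc)
qed

lemma potts_insert:
  assumes "finite E" "e \<notin> E"
  shows "potts D V (insert e E) s t a b =
    (\<Sum>S\<in>Pow E. (\<Prod>e\<in>E. if e \<in> S then b e else a e) *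
       (a e * D ^ (2 * num_classes V ((\<lambda>e. (s e, t e)) ` S) + card S) +
        b e * D ^ (2 * num_classes V (insert (s e, t e) ((\<lambda>e. (s e, t e)) ` S)) + Suc (card S)))) / D ^ card V"
  unfolding potts_def sum_Pow_insert[OF assms]
proof (intro arg_cong2[where f = "(/)"] sum.cong refl)
  fix S assume "S \<in> Pow E"
  then have S: "e \<notin> S" "finite S"
    using assms finite_subset by auto
  have "(\<Prod>x\<in>E. if x \<in> insert e S then b x else a x) = (\<Prod>x\<in>E. if x \<in> S then b x else a x)"
    using assms(2) by (intro prod.cong) auto
  then show "(\<Prod>x\<in>insert e E. if x \<in> S then b x else a x) *
       D ^ (2 * num_classes V ((\<lambda>e. (s e, t e)) ` S) + card S) +
     (\<Prod>x\<in>insert e E. if x \<in> insert e S then b x else a x) *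
       D ^ (2 * num_classes V ((\<lambda>e. (s e, t e)) ` insert e S) + card (insert e S)) =
     (\<Prod>x\<in>E. if x \<in> S then b x else a x) *
       (a e * D ^ (2 * num_classes V ((\<lambda>e. (s e, t e)) ` S) + card S) +
        b e * D ^ (2 * num_classes V (insert (s e, t e) ((\<lambda>e. (s e, t e)) ` S)) + Suc (card S)))"
    using assms S by (simp add: algebra_simps)
qed

text \<open>Taking a loop into \<open>S\<close> leaves the classes alone and only raises
  \<open>card S\<close>, whence one factor \<open>D\<close>.\<close>

lemma potts_loop:
  assumes "finite E" "e \<notin> E" "s e = t e"
  shows "potts D V (insert e E) s t a b = (a e + D * b e) * potts D V E s t a b"
proof -
  have "num_classes V (insert (s e, t e) R) = num_classes V R" for R
    using assms(3) by (intro num_classes_insert_same) simp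
  then show ?thesis
    unfolding potts_insert[OF assms(1,2)]
    by (simp add: potts_def sum_distrib_left sum_divide_distrib algebra_simps)
qed

lemma potts_loops:
  assumes "finite F" "finite E" "F \<inter> E = {}" "\<forall>e\<in>F. s e = t e"
  shows "potts D V (F \<union> E) s t a b = (\<Prod>e\<in>F. a e + D * b e) * potts D V E s t a b"
  using assms
proof (induction F rule: finite_induct)
  case (insert e F)
  then show ?case
    using potts_loop[of "F \<union> E" e s t D V a b] by simp
qed simp

text \<open>The factor \<open>D\<close> that \<open>e\<close> adds through \<open>card S\<close>
  cancels against the one lost in \<open>D ^ card V\<close> when \<open>j\<close> is merged into
  \<open>i\<close>, so contraction carries the bare weight \<open>b e\<close>.\<close>

lemma potts_edge:
  assumes "finite E" "e \<notin> E" "finite V" "i \<in> V" "j \<in> V" "i \<noteq> j" "{s e, t e} = {i, j}" "D \<noteq> 0"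
  defines "h \<equiv> \<lambda>x. if x = j then i else x"
  shows "potts D V (insert e E) s t a b =
    a e * potts D V E s t a b + b e * potts D (V - {j}) E (h \<circ> s) (h \<circ> t) a b"
proof -
  have k: "num_classes V (insert (s e, t e) ((\<lambda>e. (s e, t e)) ` S)) =
      num_classes (V - {j}) ((\<lambda>e. ((h \<circ> s) e, (h \<circ> t) e)) ` S)" for S
  proof (rule num_classes_retract[where h = h])
    let ?R = "insert (s e, t e) ((\<lambda>e. (s e, t e)) ` S)"
    have hx: "(h x, x) \<in> eqv ?R" for x
    proof (cases "x = j")
      case True
      have "(i, j) \<in> ?R \<or> (j, i) \<in> ?R"
        using assms(7) by (auto simp: doubleton_eq_iff)
      then show ?thesis
        using True by (auto simp: h_def intro: eqv_I eqv_I')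
    qed (simp add: h_def)
    then show "(h x, x) \<in> eqv ?R" if "x \<in> V" for x .
    show "(h x, h y) \<in> eqv ((\<lambda>e. ((h \<circ> s) e, (h \<circ> t) e)) ` S)" if "(x, y) \<in> ?R" for x y
    proof (cases "(x, y) = (s e, t e)")
      case True
      then have "h x = i" "h y = i"
        using assms(7) by (auto simp: h_def doubleton_eq_iff)
      then show ?thesis by simp
    next
      case False
      then have "(x, y) \<in> (\<lambda>e. (s e, t e)) ` S"
        using that by blast
      then obtain e' where "e' \<in> S" "x = s e'" "y = t e'"
        by blast
      then show ?thesis
        by (intro eqv_I) auto
    qed
    show "(\<lambda>e. ((h \<circ> s) e, (h \<circ> t) e)) ` S \<subseteq> eqv ?R"
    proof
      fix p assume "p \<in> (\<lambda>e. ((h \<circ> s) e, (h \<circ> t) e)) ` S"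
      then obtain x where x: "x \<in> S" "p = (h (s x), h (t x))" by auto
      have "(s x, t x) \<in> eqv ?R"
        using x(1) by (auto intro: eqv_I)
      then show "p \<in> eqv ?R"
        unfolding x(2) using hx by (meson eqv_sym eqv_trans)
    qed
  qed (use assms in auto)
  have card: "card V = Suc (card (V - {j}))"
    using assms(3,5) by (metis card.remove)
  have "potts D V (insert e E) s t a b =
      (\<Sum>S\<in>Pow E. (\<Prod>e\<in>E. if e \<in> S then b e else a e) * a e *
        D ^ (2 * num_classes V ((\<lambda>e. (s e, t e)) ` S) + card S) / D ^ card V +
       (\<Prod>e\<in>E. if e \<in> S then b e else a e) * b e *
        D ^ (2 * num_classes (V - {j}) ((\<lambda>e. ((h \<circ> s) e, (h \<circ> t) e)) ` S) + card S) / D ^ card (V - {j}))"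
    unfolding potts_insert[OF assms(1,2)] k sum_divide_distrib using assms(8)
    by (intro sum.cong refl) (simp add: card field_simps)
  also have "\<dots> = a e * potts D V E s t a b + b e * potts D (V - {j}) E (h \<circ> s) (h \<circ> t) a b"
    by (simp add: potts_def sum.distrib sum_distrib_left sum_divide_distrib mult_ac)
  finally show ?thesis .
qed

text \<open>The vertex is a class of its own, counting \<open>D^2\<close>, and the normalisation
  takes one \<open>D\<close> back.\<close>

lemma potts_isolated:
  assumes "finite V" "i \<in> V" "\<forall>e\<in>E. s e \<noteq> i \<and> t e \<noteq> i" "D \<noteq> 0"
  shows "potts D V E s t a b = D * potts D (V - {i}) E s t a b"
proof -
  have k: "num_classes V ((\<lambda>e. (s e, t e)) ` S) = Suc (num_classes (V - {i}) ((\<lambda>e. (s e, t e)) ` S))"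
    if "S \<in> Pow E" for S
  proof -
    have "V = {i} \<union> (V - {i})"
      using assms(2) by auto
    then have "num_classes V ((\<lambda>e. (s e, t e)) ` S) =
        num_classes ({i} \<union> (V - {i})) ((\<lambda>e. (s e, t e)) ` S)"
      by simp
    also have "\<dots> = num_classes {i} ((\<lambda>e. (s e, t e)) ` S) + num_classes (V - {i}) ((\<lambda>e. (s e, t e)) ` S)"
      using assms that by (intro num_classes_Un) auto
    also have "num_classes {i} ((\<lambda>e. (s e, t e)) ` S) = 1"
      by (simp add: num_classes_def quotient_image)
    finally show ?thesis by simp
  qed
  have card: "card V = Suc (card (V - {i}))"
    using assms by (metis card.remove)
  show ?thesis
    unfolding potts_def sum_divide_distrib sum_distrib_left
    by (intro sum.cong refl) (use assms(4) in \<open>simp add: k card field_simps\<close>)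
qed

text \<open>Once one edge of the bundle is contracted, the others are loops. The second coefficient
  is that of \<open>M\<close> in the product of all \<open>a e + b e * M\<close> with
  \<open>M^2 = D * M\<close>: evaluating at \<open>M = D\<close> and \<open>M = 0\<close> gives the
  two products in the numerator.\<close>

lemma potts_parallel:
  assumes "finite F" "finite E" "F \<inter> E = {}" "finite V" "i \<in> V" "j \<in> V" "i \<noteq> j"
    and "\<forall>e\<in>F. {s e, t e} = {i, j}" "D \<noteq> 0"
  defines "h \<equiv> \<lambda>x. if x = j then i else x"
  shows "potts D V (F \<union> E) s t a b = (\<Prod>e\<in>F. a e) * potts D V E s t a b +
    ((\<Prod>e\<in>F. a e + D * b e) - (\<Prod>e\<in>F. a e)) / D * potts D (V - {j}) E (h \<circ> s) (h \<circ> t) a b"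
  using assms(1,3,8)
proof (induction F rule: finite_induct)
  case empty
  then show ?case by simp
next
  case (insert e F)
  let ?Z = "potts D V E s t a b" and ?Z' = "potts D (V - {j}) E (h \<circ> s) (h \<circ> t) a b"
  let ?al = "\<Prod>e\<in>F. a e" and ?la = "\<Prod>e\<in>F. a e + D * b e"
  have "potts D V (insert e (F \<union> E)) s t a b =
      a e * potts D V (F \<union> E) s t a b + b e * potts D (V - {j}) (F \<union> E) (h \<circ> s) (h \<circ> t) a b"
    unfolding h_def using insert.hyps insert.prems assms
    by (intro potts_edge) auto
  also have "potts D (V - {j}) (F \<union> E) (h \<circ> s) (h \<circ> t) a b = ?la * ?Z'"
    using insert.hyps insert.prems assms
    by (intro potts_loops) (auto simp: h_def doubleton_eq_iff)
  also have "potts D V (F \<union> E) s t a b = ?al * ?Z + (?la - ?al) / D * ?Z'"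
    by (rule insert.IH) (use insert.prems in auto)
  also have "a e * (?al * Z + (?la - ?al) / D * Z') + b e * (?la * Z') =
      (a e * ?al) * Z + ((a e + D * b e) * ?la - a e * ?al) / D * Z'" for Z Z'
    using assms(9) by (simp add: field_simps)
  finally show ?case
    using insert.hyps by (simp only: Un_insert_left prod.insert[OF insert.hyps])
qed

text \<open>The sign pattern of sums of lock types. It has two uses: a vanishing sum has only
  vanishing terms, and within the pattern the absolute values in the sums \<open>Px\<close>,
  \<open>Py\<close>, \<open>Pz\<close>, \<open>Pt\<close> are additive, so that the coefficients of
  bundles multiply.\<close>

definition cone :: "quad \<Rightarrow> bool" where
  "cone w = (case w of (x, y, z, t) \<Rightarrow> 0 \<le> x \<and> 0 \<le> y \<and> z \<le> 0 \<and> t \<le> 0)"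

lemma cone_0 [simp]: "cone 0"
  by (simp add: cone_def zero_prod_def)

lemma cone_add: "cone v \<Longrightarrow> cone w \<Longrightarrow> cone (v + w)"
  by (cases v; cases w) (auto simp: cone_def)

lemma cone_add_eq_0: "cone v \<Longrightarrow> cone w \<Longrightarrow> v + w = 0 \<Longrightarrow> v = 0"
  by (cases v; cases w) (auto simp: cone_def zero_prod_def)

lemma cone_sum: "\<forall>e\<in>F. cone (k e) \<Longrightarrow> cone (\<Sum>e\<in>F. k e)"
  by (induction F rule: infinite_finite_induct) (auto intro: cone_add)

lemma cone_sum_eq_0:
  assumes "finite F" "\<forall>e\<in>F. cone (k e)" "(\<Sum>e\<in>F. k e) = 0" "e \<in> F"
  shows "k e = 0"
proof -
  have *: "k e + (\<Sum>e\<in>F - {e}. k e) = 0"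
    using assms by (simp add: sum.remove[symmetric])
  then show ?thesis
    using assms cone_sum[of "F - {e}" k] by (intro cone_add_eq_0[OF _ _ *]) auto
qed

text \<open>The sum is the binomial expansion without its term \<open>k = 0\<close>, divided by
  \<open>D\<close>; the omitted term is the power in front.\<close>

lemma sum_powi_binomial:
  fixes u D :: "'k::field"
  assumes "u \<noteq> 0"
  shows "u powi int n + D * (\<Sum>k=1..n. of_nat (n choose k) * D ^ (k - 1) * u powi (int n - 2 * int k))
    = (u + D * inverse u) ^ n"
proof -
  have "(u + D * inverse u) ^ n = (\<Sum>k\<le>n. of_nat (n choose k) * (D * inverse u) ^ k * u ^ (n - k))"
    by (subst add.commute) (rule binomial_ring)
  also have "\<dots> = (\<Sum>k\<le>n. of_nat (n choose k) * D ^ k * u powi (int n - 2 * int k))"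
  proof (intro sum.cong refl)
    fix k assume "k \<in> {..n}"
    then have *: "int n - 2 * int k = int (n - k) - int k" by auto
    have "u powi (int n - 2 * int k) = u powi int (n - k) / u powi int k"
      unfolding * using assms by (intro power_int_diff) simp
    then have "u powi (int n - 2 * int k) = u ^ (n - k) / u ^ k"
      by (simp only: power_int_of_nat)
    then show "of_nat (n choose k) * (D * inverse u) ^ k * u ^ (n - k) =
        of_nat (n choose k) * D ^ k * u powi (int n - 2 * int k)"
      by (simp add: power_mult_distrib power_inverse divide_inverse mult_ac)
  qed
  also have "{..n} = insert 0 {1..n}" by auto
  also have "(\<Sum>k\<in>insert 0 {1..n}. of_nat (n choose k) * D ^ k * u powi (int n - 2 * int k)) =
      u powi int n + (\<Sum>k=1..n. of_nat (n choose k) * D ^ k * u powi (int n - 2 * int k))"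
    by (subst sum.insert) auto
  also have "(\<Sum>k=1..n. of_nat (n choose k) * D ^ k * u powi (int n - 2 * int k)) =
      D * (\<Sum>k=1..n. of_nat (n choose k) * D ^ (k - 1) * u powi (int n - 2 * int k))"
    unfolding sum_distrib_left
  proof (intro sum.cong refl)
    fix k assume "k \<in> {1..n}"
    then have "D ^ k = D * D ^ (k - 1)"
      by (cases k) auto
    then show "of_nat (n choose k) * D ^ k * u powi (int n - 2 * int k) =
        D * (of_nat (n choose k) * D ^ (k - 1) * u powi (int n - 2 * int k))"
      by simp
  qed
  finally show ?thesis by simp
qed

section \<open>Coefficients of bundles of parallel locks, and the recursion\<close>

context
  fixes D f g :: "'k::field"
  assumes D0: "D \<noteq> 0" and f0: "f \<noteq> 0" and g0: "g \<noteq> 0"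
begin

lemma Px_eq: "0 \<le> x \<Longrightarrow> f powi x + D * Px D f x = (f + D * inverse f) ^ nat x"
  using sum_powi_binomial[OF f0, of "nat x" D] by (simp add: Px_def)

lemma Pz_eq: "0 \<le> x \<Longrightarrow> g powi x + D * Pz D g x = (g + D * inverse g) ^ nat x"
  using sum_powi_binomial[OF g0, of "nat x" D] by (simp add: Pz_def)

text \<open>\<open>Py\<close> is the sum of \<open>Pz\<close> taken at the inverse root, and a
  nonpositive \<open>x\<close> makes the exponents agree in sign.\<close>

lemma Py_eq:
  assumes "x \<le> 0"
  shows "g powi x + D * Py D g x = (inverse g + D * g) ^ nat (- x)"
proof -
  have 1: "inverse g powi int (nat (- x)) = g powi x"
    using assms by (simp add: power_int_inverse power_int_minus[symmetric])
  have 2: "inverse g powi (- x - 2 * k) = g powi (2 * k + x)" for k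
    by (simp add: power_int_inverse power_int_minus[symmetric])
  show ?thesis
    using sum_powi_binomial[of "inverse g" "nat (- x)" D] g0 assms
    unfolding 1 by (simp add: Py_def 2)
qed

lemma Pt_eq:
  assumes "x \<le> 0"
  shows "f powi x + D * Pt D f x = (inverse f + D * f) ^ nat (- x)"
proof -
  have 1: "inverse f powi int (nat (- x)) = f powi x"
    using assms by (simp add: power_int_inverse power_int_minus[symmetric])
  have 2: "inverse f powi (- x - 2 * k) = f powi (2 * k + x)" for k
    by (simp add: power_int_inverse power_int_minus[symmetric])
  show ?thesis
    using sum_powi_binomial[of "inverse f" "nat (- x)" D] f0 assms
    unfolding 1 by (simp add: Pt_def 2)
qed

text \<open>\<open>U1 + D * U2\<close> is the image of \<open>U1 + U2 * M\<close> under the character \<open>M \<mapsto> D\<close> of the algebra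
  \<open>M\<^sup>2 = D * M\<close>, hence multiplicative.\<close>

lemma U12_eq:
  assumes "cone (x, y, z, t)"
  shows "U1 f g (x, y, z, t) + D * U2 D f g (x, y, z, t) =
    (f + D * inverse f) ^ nat x * (inverse g + D * g) ^ nat y *
    (g + D * inverse g) ^ nat (- z) * (inverse f + D * f) ^ nat (- t)"
proof -
  have c: "0 \<le> x" "- y \<le> 0" "0 \<le> - z" "t \<le> 0"
    using assms by (auto simp: cone_def)
  \<comment> \<open>The nested bracket in \<open>U2\<close> is the expansion of a product of four
    bundles, one for each lock type.\<close>
  have "U1 f g (x, y, z, t) + D * U2 D f g (x, y, z, t) =
      (f powi x + D * Px D f x) * (g powi (- y) + D * Py D g (- y)) *
      (g powi (- z) + D * Pz D g (- z)) * (f powi t + D * Pt D f t)"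
    using power_int_add[of f x t] power_int_add[of g "- y" "- z"] f0 g0
    by (simp add: algebra_simps)
  then show ?thesis
    using Px_eq[OF c(1)] Py_eq[OF c(2)] Pz_eq[OF c(3)] Pt_eq[OF c(4)] by simp
qed

lemma U1_add: "U1 f g (v + w) = U1 f g v * U1 f g w"
  using f0 g0 by (cases v; cases w) (simp add: power_int_add power_int_diff power_int_minus field_simps)

lemma U1_0: "U1 f g 0 = 1"
  by (simp add: zero_prod_def)

lemma U12_add:
  assumes "cone v" "cone w"
  shows "U1 f g (v + w) + D * U2 D f g (v + w) =
    (U1 f g v + D * U2 D f g v) * (U1 f g w + D * U2 D f g w)"
proof -
  obtain x y z t x' y' z' t' where vw: "v = (x, y, z, t)" "w = (x', y', z', t')"
    by (cases v; cases w) auto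
  have c: "0 \<le> x" "0 \<le> y" "z \<le> 0" "t \<le> 0" "0 \<le> x'" "0 \<le> y'" "z' \<le> 0" "t' \<le> 0"
    using assms by (auto simp: cone_def vw)
  have n: "nat (x + x') = nat x + nat x'" "nat (y + y') = nat y + nat y'"
    "nat (- (z + z')) = nat (- z) + nat (- z')" "nat (- (t + t')) = nat (- t) + nat (- t')"
    using c by auto
  have "cone (x + x', y + y', z + z', t + t')"
    using cone_add[OF assms] by (simp add: vw)
  from U12_eq[OF this] show ?thesis
    using U12_eq assms unfolding vw add_Pair n power_add by simp
qed

lemma prod_U1: "(\<Prod>e\<in>F. U1 f g (k e)) = U1 f g (\<Sum>e\<in>F. k e)"
  by (induction F rule: infinite_finite_induct) (simp_all add: U1_0 U1_add)

lemma prod_U12: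
  "\<forall>e\<in>F. cone (k e) \<Longrightarrow> (\<Prod>e\<in>F. U1 f g (k e) + D * U2 D f g (k e)) =
    U1 f g (\<Sum>e\<in>F. k e) + D * U2 D f g (\<Sum>e\<in>F. k e)"
proof (induction F rule: infinite_finite_induct)
  case (insert e F)
  then show ?case
    by (simp add: U12_add cone_sum)
qed (use U12_eq[of 0 0 0 0] in \<open>simp_all add: zero_prod_def[symmetric]\<close>)

lemma potts_parallel_quad:
  assumes "finite F" "finite E" "F \<inter> E = {}" "finite V" "i \<in> V" "j \<in> V" "i \<noteq> j"
    and "\<forall>e\<in>F. {s e, t e} = {i, j}" "\<forall>e\<in>F. cone (k e)"
  defines "h \<equiv> \<lambda>x. if x = j then i else x"
  defines "a \<equiv> \<lambda>e. U1 f g (k e)" and "b \<equiv> \<lambda>e. U2 D f g (k e)"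
  shows "potts D V (F \<union> E) s t a b = U1 f g (\<Sum>e\<in>F. k e) * potts D V E s t a b +
    U2 D f g (\<Sum>e\<in>F. k e) * potts D (V - {j}) E (h \<circ> s) (h \<circ> t) a b"
proof -
  have "((\<Prod>e\<in>F. a e + D * b e) - (\<Prod>e\<in>F. a e)) / D = U2 D f g (\<Sum>e\<in>F. k e)"
    using D0 assms(9) by (simp add: a_def b_def prod_U12 prod_U1)
  moreover have "(\<Prod>e\<in>F. a e) = U1 f g (\<Sum>e\<in>F. k e)"
    by (simp add: a_def prod_U1)
  ultimately show ?thesis
    using potts_parallel[of F E V i j s t D a b] assms(1-8) D0 unfolding h_def by simp
qed

text \<open>A region whose remaining locks, of total type \<open>w\<close>, all lead to the deleted
  region has diagonal entry \<open>- w\<close>. Separating it leaves an isolated vertex with factor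
  \<open>D\<close>; merging it into the deleted region leaves no extra factor.\<close>

lemma Dcal_minus: "Dcal D f g (- w) = U1 f g w * D + U2 D f g w"
  by (cases w) (simp add: algebra_simps)

text \<open>The graph has the deleted region \<open>r0\<close> as an additional vertex, whose edges
  are visible only through the diagonal. The invariant relates \<open>G\<close> to sums over bundles
  and survives both branches: deleting the bundle between \<open>i\<close> and \<open>j\<close>
  corrects the two diagonal entries, and contracting it creates no loops, because the whole bundle
  goes at once. As any derivation gives the same value, the recursion does not depend on its
  choices.\<close>

lemma M_value_potts:
  assumes "M_value D f g I G m" "finite I" "r0 \<notin> I" "finite E"
    and "\<forall>e\<in>E. s e \<in> insert r0 I \<and> t e \<in> insert r0 I \<and> s e \<noteq> t e"
    and "\<forall>e\<in>E. cone (k e) \<and> k e \<noteq> 0"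
    and "\<forall>i\<in>I. \<forall>j\<in>I. i \<noteq> j \<longrightarrow> G i j = (\<Sum>e | e \<in> E \<and> {s e, t e} = {i, j}. k e)"
    and "\<forall>i\<in>I. G i i = - (\<Sum>e | e \<in> E \<and> i \<in> {s e, t e}. k e)"
  shows "m = potts D (insert r0 I) E s t (\<lambda>e. U1 f g (k e)) (\<lambda>e. U2 D f g (k e))"
  using assms
proof (induction arbitrary: E s t rule: M_value.induct)
  case (off_diagonal i I j G m1 m2)
  let ?V = "insert r0 I" and ?F = "{e \<in> E. {s e, t e} = {i, j}}"
  let ?E = "E - ?F"
  define h where "h = (\<lambda>x. if x = j then i else x)"
  note ij = off_diagonal.hyps(1-3)
  have ends: "s e \<in> ?V" "t e \<in> ?V" "s e \<noteq> t e" if "e \<in> E" for e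
    using off_diagonal.prems(4) that by auto
  have fin: "finite {e \<in> E. P e}" "finite {e \<in> ?E. P e}" for P
    using off_diagonal.prems(3) by auto
  have Gij: "G i j = (\<Sum>e\<in>?F. k e)" "G j i = (\<Sum>e\<in>?F. k e)"
    using off_diagonal.prems(6) ij by (auto simp: insert_commute)
  have off: "G p r = (\<Sum>e | e \<in> ?E \<and> {s e, t e} = {p, r}. k e)"
    if "p \<in> I" "r \<in> I" "p \<noteq> r" "{p, r} \<noteq> {i, j}" for p r
  proof -
    have "{e \<in> E. {s e, t e} = {p, r}} = {e \<in> ?E. {s e, t e} = {p, r}}"
      by (rule Collect_cong) (simp, metis that(4))
    then show ?thesis
      using off_diagonal.prems(6) that by auto
  qed
  have diag: "G p p = - (\<Sum>e | e \<in> ?E \<and> p \<in> {s e, t e}. k e)" if "p \<in> I" "p \<notin> {i, j}" for p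
  proof -
    have "{e \<in> E. p \<in> {s e, t e}} = {e \<in> ?E. p \<in> {s e, t e}}"
      using that(2) by auto
    then show ?thesis
      using off_diagonal.prems(7) that by auto
  qed
  \<comment> \<open>At the two ends the bundle is also counted in the diagonal entry, so taking it
    out adds \<open>G i j\<close> there.\<close>
  have diag': "G p p + G i j = - (\<Sum>e | e \<in> ?E \<and> p \<in> {s e, t e}. k e)" if p: "p \<in> {i, j}" for p
  proof -
    have "{e \<in> E. p \<in> {s e, t e}} = {e \<in> ?E. p \<in> {s e, t e}} \<union> ?F"
      using p by auto
    then have "(\<Sum>e | e \<in> E \<and> p \<in> {s e, t e}. k e) = (\<Sum>e\<in>{e \<in> ?E. p \<in> {s e, t e}} \<union> ?F. k e)"
      by (rule arg_cong)
    also have "\<dots> = (\<Sum>e | e \<in> ?E \<and> p \<in> {s e, t e}. k e) + (\<Sum>e\<in>?F. k e)"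
      using fin by (intro sum.union_disjoint) auto
    finally show ?thesis
      using off_diagonal.prems(7) p ij by (auto simp: Gij)
  qed
  have m1: "m1 = potts D ?V ?E s t (\<lambda>e. U1 f g (k e)) (\<lambda>e. U2 D f g (k e))"
  proof (rule off_diagonal.IH(1))
    show "\<forall>p\<in>I. \<forall>r\<in>I. p \<noteq> r \<longrightarrow> separate G i j p r = (\<Sum>e | e \<in> ?E \<and> {s e, t e} = {p, r}. k e)"
    proof (intro ballI impI)
      fix p r assume pr: "p \<in> I" "r \<in> I" "p \<noteq> r"
      show "separate G i j p r = (\<Sum>e | e \<in> ?E \<and> {s e, t e} = {p, r}. k e)"
      proof (cases "{p, r} = {i, j}")
        case True
        then have "{e \<in> ?E. {s e, t e} = {p, r}} = {}" by auto
        moreover have "separate G i j p r = 0"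
          using True pr by (auto simp: separate_def doubleton_eq_iff)
        ultimately show ?thesis by (simp only: sum.empty)
      next
        case False
        then have "separate G i j p r = G p r"
          using pr by (auto simp: separate_def)
        then show ?thesis using off[OF pr False] by simp
      qed
    qed
    show "\<forall>p\<in>I. separate G i j p p = - (\<Sum>e | e \<in> ?E \<and> p \<in> {s e, t e}. k e)"
      using diag diag' ij by (auto simp: separate_def)
  qed (use off_diagonal.prems in auto)
  have m2: "m2 = potts D (insert r0 (I - {j})) ?E (h \<circ> s) (h \<circ> t) (\<lambda>e. U1 f g (k e)) (\<lambda>e. U2 D f g (k e))"
  proof (rule off_diagonal.IH(2))
    show "\<forall>e\<in>?E. (h \<circ> s) e \<in> insert r0 (I - {j}) \<and> (h \<circ> t) e \<in> insert r0 (I - {j}) \<and> (h \<circ> s) e \<noteq> (h \<circ> t) e"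
    proof
      fix e assume "e \<in> ?E"
      then have "e \<in> E" "{s e, t e} \<noteq> {i, j}" by auto
      then show "(h \<circ> s) e \<in> insert r0 (I - {j}) \<and> (h \<circ> t) e \<in> insert r0 (I - {j}) \<and> (h \<circ> s) e \<noteq> (h \<circ> t) e"
        using ends[of e] ij off_diagonal.prems(2) by (auto simp: h_def doubleton_eq_iff)
    qed
    have split: "(\<Sum>e | e \<in> ?E \<and> {(h \<circ> s) e, (h \<circ> t) e} = {i, r}. k e) = G i r + G j r"
      if r: "r \<in> I" "r \<noteq> i" "r \<noteq> j" for r
    proof -
      have "{e \<in> ?E. {(h \<circ> s) e, (h \<circ> t) e} = {i, r}} =
          {e \<in> ?E. {s e, t e} = {i, r}} \<union> {e \<in> ?E. {s e, t e} = {j, r}}"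
        using r by (auto simp: h_def doubleton_eq_iff split: if_splits)
      then have "(\<Sum>e | e \<in> ?E \<and> {(h \<circ> s) e, (h \<circ> t) e} = {i, r}. k e) =
          (\<Sum>e\<in>{e \<in> ?E. {s e, t e} = {i, r}} \<union> {e \<in> ?E. {s e, t e} = {j, r}}. k e)"
        by (rule arg_cong)
      also have "\<dots> = (\<Sum>e | e \<in> ?E \<and> {s e, t e} = {i, r}. k e) + (\<Sum>e | e \<in> ?E \<and> {s e, t e} = {j, r}. k e)"
        using fin ij r by (intro sum.union_disjoint) (auto simp: doubleton_eq_iff)
      finally show ?thesis
        using off[of i r] off[of j r] ij r by (auto simp: doubleton_eq_iff)
    qed
    have sym: "G p r = G r p" if "p \<in> I" "r \<in> I" for p r
      using off_diagonal.prems(6) that by (cases "p = r") (auto simp: insert_commute)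
    show "\<forall>p\<in>I - {j}. \<forall>r\<in>I - {j}. p \<noteq> r \<longrightarrow>
        merge G i j p r = (\<Sum>e | e \<in> ?E \<and> {(h \<circ> s) e, (h \<circ> t) e} = {p, r}. k e)"
    proof (intro ballI impI)
      fix p r assume pr: "p \<in> I - {j}" "r \<in> I - {j}" "p \<noteq> r"
      consider "p = i" | "r = i" | "p \<noteq> i" "r \<noteq> i" by blast
      then show "merge G i j p r = (\<Sum>e | e \<in> ?E \<and> {(h \<circ> s) e, (h \<circ> t) e} = {p, r}. k e)"
      proof cases
        case 1
        then show ?thesis
          using split[of r] pr by (simp add: merge_def)
      next
        case 2
        then show ?thesis
          using split[of p] pr sym[of p i] sym[of p j] ij by (simp add: merge_def insert_commute)
      next
        case 3
        then have "{e \<in> ?E. {(h \<circ> s) e, (h \<circ> t) e} = {p, r}} = {e \<in> ?E. {s e, t e} = {p, r}}"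
          using pr by (auto simp: h_def doubleton_eq_iff split: if_splits)
        then show ?thesis
          using 3 pr off[of p r] by (auto simp: merge_def doubleton_eq_iff)
      qed
    qed
    show "\<forall>p\<in>I - {j}. merge G i j p p = - (\<Sum>e | e \<in> ?E \<and> p \<in> {(h \<circ> s) e, (h \<circ> t) e}. k e)"
    proof
      fix p assume p: "p \<in> I - {j}"
      show "merge G i j p p = - (\<Sum>e | e \<in> ?E \<and> p \<in> {(h \<circ> s) e, (h \<circ> t) e}. k e)"
      proof (cases "p = i")
        case True
        have "{e \<in> ?E. i \<in> {(h \<circ> s) e, (h \<circ> t) e}} =
            {e \<in> ?E. i \<in> {s e, t e}} \<union> {e \<in> ?E. j \<in> {s e, t e}}"
          by (auto simp: h_def)
        then have "(\<Sum>e | e \<in> ?E \<and> i \<in> {(h \<circ> s) e, (h \<circ> t) e}. k e) =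
            (\<Sum>e\<in>{e \<in> ?E. i \<in> {s e, t e}} \<union> {e \<in> ?E. j \<in> {s e, t e}}. k e)"
          by (rule arg_cong)
        \<comment> \<open>An edge touching both \<open>i\<close> and \<open>j\<close> would belong
          to the bundle \<open>?F\<close>, so the two sets are disjoint.\<close>
        also have "\<dots> = (\<Sum>e | e \<in> ?E \<and> i \<in> {s e, t e}. k e) + (\<Sum>e | e \<in> ?E \<and> j \<in> {s e, t e}. k e)"
          using fin ij by (intro sum.union_disjoint) (auto simp: doubleton_eq_iff)
        also have "\<dots> = - (G i i + G i j) - (G j j + G i j)"
          using diag'[of i] diag'[of j] by simp
        finally show ?thesis
          using True by (simp add: merge_def)
      next
        case False
        then have "{e \<in> ?E. p \<in> {(h \<circ> s) e, (h \<circ> t) e}} = {e \<in> ?E. p \<in> {s e, t e}}"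
          using p by (auto simp: h_def)
        then show ?thesis
          using False p diag[of p] by (auto simp: merge_def)
      qed
    qed
  qed (use off_diagonal.prems in auto)
  have "potts D ?V (?F \<union> ?E) s t (\<lambda>e. U1 f g (k e)) (\<lambda>e. U2 D f g (k e)) =
      U1 f g (\<Sum>e\<in>?F. k e) * potts D ?V ?E s t (\<lambda>e. U1 f g (k e)) (\<lambda>e. U2 D f g (k e)) +
      U2 D f g (\<Sum>e\<in>?F. k e) * potts D (?V - {j}) ?E (h \<circ> s) (h \<circ> t) (\<lambda>e. U1 f g (k e)) (\<lambda>e. U2 D f g (k e))"
    unfolding h_def using off_diagonal.prems ij
    by (intro potts_parallel_quad) auto
  moreover have "?F \<union> ?E = E" by auto
  moreover have "?V - {j} = insert r0 (I - {j})"
    using ij off_diagonal.prems(2) by auto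
  ultimately show ?case
    using m1 m2 Gij(1) by simp
next
  case (diagonal I G i m)
  let ?V = "insert r0 I" and ?F = "{e \<in> E. i \<in> {s e, t e}}"
  let ?E = "E - ?F"
  \<comment> \<open>The off-diagonal entries vanish and nothing cancels in them, so no edge joins
    \<open>i\<close> to another kept region; every edge at \<open>i\<close> runs to
    \<open>r0\<close>.\<close>
  have F: "{s e, t e} = {r0, i}" if e: "e \<in> ?F" for e
  proof -
    obtain p where p: "{s e, t e} = {p, i}" "p \<noteq> i" "p \<in> ?V"
    proof (cases "i = s e")
      case True
      then show ?thesis
        using that[of "t e"] e diagonal.prems(4) by (auto simp: insert_commute)
    next
      case False
      then show ?thesis
        using that[of "s e"] e diagonal.prems(4) by auto
    qed
    have "p \<notin> I"
    proof
      assume "p \<in> I"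
      then have "G p i = 0" "G p i = (\<Sum>e | e \<in> E \<and> {s e, t e} = {p, i}. k e)"
        using diagonal.hyps(1,2) diagonal.prems(6) p(2) by blast+
      then have "(\<Sum>e | e \<in> E \<and> {s e, t e} = {p, i}. k e) = 0"
        by simp
      moreover have "e \<in> {e \<in> E. {s e, t e} = {p, i}}"
        using e p(1) by blast
      ultimately have "k e = 0"
        using diagonal.prems(3,5) by (intro cone_sum_eq_0[of "{e \<in> E. {s e, t e} = {p, i}}" k]) simp_all
      then show False
        using e diagonal.prems(5) by auto
    qed
    then show ?thesis using p by auto
  qed
  have m: "m = potts D (insert r0 (I - {i})) ?E s t (\<lambda>e. U1 f g (k e)) (\<lambda>e. U2 D f g (k e))"
  proof (rule diagonal.IH)
    show "\<forall>p\<in>I - {i}. \<forall>r\<in>I - {i}. p \<noteq> r \<longrightarrow> G p r = (\<Sum>e | e \<in> ?E \<and> {s e, t e} = {p, r}. k e)"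
    proof (intro ballI impI)
      fix p r assume pr: "p \<in> I - {i}" "r \<in> I - {i}" "p \<noteq> r"
      then have "{e \<in> ?E. {s e, t e} = {p, r}} = {e \<in> E. {s e, t e} = {p, r}}"
        by (auto simp: doubleton_eq_iff)
      then show "G p r = (\<Sum>e | e \<in> ?E \<and> {s e, t e} = {p, r}. k e)"
        using diagonal.prems(6) pr by auto
    qed
    show "\<forall>p\<in>I - {i}. G p p = - (\<Sum>e | e \<in> ?E \<and> p \<in> {s e, t e}. k e)"
    proof
      fix p assume p: "p \<in> I - {i}"
      then have "p \<noteq> r0" using diagonal.prems(2) by auto
      then have "{e \<in> ?E. p \<in> {s e, t e}} = {e \<in> E. p \<in> {s e, t e}}"
        using p F by blast
      then show "G p p = - (\<Sum>e | e \<in> ?E \<and> p \<in> {s e, t e}. k e)"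
        using diagonal.prems(7) p by auto
    qed
  qed (use diagonal.prems in auto)
  \<comment> \<open>The bundle is contracted towards \<open>r0\<close>. No other edge touches
    \<open>i\<close>, so both branches have the same edges left: one keeps \<open>i\<close> as an
    isolated vertex, the other drops it.\<close>
  have "potts D ?V (?F \<union> ?E) s t (\<lambda>e. U1 f g (k e)) (\<lambda>e. U2 D f g (k e)) =
      U1 f g (\<Sum>e\<in>?F. k e) * potts D ?V ?E s t (\<lambda>e. U1 f g (k e)) (\<lambda>e. U2 D f g (k e)) +
      U2 D f g (\<Sum>e\<in>?F. k e) * potts D (?V - {i}) ?E ((\<lambda>x. if x = i then r0 else x) \<circ> s)
        ((\<lambda>x. if x = i then r0 else x) \<circ> t) (\<lambda>e. U1 f g (k e)) (\<lambda>e. U2 D f g (k e))"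
    using diagonal.prems diagonal.hyps(2) F
    by (intro potts_parallel_quad) auto
  moreover have "?F \<union> ?E = E" by auto
  moreover have V: "?V - {i} = insert r0 (I - {i})"
    using diagonal.prems(2) diagonal.hyps(2) by auto
  moreover have "potts D (?V - {i}) ?E ((\<lambda>x. if x = i then r0 else x) \<circ> s)
        ((\<lambda>x. if x = i then r0 else x) \<circ> t) (\<lambda>e. U1 f g (k e)) (\<lambda>e. U2 D f g (k e)) = m"
    unfolding V m by (rule potts_cong) auto
  moreover have "potts D ?V ?E s t (\<lambda>e. U1 f g (k e)) (\<lambda>e. U2 D f g (k e)) = D * m"
    unfolding m V[symmetric] using diagonal.prems(1) diagonal.hyps(2) D0
    by (intro potts_isolated) auto
  moreover have "Dcal D f g (G i i) = U1 f g (\<Sum>e\<in>?F. k e) * D + U2 D f g (\<Sum>e\<in>?F. k e)"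
    using diagonal.prems(7) diagonal.hyps(2) Dcal_minus by auto
  ultimately show ?case
    by (simp add: algebra_simps)
next
  case (empty G)
  then have "E = {}" by auto
  then show ?case
    using D0 by (simp add: potts_def power2_eq_square)
qed

end

text \<open>The recursion terminates lexicographically: \<open>merge\<close> and the diagonal step
  shrink the index set, while \<open>separate\<close> keeps it and reduces the number of nonzero
  off-diagonal entries.\<close>

lemma M_value_exists: "finite I \<Longrightarrow> \<exists>m. M_value D f g I G m"
proof (induction "card I" arbitrary: I G rule: less_induct)
  case less
  note outer = less
  define N where "N = (\<lambda>G :: 'a \<Rightarrow> 'a \<Rightarrow> quad. {(i, j). i \<in> I \<and> j \<in> I \<and> i \<noteq> j \<and> G i j \<noteq> 0})"
  show ?case
  proof (induction "card (N G)" arbitrary: G rule: less_induct)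
    case less
    show ?case
    proof (cases "N G = {}")
      case True
      then have d: "\<forall>j\<in>I. \<forall>k\<in>I. j \<noteq> k \<longrightarrow> G j k = 0"
        by (auto simp: N_def)
      show ?thesis
      proof (cases "I = {}")
        case True
        then show ?thesis using M_value.empty by blast
      next
        case False
        then obtain i where i: "i \<in> I" by blast
        then have "card (I - {i}) < card I"
          using outer(2) by (intro psubset_card_mono) auto
        then obtain m where "M_value D f g (I - {i}) G m"
          using outer(1)[of "I - {i}" G] outer(2) by auto
        then show ?thesis
          using M_value.diagonal[OF d i] by blast
      qed
    next
      case False
      then obtain i j where ij: "i \<in> I" "j \<in> I" "i \<noteq> j" "G i j \<noteq> 0"
        by (auto simp: N_def)
      have "finite (N G)"
        by (rule finite_subset[of _ "I \<times> I"]) (use outer(2) in \<open>auto simp: N_def\<close>)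
      moreover have "N (separate G i j) \<subset> N G"
        using ij by (auto simp: N_def separate_def split: if_splits)
      ultimately have "card (N (separate G i j)) < card (N G)"
        by (rule psubset_card_mono)
      then obtain m1 where m1: "M_value D f g I (separate G i j) m1"
        using less by blast
      have "card (I - {j}) < card I"
        using outer(2) ij by (intro psubset_card_mono) auto
      then obtain m2 where "M_value D f g (I - {j}) (merge G i j) m2"
        using outer(1)[of "I - {j}" "merge G i j"] outer(2) by auto
      then show ?thesis
        using M_value.off_diagonal[OF ij m1] by blast
    qed
  qed
qed

section \<open>The main theorem\<close>

text \<open>The test polynomials are \<open>A\<close>, \<open>A^2 - 1\<close>, \<open>q\<close> and
  \<open>q^2 - 1\<close>, written with \<open>A\<close> as the outer variable.\<close>

lemma formal_variables_nonzero:
  assumes "formal_variables A q"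
  shows "A \<noteq> 0" "braces A \<noteq> 0" "braces q \<noteq> 0"
proof -
  note nz = assms[unfolded formal_variables_def, rule_format]
  have A: "A \<noteq> 0"
    using nz[of "[:0, 1:]"] by (simp add: map_poly_pCons)
  have A2: "A * A \<noteq> 1"
    using nz[of "[:[:-1:], 0, 1:]"] by (simp add: map_poly_pCons)
  have q: "q \<noteq> 0"
    using nz[of "[:[:0, 1:]:]"] by (simp add: map_poly_pCons)
  have q2: "q * q \<noteq> 1"
    using nz[of "[:[:-1, 0, 1:]:]"] by (simp add: map_poly_pCons)
  show "A \<noteq> 0" by (rule A)
  show "braces A \<noteq> 0"
    using A A2 by (simp add: braces_def field_simps)
  show "braces q \<noteq> 0"
    using q q2 by (simp add: braces_def field_simps)
qed

lemma num_of_card: "closed_figure B \<Longrightarrow> num_of P B = int (card {x \<in> set_mset B. P x})"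
proof -
  assume "closed_figure B"
  then have "filter_mset P (mset_set (set_mset B)) = filter_mset P B"
    by (simp add: mset_closed_figure)
  then show ?thesis
    unfolding num_of_def by (metis filter_mset_mset_set finite_set_mset size_mset_set)
qed

lemma card_Collect_insert:
  "finite X \<Longrightarrow> x \<notin> X \<Longrightarrow> int (card {y \<in> insert x X. P y}) = of_bool (P x) + int (card {y \<in> X. P y})"
proof -
  assume "finite X" "x \<notin> X"
  moreover have "{y \<in> insert x X. P y} = (if P x then insert x {y \<in> X. P y} else {y \<in> X. P y})"
    by auto
  ultimately show ?thesis by simp
qed

text \<open>The values needed to evaluate \<open>U1\<close> and \<open>U2\<close> at the type of a
  single lock.\<close>

lemma P_at_0_1 [simp]:
  "Px D f 0 = 0" "Py D f 0 = 0" "Pz D f 0 = 0" "Pt D f 0 = 0"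
  "Px D f 1 = inverse f" "Py D f (- 1) = f" "Pz D f 1 = inverse f" "Pt D f (- 1) = f"
  by (simp_all add: Px_def Py_def Pz_def Pt_def power_int_minus)

section \<open>Lock weights, the Goeritz matrix and the counts of self-locks\<close>

locale coloured_homfly = homfly A q H + coloured_bipartite B \<rho> white
  for A q :: "'k::field_char_0" and H B and \<rho> :: "side \<Rightarrow> 'r" and white +
  fixes f g :: 'k and r0 :: 'r
  assumes f2: "f ^ 2 = phi A q" and g2: "g ^ 2 = phibar A q" and braces_A: "braces A \<noteq> 0"
    and r0: "r0 \<in> V"
begin

abbreviation D :: 'k where "D \<equiv> DN A q"

definition kind :: "vertex \<Rightarrow> quad" where
  "kind x = (if bullet x then (if lateral_along w x then (0, 0, 0, - 1) else (1, 0, 0, 0))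
     else (if lateral_along w x then (0, 1, 0, 0) else (0, 0, - 1, 0)))"

text \<open>The common factor that turns the weights of the two smoothings into \<open>U1\<close>
  and \<open>U2\<close> of the lock type. Taken over all locks between different regions, it
  produces the square roots in front of the final formula.\<close>

definition pref :: "vertex \<Rightarrow> 'k" where
  "pref x = (if bullet x then A powi (- 2) * f else A powi 2 * g)"

definition sep :: "vertex \<Rightarrow> 'k" where "sep x = lock_coeff A q (\<not> lateral_along w x) x"
definition mer :: "vertex \<Rightarrow> 'k" where "mer x = lock_coeff A q (lateral_along w x) x"

definition Eself :: "vertex set" where "Eself = {x \<in> E. src x = tgt x}"
definition Eoff :: "vertex set" where "Eoff = {x \<in> E. src x \<noteq> tgt x}"

lemma D0: "D \<noteq> 0"
  using braces_A q0 by (simp add: DN_def)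

lemma f0: "f \<noteq> 0" and g0: "g \<noteq> 0"
  using f2 g2 A0 q0 by (auto simp: phi_def phibar_def)

lemma kind_cone: "cone (kind x)" "kind x \<noteq> 0"
  by (auto simp: kind_def cone_def zero_prod_def)

lemma weights: "sep x = pref x * U1 f g (kind x)" "mer x = pref x * U2 D f g (kind x)"
proof -
  have *: "phi A q = f * f" "phibar A q = g * g"
    using f2 g2 by (simp_all add: power2_eq_square)
  show "sep x = pref x * U1 f g (kind x)"
    using f0 g0 by (simp add: sep_def pref_def kind_def lock_coeff_def * power_int_minus)
  show "mer x = pref x * U2 D f g (kind x)"
    using f0 g0 by (simp add: mer_def pref_def kind_def lock_coeff_def * power_int_minus)
qed

text \<open>Because \<open>phi * D = A^2 - 1\<close> and \<open>phibar * D = A^-2 - 1\<close>, a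
  self-lock with white lateral corners contributes 1. The other self-locks give the factors
  \<open>phi + D\<close> and \<open>phibar + D\<close>.\<close>

lemma loop_weight:
  "sep x + D * mer x = (if lateral_along w x then 1
     else if bullet x then A powi (- 2) * (phi A q + D) else A powi 2 * (phibar A q + D))"
proof -
  have "phi A q * D = A * A - 1" "phibar A q * D = inverse A * inverse A - 1"
    using A0 q0 by (simp_all add: phi_def phibar_def DN_def braces_def[of A] field_simps)
  then have "1 + D * phi A q = A * A" "1 + D * phibar A q = inverse A * inverse A"
    by (simp_all add: mult.commute)
  then have "A powi (- 2) * (1 + D * phi A q) = 1" "A ^ 2 * (1 + D * phibar A q) = 1"
    using A0 by (simp_all add: power_int_minus power2_eq_square field_simps)
  then have 1: "A powi (- 2) + D * (A powi (- 2) * phi A q) = 1" "A ^ 2 + D * (A ^ 2 * phibar A q) = 1"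
    by (simp_all add: algebra_simps)
  show ?thesis
  proof (cases "lateral_along w x")
    case True
    then show ?thesis
      by (simp add: sep_def mer_def lock_coeff_def 1)
  next
    case False
    then show ?thesis
      by (simp add: sep_def mer_def lock_coeff_def algebra_simps)
  qed
qed

lemma H_potts: "H (underlying B) = potts D V E src tgt sep mer"
proof -
  have "B \<noteq> {#}"
    using r0 by (auto simp: V_def white_regions_def sides_def edges_heads)
  then have "H (underlying (N + mset_set E)) =
      (\<Sum>S\<in>Pow E. (\<Prod>x\<in>E. lock_coeff A q ((x \<in> S) = lateral_along w x) x) *
         D ^ num_components (N + (\<Sum>x\<in>E. resolve ((x \<in> S) = lateral_along w x) x)))"
    using all_bends_N sph B_eq by (intro H_state_sum) (auto simp: E_def is_lock_def)
  also have "\<dots> = (\<Sum>S\<in>Pow E. (\<Prod>x\<in>E. if x \<in> S then mer x else sep x) *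
      D ^ (2 * num_classes V ((\<lambda>x. (src x, tgt x)) ` S) + card S)) / D ^ card V"
    unfolding sum_divide_distrib
  proof (intro sum.cong refl)
    fix S assume "S \<in> Pow E"
    then have "num_components (state S) + card V = 2 * num_classes V (joins S) + card S"
      by (intro components_state) auto
    then have "D ^ (2 * num_classes V ((\<lambda>x. (src x, tgt x)) ` S) + card S) =
        D ^ num_components (state S) * D ^ card V"
      by (simp add: joins_def power_add[symmetric])
    moreover have "(\<Prod>x\<in>E. lock_coeff A q ((x \<in> S) = lateral_along w x) x) =
        (\<Prod>x\<in>E. if x \<in> S then mer x else sep x)"
      by (intro prod.cong) (auto simp: mer_def sep_def)
    ultimately show "(\<Prod>x\<in>E. lock_coeff A q ((x \<in> S) = lateral_along w x) x) *
         D ^ num_components (N + (\<Sum>x\<in>E. resolve ((x \<in> S) = lateral_along w x) x)) =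
        (\<Prod>x\<in>E. if x \<in> S then mer x else sep x) *
         D ^ (2 * num_classes V ((\<lambda>x. (src x, tgt x)) ` S) + card S) / D ^ card V"
      using D0 by (simp add: state_def)
  qed
  finally show ?thesis
    using B_eq by (simp add: potts_def)
qed

lemma white_V: "r \<in> V \<Longrightarrow> white r"
  by (simp add: V_def white_regions_def)

lemma lock_corners:
  assumes "x \<in> E"
  shows "lateral_along w x \<Longrightarrow> \<rho> ` lateral_corners x = {src x, tgt x}"
    "lateral_along w x \<Longrightarrow> r \<in> \<rho> ` end_corners x \<Longrightarrow> \<not> white r"
    "\<not> lateral_along w x \<Longrightarrow> \<rho> ` end_corners x = {src x, tgt x}"
    "\<not> lateral_along w x \<Longrightarrow> r \<in> \<rho> ` lateral_corners x \<Longrightarrow> \<not> white r"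
    "end_corners x \<noteq> {}" "lateral_corners x \<noteq> {}"
proof -
  from assms obtain s l i1 o1 i2 o2 u v where L: "x = Lock s l i1 o1 i2 o2 u v" "x \<in># B"
    by (rule E_cases)
  have e: "i1 \<in> edges B" "i2 \<in> edges B"
    using strands_edges[OF assms] L by auto
  have "w i2 = w (lead x)"
    by (rule coherent_w[unfolded coherent_def, rule_format, OF L(2)]) (simp add: L(1))
  then have w12: "w i2 = w i1"
    by (simp add: L(1))
  then show "lateral_along w x \<Longrightarrow> \<rho> ` lateral_corners x = {src x, tgt x}"
    "\<not> lateral_along w x \<Longrightarrow> \<rho> ` end_corners x = {src x, tgt x}"
    by (auto simp: L src_def tgt_def hr_def)
  show "lateral_along w x \<Longrightarrow> r \<in> \<rho> ` end_corners x \<Longrightarrow> \<not> white r"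
    "\<not> lateral_along w x \<Longrightarrow> r \<in> \<rho> ` lateral_corners x \<Longrightarrow> \<not> white r"
  proof -
    have ends: "white (\<rho> (i1, f)) \<longleftrightarrow> f = w i1" "white (\<rho> (i2, f)) \<longleftrightarrow> f = w i1" for f
      unfolding w12[symmetric] by (rule white_iff[OF e(1), unfolded w12[symmetric]]) (rule white_iff[OF e(2)])
    show "lateral_along w x \<Longrightarrow> r \<in> \<rho> ` end_corners x \<Longrightarrow> \<not> white r"
      "\<not> lateral_along w x \<Longrightarrow> r \<in> \<rho> ` lateral_corners x \<Longrightarrow> \<not> white r"
      by (auto simp: L ends)
  qed
  show "end_corners x \<noteq> {}" "lateral_corners x \<noteq> {}"
    by (auto simp: L)
qed

text \<open>A white member rules out black corners, so equality with \<open>{i, j}\<close> also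
  decides which pair of corners is white.\<close>

lemma end_corners_eq:
  assumes "x \<in> E" "white i"
  shows "\<rho> ` end_corners x = {i, j} \<longleftrightarrow> \<not> lateral_along w x \<and> {src x, tgt x} = {i, j}"
proof (cases "lateral_along w x")
  case True
  then have "i \<notin> \<rho> ` end_corners x"
    using lock_corners(2)[OF assms(1)] assms(2) by blast
  then show ?thesis
    using True by blast
next
  case False
  then show ?thesis
    using lock_corners(3)[OF assms(1)] by simp
qed

lemma lateral_corners_eq:
  assumes "x \<in> E" "white i"
  shows "\<rho> ` lateral_corners x = {i, j} \<longleftrightarrow> lateral_along w x \<and> {src x, tgt x} = {i, j}"
proof (cases "lateral_along w x")
  case False
  then have "i \<notin> \<rho> ` lateral_corners x"
    using lock_corners(4)[OF assms(1)] assms(2) by blast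
  then show ?thesis
    using False by blast
next
  case True
  then show ?thesis
    using lock_corners(1)[OF assms(1)] by simp
qed

lemma self_end_iff: "x \<in> E \<Longrightarrow> self_end \<rho> white x \<longleftrightarrow> \<not> lateral_along w x \<and> src x = tgt x"
proof
  assume x: "x \<in> E" and "self_end \<rho> white x"
  then obtain r where "white r" "\<rho> ` end_corners x = {r, r}"
    by (auto simp: self_end_def)
  then show "\<not> lateral_along w x \<and> src x = tgt x"
    using end_corners_eq[OF x] by (metis doubleton_eq_iff)
next
  assume x: "x \<in> E" and "\<not> lateral_along w x \<and> src x = tgt x"
  moreover have "white (src x)"
    using src_tgt_V[OF x] white_V by blast
  ultimately have "\<rho> ` end_corners x = {src x, src x}"
    using end_corners_eq[OF x, of "src x" "src x"] by simp
  then show "self_end \<rho> white x"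
    using \<open>white (src x)\<close> by (auto simp: self_end_def)
qed

lemma self_lateral_iff: "x \<in> E \<Longrightarrow> self_lateral \<rho> white x \<longleftrightarrow> lateral_along w x \<and> src x = tgt x"
proof
  assume x: "x \<in> E" and "self_lateral \<rho> white x"
  then obtain r where "white r" "\<rho> ` lateral_corners x = {r, r}"
    by (auto simp: self_lateral_def)
  then show "lateral_along w x \<and> src x = tgt x"
    using lateral_corners_eq[OF x] by (metis doubleton_eq_iff)
next
  assume x: "x \<in> E" and "lateral_along w x \<and> src x = tgt x"
  moreover have "white (src x)"
    using src_tgt_V[OF x] white_V by blast
  ultimately have "\<rho> ` lateral_corners x = {src x, src x}"
    using lateral_corners_eq[OF x, of "src x" "src x"] by simp
  then show "self_lateral \<rho> white x"
    using \<open>white (src x)\<close> by (auto simp: self_lateral_def)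
qed

lemma bullet_circ_E:
  "x \<in># B \<and> bullet x \<longleftrightarrow> x \<in> E \<and> bullet x"
  "x \<in># B \<and> circ x \<longleftrightarrow> x \<in> E \<and> \<not> bullet x"
  using lb by (cases x; auto simp: E_def lock_bend_def)+

lemma num_of_bullet: "num_of (\<lambda>x. bullet x \<and> P x) B = int (card {x \<in> E. bullet x \<and> P x})"
proof -
  have "{x \<in> set_mset B. bullet x \<and> P x} = {x \<in> E. bullet x \<and> P x}"
    using bullet_circ_E by blast
  then show ?thesis
    by (simp add: num_of_card[OF cl])
qed

lemma num_of_circ: "num_of (\<lambda>x. circ x \<and> P x) B = int (card {x \<in> E. \<not> bullet x \<and> P x})"
proof -
  have "{x \<in> set_mset B. circ x \<and> P x} = {x \<in> E. \<not> bullet x \<and> P x}"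
    using bullet_circ_E by blast
  then show ?thesis
    by (simp add: num_of_card[OF cl])
qed

lemma sum_kind:
  "finite X \<Longrightarrow> (\<Sum>x\<in>X. kind x) =
    (int (card {x \<in> X. bullet x \<and> \<not> lateral_along w x}), int (card {x \<in> X. \<not> bullet x \<and> lateral_along w x}),
     - int (card {x \<in> X. \<not> bullet x \<and> \<not> lateral_along w x}), - int (card {x \<in> X. bullet x \<and> lateral_along w x}))"
proof (induction X rule: finite_induct)
  case empty
  then show ?case by (simp add: zero_prod_def)
next
  case (insert x X)
  then show ?case
    unfolding card_Collect_insert[OF insert.hyps] by (simp add: kind_def)
qed

lemma goeritz_off_eq:
  assumes "i \<in> V" "i \<noteq> j"
  shows "goeritz_off B \<rho> i j = (\<Sum>x | x \<in> Eoff \<and> {src x, tgt x} = {i, j}. kind x)"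
proof -
  have X: "{x \<in> Eoff. {src x, tgt x} = {i, j}} = {x \<in> E. {src x, tgt x} = {i, j}}"
    using assms(2) by (auto simp: Eoff_def doubleton_eq_iff)
  have "{x \<in> E. P x \<and> \<rho> ` end_corners x = {i, j}} =
      {x \<in> {x \<in> E. {src x, tgt x} = {i, j}}. P x \<and> \<not> lateral_along w x}" for P
    by (rule Collect_cong) (use end_corners_eq[OF _ white_V[OF assms(1)]] in \<open>simp only: mem_Collect_eq, metis\<close>)
  moreover have "{x \<in> E. P x \<and> \<rho> ` lateral_corners x = {i, j}} =
      {x \<in> {x \<in> E. {src x, tgt x} = {i, j}}. P x \<and> lateral_along w x}" for P
    by (rule Collect_cong) (use lateral_corners_eq[OF _ white_V[OF assms(1)]] in \<open>simp only: mem_Collect_eq, metis\<close>)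
  ultimately show ?thesis
    unfolding goeritz_off_def num_of_bullet num_of_circ X
    by (subst sum_kind) simp_all
qed

text \<open>The locks at \<open>i\<close> are sorted by the region at their other end; self-locks
  are absent from \<open>Eoff\<close>, so these classes exhaust them without overlap.\<close>

lemma goeritz_diag_eq:
  assumes "i \<in> V"
  shows "goeritz B \<rho> white i i = - (\<Sum>x | x \<in> Eoff \<and> i \<in> {src x, tgt x}. kind x)"
proof -
  have "(\<Sum>k\<in>V - {i}. goeritz_off B \<rho> k i) =
      (\<Sum>k\<in>V - {i}. \<Sum>x | x \<in> Eoff \<and> {src x, tgt x} = {k, i}. kind x)"
    by (intro sum.cong refl goeritz_off_eq) auto
  also have "\<dots> = (\<Sum>x\<in>(\<Union>k\<in>V - {i}. {x. x \<in> Eoff \<and> {src x, tgt x} = {k, i}}). kind x)"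
    by (rule sum.UNION_disjoint[symmetric]) (auto simp: Eoff_def doubleton_eq_iff)
  also have "(\<Union>k\<in>V - {i}. {x. x \<in> Eoff \<and> {src x, tgt x} = {k, i}}) = {x. x \<in> Eoff \<and> i \<in> {src x, tgt x}}"
    using src_tgt_V by (auto simp: Eoff_def doubleton_eq_iff)
  finally show ?thesis
    by (simp add: goeritz_def V_def)
qed

lemma M_value_eq:
  assumes "M_value D f g (V - {r0}) (goeritz B \<rho> white) m"
  shows "m = potts D V Eoff src tgt (\<lambda>x. U1 f g (kind x)) (\<lambda>x. U2 D f g (kind x))"
proof -
  have V: "insert r0 (V - {r0}) = V"
    using r0 by auto
  have "m = potts D (insert r0 (V - {r0})) Eoff src tgt (\<lambda>x. U1 f g (kind x)) (\<lambda>x. U2 D f g (kind x))"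
  proof (rule M_value_potts[OF D0 f0 g0 assms])
    show "\<forall>x\<in>Eoff. src x \<in> insert r0 (V - {r0}) \<and> tgt x \<in> insert r0 (V - {r0}) \<and> src x \<noteq> tgt x"
      using src_tgt_V by (auto simp: Eoff_def)
    show "\<forall>i\<in>V - {r0}. \<forall>j\<in>V - {r0}. i \<noteq> j \<longrightarrow>
        goeritz B \<rho> white i j = (\<Sum>x | x \<in> Eoff \<and> {src x, tgt x} = {i, j}. kind x)"
      using goeritz_off_eq by (simp add: goeritz_def)
  qed (use kind_cone goeritz_diag_eq in \<open>auto simp: Eoff_def\<close>)
  then show ?thesis
    unfolding V .
qed

lemma prod_bullet:
  "finite X \<Longrightarrow> (\<Prod>x\<in>X. if bullet x then a else b) =
    (a :: 'k) ^ card {x \<in> X. bullet x} * b ^ card {x \<in> X. \<not> bullet x}"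
  by (simp add: prod.If_cases Int_def)

text \<open>Self-locks leave the state sum as loops, independently of the rest. The sum that remains
  is the recursion value times the product of the normalising factors.\<close>

lemma H_formula:
  assumes "M_value D f g (V - {r0}) (goeritz B \<rho> white) m"
  defines "nb \<equiv> card {x \<in> E. bullet x \<and> src x \<noteq> tgt x}" and "nc \<equiv> card {x \<in> E. \<not> bullet x \<and> src x \<noteq> tgt x}"
    and "nbh \<equiv> card {x \<in> E. bullet x \<and> \<not> lateral_along w x \<and> src x = tgt x}"
    and "nch \<equiv> card {x \<in> E. \<not> bullet x \<and> \<not> lateral_along w x \<and> src x = tgt x}"
  shows "H (underlying B) = (A powi (- 2) * (phi A q + D)) ^ nbh * (A powi 2 * (phibar A q + D)) ^ nch *
    ((A powi (- 2) * f) ^ nb * (A powi 2 * g) ^ nc * m)"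
proof -
  have "H (underlying B) = potts D V (Eself \<union> Eoff) src tgt sep mer"
  proof -
    have "Eself \<union> Eoff = E"
      by (auto simp: Eself_def Eoff_def)
    then show ?thesis
      by (simp add: H_potts)
  qed
  also have "\<dots> = (\<Prod>x\<in>Eself. sep x + D * mer x) * potts D V Eoff src tgt sep mer"
    by (rule potts_loops) (auto simp: Eself_def Eoff_def)
  also have "potts D V Eoff src tgt sep mer = (\<Prod>x\<in>Eoff. pref x) * m"
  proof -
    have "potts D V Eoff src tgt sep mer =
        potts D V Eoff src tgt (\<lambda>x. pref x * U1 f g (kind x)) (\<lambda>x. pref x * U2 D f g (kind x))"
      by (rule potts_cong) (simp_all add: weights)
    also have "\<dots> = (\<Prod>x\<in>Eoff. pref x) * m"
      unfolding M_value_eq[OF assms(1)] by (rule potts_scale)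
    finally show ?thesis .
  qed
  also have "(\<Prod>x\<in>Eoff. pref x) = (A powi (- 2) * f) ^ nb * (A powi 2 * g) ^ nc"
  proof -
    have "{x \<in> Eoff. bullet x} = {x \<in> E. bullet x \<and> src x \<noteq> tgt x}"
      "{x \<in> Eoff. \<not> bullet x} = {x \<in> E. \<not> bullet x \<and> src x \<noteq> tgt x}"
      by (auto simp: Eoff_def)
    then show ?thesis
      unfolding pref_def nb_def nc_def by (subst prod_bullet) (simp_all add: Eoff_def)
  qed
  also have "(\<Prod>x\<in>Eself. sep x + D * mer x) =
      (A powi (- 2) * (phi A q + D)) ^ nbh * (A powi 2 * (phibar A q + D)) ^ nch"
  proof -
    have "(\<Prod>x\<in>Eself. sep x + D * mer x) =
        (\<Prod>x\<in>{x \<in> Eself. \<not> lateral_along w x}. if bullet x then A powi (- 2) * (phi A q + D) else A powi 2 * (phibar A q + D))"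
      unfolding loop_weight
      by (intro prod.mono_neutral_cong_right) (auto simp: Eself_def)
    moreover have "{x \<in> {x \<in> Eself. \<not> lateral_along w x}. bullet x} =
        {x \<in> E. bullet x \<and> \<not> lateral_along w x \<and> src x = tgt x}"
      "{x \<in> {x \<in> Eself. \<not> lateral_along w x}. \<not> bullet x} =
        {x \<in> E. \<not> bullet x \<and> \<not> lateral_along w x \<and> src x = tgt x}"
      by (auto simp: Eself_def)
    ultimately show ?thesis
      unfolding nbh_def nch_def by (subst (asm) prod_bullet) (simp_all add: Eself_def)
  qed
  finally show ?thesis
    by (simp add: mult.assoc)
qed

lemma num_of_split:
  "num_of bullet B = num_of (\<lambda>x. bullet x \<and> self_lateral \<rho> white x) B +
     num_of (\<lambda>x. bullet x \<and> self_end \<rho> white x) B + int (card {x \<in> E. bullet x \<and> src x \<noteq> tgt x})"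
  "num_of circ B = num_of (\<lambda>x. circ x \<and> self_lateral \<rho> white x) B +
     num_of (\<lambda>x. circ x \<and> self_end \<rho> white x) B + int (card {x \<in> E. \<not> bullet x \<and> src x \<noteq> tgt x})"
  "num_of (\<lambda>x. bullet x \<and> self_end \<rho> white x) B =
     int (card {x \<in> E. bullet x \<and> \<not> lateral_along w x \<and> src x = tgt x})"
  "num_of (\<lambda>x. circ x \<and> self_end \<rho> white x) B =
     int (card {x \<in> E. \<not> bullet x \<and> \<not> lateral_along w x \<and> src x = tgt x})"
proof -
  have part: "card {x \<in> E. Q x} = card {x \<in> E. Q x \<and> self_lateral \<rho> white x} +
      card {x \<in> E. Q x \<and> self_end \<rho> white x} + card {x \<in> E. Q x \<and> src x \<noteq> tgt x}" for Q
  proof -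
    let ?X = "{x \<in> E. Q x \<and> self_lateral \<rho> white x}" and ?Y = "{x \<in> E. Q x \<and> self_end \<rho> white x}"
      and ?Z = "{x \<in> E. Q x \<and> src x \<noteq> tgt x}"
    have "{x \<in> E. Q x} = (?X \<union> ?Y) \<union> ?Z"
      using self_end_iff self_lateral_iff by blast
    moreover have "card ((?X \<union> ?Y) \<union> ?Z) = card (?X \<union> ?Y) + card ?Z"
      by (rule card_Un_disjoint) (auto simp: self_end_iff self_lateral_iff)
    moreover have "card (?X \<union> ?Y) = card ?X + card ?Y"
      by (rule card_Un_disjoint) (auto simp: self_end_iff self_lateral_iff)
    ultimately show ?thesis by simp
  qed
  show "num_of bullet B = num_of (\<lambda>x. bullet x \<and> self_lateral \<rho> white x) B +
     num_of (\<lambda>x. bullet x \<and> self_end \<rho> white x) B + int (card {x \<in> E. bullet x \<and> src x \<noteq> tgt x})"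
    using num_of_bullet[of "\<lambda>_. True"] part[of bullet] by (simp add: num_of_bullet)
  show "num_of circ B = num_of (\<lambda>x. circ x \<and> self_lateral \<rho> white x) B +
     num_of (\<lambda>x. circ x \<and> self_end \<rho> white x) B + int (card {x \<in> E. \<not> bullet x \<and> src x \<noteq> tgt x})"
    using num_of_circ[of "\<lambda>_. True"] part[of "\<lambda>x. \<not> bullet x"] by (simp add: num_of_circ)
  have "{x \<in> E. Q x \<and> self_end \<rho> white x} = {x \<in> E. Q x \<and> \<not> lateral_along w x \<and> src x = tgt x}" for Q
    using self_end_iff by blast
  then show "num_of (\<lambda>x. bullet x \<and> self_end \<rho> white x) B =
     int (card {x \<in> E. bullet x \<and> \<not> lateral_along w x \<and> src x = tgt x})"
    "num_of (\<lambda>x. circ x \<and> self_end \<rho> white x) B =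
     int (card {x \<in> E. \<not> bullet x \<and> \<not> lateral_along w x \<and> src x = tgt x})"
    by (simp_all add: num_of_bullet num_of_circ)
qed

end

theorem mainTheorem1:
  fixes A q sqrt_phi sqrt_phibar :: "'k::field_char_0"
    and H :: "figure \<Rightarrow> 'k"
    and B :: figure
    and \<rho> :: "side \<Rightarrow> 'r"
    and white :: "'r \<Rightarrow> bool"
    and r\<^sub>0 :: 'r
  assumes "formal_variables A q"
    and "sqrt_phi ^ 2 = phi A q"
    and "sqrt_phibar ^ 2 = phibar A q"
    and "HOMFLY_PT A q H"
    and "bipartite_diagram B"
    and "region_map B \<rho>"
    and "checkerboard B \<rho> white"
    and "white_simply_connected B \<rho> white"
    and "r\<^sub>0 \<in> white_regions B \<rho> white"
  shows "let
      Nb = num_of bullet B;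
      Nc = num_of circ B;
      Nbv = num_of (\<lambda>x. bullet x \<and> self_lateral \<rho> white x) B;
      Ncv = num_of (\<lambda>x. circ x \<and> self_lateral \<rho> white x) B;
      Nbh = num_of (\<lambda>x. bullet x \<and> self_end \<rho> white x) B;
      Nch = num_of (\<lambda>x. circ x \<and> self_end \<rho> white x) B;
      D = DN A q;
      M = M_value D sqrt_phi sqrt_phibar (white_regions B \<rho> white - {r\<^sub>0}) (goeritz B \<rho> white)
    in (\<exists>m. M m) \<and>
       (\<forall>m. M m \<longrightarrow>
          H (underlying B) =
            A powi (- 2 * (Nb - Nbv - Nc + Ncv))
            * sqrt_phi powi (Nb - Nbh - Nbv) * sqrt_phibar powi (Nc - Nch - Ncv)
            * (phi A q + D) powi Nbh * (phibar A q + D) powi Nch * m)"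
proof -
  interpret coloured_bipartite B \<rho> white
    by standard (use assms in \<open>auto simp: region_map_def\<close>)
  interpret coloured_homfly A q H B \<rho> white sqrt_phi sqrt_phibar r\<^sub>0
    by standard (use assms formal_variables_nonzero[OF assms(1)] in \<open>auto simp: V_def\<close>)
  define nb where "nb = card {x \<in> E. bullet x \<and> src x \<noteq> tgt x}"
  define nc where "nc = card {x \<in> E. \<not> bullet x \<and> src x \<noteq> tgt x}"
  define nbh where "nbh = card {x \<in> E. bullet x \<and> \<not> lateral_along w x \<and> src x = tgt x}"
  define nch where "nch = card {x \<in> E. \<not> bullet x \<and> \<not> lateral_along w x \<and> src x = tgt x}"
  define nbv where "nbv = num_of (\<lambda>x. bullet x \<and> self_lateral \<rho> white x) B"
  define ncv where "ncv = num_of (\<lambda>x. circ x \<and> self_lateral \<rho> white x) B"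
  note counts = num_of_split[folded nb_def nc_def nbh_def nch_def nbv_def ncv_def]
  \<comment> \<open>Self-locks with white lateral corners cancel from the exponents, in accordance
    with their weight 1; the other self-locks still contribute to the power of
    \<open>A\<close>.\<close>
  have "- 2 * (nbv + int nbh + int nb - nbv - (ncv + int nch + int nc) + ncv) =
      - 2 * int (nbh + nb) + 2 * int (nch + nc)"
    by simp
  moreover have "A powi (- 2 * int (nbh + nb) + 2 * int (nch + nc)) =
      A powi (- 2 * int (nbh + nb)) * A powi (2 * int (nch + nc))"
    using A0 by (intro power_int_add) simp
  ultimately have "A powi (- 2 * (nbv + int nbh + int nb - nbv - (ncv + int nch + int nc) + ncv)) =
      (A powi (- 2)) powi int (nbh + nb) * (A powi 2) powi int (nch + nc)"
    by (simp only: power_int_mult)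
  then have A: "A powi (- 2 * (nbv + int nbh + int nb - nbv - (ncv + int nch + int nc) + ncv)) =
      (A powi (- 2)) ^ (nbh + nb) * (A powi 2) ^ (nch + nc)"
    by (simp only: power_int_of_nat)
  have fg: "sqrt_phi powi (nbv + int nbh + int nb - int nbh - nbv) = sqrt_phi ^ nb"
    "sqrt_phibar powi (ncv + int nch + int nc - int nch - ncv) = sqrt_phibar ^ nc"
    by simp_all
  have "H (underlying B) = A powi (- 2 * (nbv + int nbh + int nb - nbv - (ncv + int nch + int nc) + ncv)) *
      sqrt_phi powi (nbv + int nbh + int nb - int nbh - nbv) *
      sqrt_phibar powi (ncv + int nch + int nc - int nch - ncv) *
      (phi A q + D) powi int nbh * (phibar A q + D) powi int nch * m"
    if "M_value D sqrt_phi sqrt_phibar (V - {r\<^sub>0}) (goeritz B \<rho> white) m" for m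
    unfolding A fg power_int_of_nat H_formula[OF that, folded nb_def nc_def nbh_def nch_def]
    by (simp only: power_add power_mult_distrib mult_ac)
  moreover have "\<exists>m. M_value D sqrt_phi sqrt_phibar (V - {r\<^sub>0}) (goeritz B \<rho> white) m"
    by (rule M_value_exists) simp
  ultimately show ?thesis
    unfolding Let_def V_def[symmetric] counts nbv_def[symmetric] ncv_def[symmetric] by blast
qed

end
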